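(* Let $n,e$ be positive integers and let $\ell,m$ be integers with $e\leqslant \ell<m\leqslant n-\ell$. Let $(Y,\omega)$ be a tight relative $2e$-design in the $n$-cube $\mathcal{Q}_n$ (with respect to a fixed base vertex $x$) supported on the two shells $X_\ell\sqcup X_m$, i.e. $Y\subseteq X_\ell\cup X_m$, $Y_\ell:=Y\cap X_\ell\neq\emptyset$ and $Y_m:=Y\cap X_m\neq\emptyset$. Put $\omega_\ell=\sum_{y\in X_\ell}\omega(y)$, $\omega_m=\sum_{y\in X_m}\omega(y)$ and $$\kappa_e=\frac{\omega_\ell\binom{n-2e}{\ell-e}}{2^{n-2e}\binom{n}{\ell}}+\frac{\omega_m\binom{n-2e}{m-e}}{2^{n-2e}\binom{n}{m}}.$$ For $a,b\in\{\ell,m\}$ let $S_{a,b}(Y)=\{j: \partial(y,z)=j \text{ for some } y\in Y_a,\ z\in Y_b\}$, where $\partial$ is the Hamming distance. Let $\bm{H}$ be the set of all complex matrices $M$ with rows and columns indexed by $Y$ such that, for $a,b\in\{\ell,m\}$, the block $M|_{Y_a\times Y_b}$ is a linear combination of the matrices $A_j|_{Y_a\times Y_b}$, $j\in S_{a,b}(Y)$ (equivalently, $M_{y,z}$ depends only on the pair of shells containing $y$ and $z$ and on $\partial(y,z)$). Then: (i) $\bm{H}$ is a coherent algebra of type $\begin{bmatrix} e+1 & e\\ e & e+1\end{bmatrix}$ (its two fibers being $Y_\ell$ and $Y_m$). (ii) Define the polynomials in $\xi$ $$\psi_e^{\ell,\ell}(\xi)=\sum_{r=0}^{e-1}\Bigl(\tbinom{n}{r}-\tbinom{n}{r-1}\Bigr)\,{}_3F_2\!\left(\begin{matrix}-\xi,-r,r-n-1\\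 \ell-n,-\ell\end{matrix};1\right)+\frac{\omega_\ell\binom{n-2e}{\ell-e}\bigl(\binom{n}{e}-\binom{n}{e-1}\bigr)}{2^{n-2e}\kappa_e\binom{n}{\ell}}\,{}_3F_2\!\left(\begin{matrix}-\xi,-e,e-n-1\\ \ell-n,-\ell\end{matrix};1\right),$$ $\psi_e^{m,m}(\xi)$ the same expression with $\ell$ replaced by $m$ everywhere (including $\omega_\ell$ replaced by $\omega_m$), and $$\psi_e^{\ell,m}(\xi)={}_3F_2\!\left(\begin{matrix}-\xi,-e,e-n-1\\ m-n,-\ell\end{matrix};1\right).$$ Then the sets of zeros of $\psi_e^{\ell,\ell}$, $\psi_e^{m,m}$ and $\psi_e^{\ell,m}$ are, respectively, $\{\xi\neq 0: 2\xi\in S_{\ell,\ell}(Y)\}$, $\{\xi\neq 0: 2\xi\in S_{m,m}(Y)\}$ and $\{\xi: 2\xi+m-\ell\in S_{\ell,m}(Y)\}$. In particular, all zeros of these three polynomials are integers.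
   Context: The $n$-cube $\mathcal{Q}_n$: vertex set $X=\{0,1\}^n$, $\partial$ the Hamming distance, $A_j$ ($0\le j\le n$) the $X\times X$ 0/1 matrix with $(A_j)_{y,z}=1$ iff $\partial(y,z)=j$; $\binom{n}{-1}:=0$. Let $V=\mathbb{C}^X$ with the standard Hermitian inner product and let $E_i$ ($0\le i\le n$) be the orthogonal projection onto the eigenspace of $A_1$ with eigenvalue $n-2i$. A base vertex $x\in X$ is fixed; $\hat x$ is its characteristic vector, $X_i=\{y:\partial(x,y)=i\}$ are the shells, and $E_i^*$ is the diagonal 0/1 matrix with $(E_i^* )_{y,y}=1$ iff $y\in X_i$. A weighted subset is a pair $(Y,\omega)$ with $\omega:X\to[0,\infty)$, viewed as a vector in $V$, and $Y=\{y:\omega(y)>0\}$. It is a relative $t$-design if $E_i\omega\in\operatorname{span}\{E_i\hat x\}$ for $1\le i\le t$. A relative $2e$-design with $Y\subseteq\bigsqcup_{k\in L}X_k$, $Y\cap X_k\ne\emptyset$ ($k\in L$), satisfies $|Y|\ge\dim(\sum_{k\in L}E_k^* )(\sum_{i=0}^eE_iV)$, and it is called tight if equality holds; for $L=\{\ell,m\}$ with $e\le\ell<m\le n-\ell$ this bound equals $\binom{n}{e}+\binom{n}{e-1}$. Generalized hypergeometric series: ${}_3F_2\left(\begin{matrix}a_1,a_2,a_3\\ b_1,b_2\end{matrix};c\right)=\sum_{i\ge0}\frac{(a_1)_i(a_2)_i(a_3)_i}{(b_1)_i(b_2)_i}\frac{c^i}{i!}$ with $(a)_i=a(a+1)\cdots(a+i-1)$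 (here terminating). A coherent algebra on a finite set $Z$ is a subalgebra of $M_Z(\mathbb{C})$ containing the all-ones matrix and closed under entrywise (Hadamard) product and conjugate transpose; it has a unique basis of 0/1 matrices $A_R$ indexed by a partition $\mathscr{R}$ of $Z^2$; the fibers are the sets $\Phi$ with $\{(z,z):z\in\Phi\}\in\mathscr{R}$; its type is the symmetric matrix $[\gamma_{\Phi,\Psi}]$ indexed by fibers where $\gamma_{\Phi,\Psi}$ is the number of $R\in\mathscr{R}$ with $R\subseteq\Phi\times\Psi$. *)

theory Defs
  imports "HOL-Analysis.Analysis" "HOL-Library.Disjoint_Sets"
begin

text \<open>The \<open>n\<close>-cube is the type \<open>bool ^ 'n\<close> with \<open>n = CARD('n)\<close>. Vectors of \<open>V\<close> are of type
  \<open>complex ^ (bool ^ 'n)\<close>; a matrix \<open>M\<close> has the entry \<open>M $ y $ z\<close> in row \<open>y\<close> and column \<open>z\<close>.\<close>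

section \<open>The cube\<close>

definition hamming :: "bool ^ 'n \<Rightarrow> bool ^ 'n \<Rightarrow> nat" where
  "hamming y z = card {i. y $ i \<noteq> z $ i}"

definition shell :: "bool ^ 'n \<Rightarrow> nat \<Rightarrow> (bool ^ 'n) set" where
  "shell x i = {y. hamming x y = i}"

definition dist_matrix :: "nat \<Rightarrow> complex ^ (bool ^ 'n) ^ (bool ^ 'n)" where
  "dist_matrix j = (\<chi> y z. if hamming y z = j then 1 else 0)"

definition dual_idempotent :: "bool ^ 'n \<Rightarrow> nat \<Rightarrow> complex ^ (bool ^ 'n) ^ (bool ^ 'n)" where
  "dual_idempotent x i = (\<chi> y z. if y = z \<and> y \<in> shell x i then 1 else 0)"

definition char_vec :: "'a \<Rightarrow> complex ^ 'a::finite" where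
  "char_vec x = (\<chi> y. if y = x then 1 else 0)"

text \<open>The library's \<open>\<bullet>\<close> on \<open>complex ^ 'a\<close> is only the real part of the Hermitian inner product.\<close>

definition hermitian_inner :: "complex ^ 'a \<Rightarrow> complex ^ 'a::finite \<Rightarrow> complex" where
  "hermitian_inner u v = (\<Sum>y\<in>UNIV. u $ y * cnj (v $ y))"

definition eigenspace :: "complex ^ 'a ^ 'a \<Rightarrow> complex \<Rightarrow> (complex ^ 'a::finite) set" where
  "eigenspace M \<theta> = {v. M *v v = \<theta> *s v}"

definition orthogonal_projection :: "(complex ^ 'a::finite) set \<Rightarrow> complex ^ 'a ^ 'a" where
  "orthogonal_projection S =
     (THE P. \<forall>v. P *v v \<in> S \<and> (\<forall>u\<in>S. hermitian_inner (v - P *v v) u = 0))"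

definition primitive_idempotent :: "nat \<Rightarrow> complex ^ (bool ^ 'n) ^ (bool ^ 'n)" where
  "primitive_idempotent i =
     orthogonal_projection (eigenspace (dist_matrix 1) (of_nat CARD('n) - 2 * of_nat i))"


section \<open>Relative designs\<close>

definition weighted_subset :: "(bool ^ 'n) set \<Rightarrow> (bool ^ 'n \<Rightarrow> real) \<Rightarrow> bool" where
  "weighted_subset Y \<omega> \<longleftrightarrow> (\<forall>y. 0 \<le> \<omega> y) \<and> Y = {y. 0 < \<omega> y}"

definition weight_vec :: "('a \<Rightarrow> real) \<Rightarrow> complex ^ 'a::finite" where
  "weight_vec \<omega> = (\<chi> y. complex_of_real (\<omega> y))"

definition relative_design ::
    "bool ^ 'n \<Rightarrow> nat \<Rightarrow> (bool ^ 'n) set \<Rightarrow> (bool ^ 'n \<Rightarrow> real) \<Rightarrow> bool" where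
  "relative_design x t Y \<omega> \<longleftrightarrow> weighted_subset Y \<omega> \<and>
     (\<forall>i\<in>{1..t}. primitive_idempotent i *v weight_vec \<omega>
                    \<in> vec.span {primitive_idempotent i *v char_vec x})"

text \<open>The subspace \<open>(\<Sum>k\<in>L. E\<^sup>*\<^sub>k) (\<Sum>i\<le>e. E\<^sub>i V)\<close>.\<close>

definition design_space :: "bool ^ 'n \<Rightarrow> nat \<Rightarrow> nat set \<Rightarrow> (complex ^ (bool ^ 'n)) set" where
  "design_space x e L =
     {(\<Sum>k\<in>L. dual_idempotent x k) *v (\<Sum>i\<le>e. primitive_idempotent i *v f i) | f. True}"

definition tight_relative_design ::
    "bool ^ 'n \<Rightarrow> nat \<Rightarrow> nat set \<Rightarrow> (bool ^ 'n) set \<Rightarrow> (bool ^ 'n \<Rightarrow> real) \<Rightarrow> bool" where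
  "tight_relative_design x e L Y \<omega> \<longleftrightarrow>
     relative_design x (2 * e) Y \<omega> \<and>
     Y \<subseteq> (\<Union>k\<in>L. shell x k) \<and> (\<forall>k\<in>L. Y \<inter> shell x k \<noteq> {}) \<and>
     card Y = vec.dim (design_space x e L)"


section \<open>Coherent algebras\<close>

text \<open>Matrices indexed by a subset \<open>Z\<close> of a finite type are represented by matrices over the whole
  type whose entries vanish off \<open>Z \<times> Z\<close>.  Products and sums agree under this identification.\<close>

definition matrices_on :: "'a set \<Rightarrow> (complex ^ 'a ^ 'a::finite) set" where
  "matrices_on Z = {M. \<forall>y z. (y, z) \<notin> Z \<times> Z \<longrightarrow> M $ y $ z = 0}"

definition rel_matrix :: "('a \<times> 'a) set \<Rightarrow> complex ^ 'a ^ 'a::finite" where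
  "rel_matrix R = (\<chi> y z. if (y, z) \<in> R then 1 else 0)"

text \<open>Subalgebras are unital: the identity of \<open>M\<^sub>Z(\<complex>)\<close> is \<open>rel_matrix (Id_on Z)\<close>, the all-ones matrix is
  \<open>rel_matrix (Z \<times> Z)\<close>.\<close>

definition coherent_algebra :: "'a set \<Rightarrow> (complex ^ 'a ^ 'a::finite) set \<Rightarrow> bool" where
  "coherent_algebra Z \<A> \<longleftrightarrow>
     \<A> \<subseteq> matrices_on Z \<and>
     rel_matrix (Id_on Z) \<in> \<A> \<and>
     rel_matrix (Z \<times> Z) \<in> \<A> \<and>
     (\<forall>M\<in>\<A>. \<forall>N\<in>\<A>. M + N \<in> \<A>) \<and>
     (\<forall>c. \<forall>M\<in>\<A>. (\<chi> y z. c * M $ y $ z) \<in> \<A>) \<and>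
     (\<forall>M\<in>\<A>. \<forall>N\<in>\<A>. M ** N \<in> \<A>) \<and>
     (\<forall>M\<in>\<A>. \<forall>N\<in>\<A>. (\<chi> y z. M $ y $ z * N $ y $ z) \<in> \<A>) \<and>
     (\<forall>M\<in>\<A>. (\<chi> y z. cnj (M $ z $ y)) \<in> \<A>)"

text \<open>The matrices \<open>rel_matrix R\<close> of the (nonempty, disjoint) parts of a partition are automatically
  linearly independent, so spanning makes them a basis.\<close>

definition is_coherent_partition ::
    "'a set \<Rightarrow> (complex ^ 'a ^ 'a::finite) set \<Rightarrow> ('a \<times> 'a) set set \<Rightarrow> bool" where
  "is_coherent_partition Z \<A> \<R> \<longleftrightarrow> partition_on (Z \<times> Z) \<R> \<and>
     \<A> = {(\<chi> y z. \<Sum>R\<in>\<R>. c R * rel_matrix R $ y $ z) | c. True}"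

definition coherent_partition ::
    "'a set \<Rightarrow> (complex ^ 'a ^ 'a::finite) set \<Rightarrow> ('a \<times> 'a) set set" where
  "coherent_partition Z \<A> = (THE \<R>. is_coherent_partition Z \<A> \<R>)"

lemma is_coherent_partition_entry:
  assumes "partition_on (Z \<times> Z) \<R>" "R \<in> \<R>" "(y, z) \<in> R"
  shows "(\<Sum>S\<in>\<R>. c S * rel_matrix S $ y $ z) = c R"
proof -
  have fin: "finite \<R>"
    using assms(1) finite_elements[OF _ assms(1)] by auto
  have "c S * rel_matrix S $ y $ z = (if S = R then c R else 0)" if "S \<in> \<R>" for S
    using assms that unfolding rel_matrix_def partition_on_def disjoint_def by fastforce
  then have "(\<Sum>S\<in>\<R>. c S * rel_matrix S $ y $ z) = (\<Sum>S\<in>\<R>. if S = R then c R else 0)"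
    by (intro sum.cong) auto
  with fin assms(2) show ?thesis by simp
qed

lemma is_coherent_partition_subset:
  assumes "is_coherent_partition Z \<A> \<R>" "is_coherent_partition Z \<A> \<S>"
  shows "\<R> \<subseteq> \<S>"
proof
  have classes: "R = {q \<in> Z \<times> Z. \<forall>M\<in>\<A>. M $ fst q $ snd q = M $ fst p $ snd p}"
    if *: "is_coherent_partition Z \<A> P" "R \<in> P" "p \<in> R" for P R p
  proof -
    have P: "partition_on (Z \<times> Z) P"
      and A: "\<A> = {(\<chi> y z. \<Sum>S\<in>P. c S * rel_matrix S $ y $ z) | c. True}"
      using *(1) by (auto simp: is_coherent_partition_def)
    note entry = is_coherent_partition_entry[OF P]
    have sub: "R \<subseteq> Z \<times> Z"
      using P *(2) by (auto simp: partition_on_def)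
    have "M $ fst q $ snd q = M $ fst p $ snd p" if q: "q \<in> R" and M\<A>: "M \<in> \<A>" for q M
    proof -
      obtain c where M: "M = (\<chi> y z. \<Sum>S\<in>P. c S * rel_matrix S $ y $ z)"
        using M\<A> A by auto
      show ?thesis
        using entry[OF *(2), of "fst q" "snd q" c] entry[OF *(2), of "fst p" "snd p" c]
          q *(3) by (simp add: M)
    qed
    moreover have "q \<in> R"
      if qZ: "q \<in> Z \<times> Z"
        and q: "\<forall>M\<in>\<A>. M $ fst q $ snd q = M $ fst p $ snd p" for q
    proof -
      obtain T where T: "T \<in> P" "q \<in> T"
        using P qZ by (auto simp: partition_on_def)
      define c :: "('a \<times> 'a) set \<Rightarrow> complex" where "c = (\<lambda>S. if S = R then 1 else 0)"
      define M where "M = (\<chi> y z. \<Sum>S\<in>P. c S * rel_matrix S $ y $ z)"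
      have "M \<in> \<A>" unfolding A M_def by auto
      then have "M $ fst q $ snd q = M $ fst p $ snd p" using q by auto
      then have "c T = c R"
        using entry[OF T(1), of "fst q" "snd q" c] entry[OF *(2), of "fst p" "snd p" c] T(2) *(3)
        by (simp add: M_def)
      then show ?thesis using T(2) by (auto simp: c_def split: if_splits)
    qed
    ultimately show ?thesis using sub by blast
  qed
  fix R assume R: "R \<in> \<R>"
  have parts: "\<Union>\<R> = Z \<times> Z" "{} \<notin> \<R>" "\<Union>\<S> = Z \<times> Z"
    using assms by (simp_all add: is_coherent_partition_def partition_on_def)
  then have "R \<noteq> {}" using R by metis
  then obtain p where p: "p \<in> R" by blast
  then have "p \<in> \<Union>\<S>" using parts R by auto
  then obtain S where S: "S \<in> \<S>" "p \<in> S" by blast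
  show "R \<in> \<S>"
    using classes[OF assms(1) R p] classes[OF assms(2) S] S(1) by simp
qed

lemma coherent_partition_eqI:
  assumes "is_coherent_partition Z \<A> \<R>"
  shows "coherent_partition Z \<A> = \<R>"
  unfolding coherent_partition_def
  using assms is_coherent_partition_subset by (intro the_equality) blast+

definition fibers :: "'a set \<Rightarrow> (complex ^ 'a ^ 'a::finite) set \<Rightarrow> 'a set set" where
  "fibers Z \<A> = {\<Phi>. Id_on \<Phi> \<in> coherent_partition Z \<A>}"

definition type_entry :: "'a set \<Rightarrow> (complex ^ 'a ^ 'a::finite) set \<Rightarrow> 'a set \<Rightarrow> 'a set \<Rightarrow> nat" where
  "type_entry Z \<A> \<Phi> \<Psi> = card {R \<in> coherent_partition Z \<A>. R \<subseteq> \<Phi> \<times> \<Psi>}"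


section \<open>Distances and matrices attached to a design\<close>

definition shell_distances ::
    "bool ^ 'n \<Rightarrow> (bool ^ 'n) set \<Rightarrow> nat \<Rightarrow> nat \<Rightarrow> nat set" where
  "shell_distances x Y a b = {hamming y z | y z. y \<in> Y \<inter> shell x a \<and> z \<in> Y \<inter> shell x b}"

definition design_algebra ::
    "bool ^ 'n \<Rightarrow> (bool ^ 'n) set \<Rightarrow> nat set \<Rightarrow> (complex ^ (bool ^ 'n) ^ (bool ^ 'n)) set" where
  "design_algebra x Y L = {M \<in> matrices_on Y. \<forall>a\<in>L. \<forall>b\<in>L. \<exists>c.
     \<forall>y\<in>Y \<inter> shell x a. \<forall>z\<in>Y \<inter> shell x b.
       M $ y $ z = (\<Sum>j\<in>shell_distances x Y a b. c j * dist_matrix j $ y $ z)}"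


section \<open>The polynomials\<close>

text \<open>For the nonpositive integer parameters used below, \<open>(a\<^sub>2)\<^sub>i\<close> vanishes no later than
  \<open>(b\<^sub>1)\<^sub>i (b\<^sub>2)\<^sub>i\<close> does; as \<open>0 / 0 = 0\<close>, the series is then the intended terminating sum.\<close>

definition hyp_3F2 ::
    "complex \<Rightarrow> complex \<Rightarrow> complex \<Rightarrow> complex \<Rightarrow> complex \<Rightarrow> complex \<Rightarrow> complex" where
  "hyp_3F2 a1 a2 a3 b1 b2 c =
     (\<Sum>i. (pochhammer a1 i * pochhammer a2 i * pochhammer a3 i) /
            (pochhammer b1 i * pochhammer b2 i) * (c ^ i / fact i))"

definition binomial_diff :: "nat \<Rightarrow> nat \<Rightarrow> real" where
  "binomial_diff n r = real (n choose r) - (if r = 0 then 0 else real (n choose (r - 1)))"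

definition shell_weight :: "bool ^ 'n \<Rightarrow> (bool ^ 'n \<Rightarrow> real) \<Rightarrow> nat \<Rightarrow> real" where
  "shell_weight x \<omega> k = (\<Sum>y\<in>shell x k. \<omega> y)"

definition kappa_part :: "nat \<Rightarrow> nat \<Rightarrow> nat \<Rightarrow> real \<Rightarrow> real" where
  "kappa_part n e k \<omega>\<^sub>k =
     \<omega>\<^sub>k * real ((n - 2 * e) choose (k - e)) / (2 ^ (n - 2 * e) * real (n choose k))"

definition kappa :: "nat \<Rightarrow> nat \<Rightarrow> nat \<Rightarrow> nat \<Rightarrow> real \<Rightarrow> real \<Rightarrow> real" where
  "kappa n e l m \<omega>\<^sub>l \<omega>\<^sub>m = kappa_part n e l \<omega>\<^sub>l + kappa_part n e m \<omega>\<^sub>m"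

text \<open>\<open>psi_diag n e k \<omega>\<^sub>k \<kappa>\<close> is \<open>\<psi>\<^sub>e\<^bsup>k,k\<^esup>\<close> and \<open>psi_off n e l m\<close> is \<open>\<psi>\<^sub>e\<^bsup>l,m\<^esup>\<close>.\<close>

definition psi_diag :: "nat \<Rightarrow> nat \<Rightarrow> nat \<Rightarrow> real \<Rightarrow> real \<Rightarrow> complex \<Rightarrow> complex" where
  "psi_diag n e k \<omega>\<^sub>k \<kappa> \<xi> =
     (\<Sum>r<e. of_real (binomial_diff n r) *
        hyp_3F2 (- \<xi>) (- of_nat r) (of_nat r - of_nat n - 1) (of_nat k - of_nat n) (- of_nat k) 1)
     + of_real (\<omega>\<^sub>k * real ((n - 2 * e) choose (k - e)) * binomial_diff n e /
                (2 ^ (n - 2 * e) * \<kappa> * real (n choose k))) *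
        hyp_3F2 (- \<xi>) (- of_nat e) (of_nat e - of_nat n - 1) (of_nat k - of_nat n) (- of_nat k) 1"

definition psi_off :: "nat \<Rightarrow> nat \<Rightarrow> nat \<Rightarrow> nat \<Rightarrow> complex \<Rightarrow> complex" where
  "psi_off n e l m \<xi> =
     hyp_3F2 (- \<xi>) (- of_nat e) (of_nat e - of_nat n - 1) (of_nat m - of_nat n) (- of_nat l) 1"

end

(* Taking the base vertex as origin, vertices of the cube become subsets and sum_{i<=e} E_i V becomes
   the polynomials of degree at most e. A relative 2e-design integrates polynomials of degree at most
   2e like its symmetrisation, so by tightness the restriction W of the polynomials of degree at most e
   to the two shells is mapped isomorphically onto C^Y, and the reproducing kernel K of W satisfies
   w(y) K(y,z) = delta_{yz} on Y. Under the symmetric group, W splits into two copies of each harmonic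
   space of degree r < e and one diagonal copy of that of degree e; the zonal function of each is an
   eigenfunction of the Johnson graph, which gives the 3F2 expression, and K becomes psi/w on the
   diagonal blocks and a multiple of psi^{l,m} on the off-diagonal one. Hence the psi vanish at all
   separations and the weight is constant on each shell. Annihilator polynomials show that there are
   at least e = deg psi separations, so these are all the zeros. Finally a function of the separation is
   a polynomial of degree at most e - 1 up to a multiple of the identity, and the quadrature turns matrix
   products over Y into sums over a whole shell, which are invariant. *)

theory Submission
  imports Defs
begin

section \<open>Polynomials and quadrature on the subset lattice\<close>

text \<open>\<open>deg_le d\<close> describes the multilinear polynomials of degree at most
  \<open>d\<close> in the 0/1 coordinates of a set. Distances are traded for separations |A - B|:
  between shells a and b the Hamming distance is 2|A - B| + b - a, and |A - B| has degree 1 in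
  either argument. Degree bookkeeping decides every step. The full quadrature has degree 2e;
  isolating one of the two shells costs a factor of degree 1, so on a single layer only degree 2e -
  1 remains. That still suffices for an annihilator of degree below e times a harmonic of degree e,
  for the square of an annihilator, and for a product of two polynomials of degree at most e - 1 in
  separations. The constant \<kappa> is a norm: on the common copy of the harmonic space of degree
  e, the squared norm in the symmetrised weight is 2^(n - 2e) \<kappa> times that of the coefficient
  vector, both shells together. In lower degrees each shell has a norm of its own. The dimension in
  the tightness condition enters only through surjectivity of the restriction to Y; that the kernel
  reproduces is checked directly on its formula.\<close>

definition deg_le :: "nat \<Rightarrow> ('a::finite set \<Rightarrow> real) \<Rightarrow> bool" where
  "deg_le d f \<longleftrightarrow> (\<exists>c. f = (\<lambda>A. \<Sum>T | card T \<le> d. c T * of_bool (T \<subseteq> A)))"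

lemma deg_leI:
  assumes "\<And>A. f A = (\<Sum>T | card T \<le> d. c T * of_bool (T \<subseteq> A))"
  shows "deg_le d f"
  unfolding deg_le_def using assms by (intro exI[of _ c]) auto

lemma deg_le_mono:
  assumes "deg_le d f" "d \<le> d'"
  shows "deg_le d' f"
proof -
  obtain c where c: "f = (\<lambda>A. \<Sum>T | card T \<le> d. c T * of_bool (T \<subseteq> A))"
    using assms(1) by (auto simp: deg_le_def)
  have "f A = (\<Sum>T | card T \<le> d'. (if card T \<le> d then c T else 0) * of_bool (T \<subseteq> A))" for A
    unfolding c using assms(2) by (intro sum.mono_neutral_cong_left) auto
  then show ?thesis by (rule deg_leI)
qed

lemma deg_le_add:
  assumes "deg_le d f" "deg_le d g"
  shows "deg_le d (\<lambda>A. f A + g A)"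
proof -
  obtain c c' where "f = (\<lambda>A. \<Sum>T | card T \<le> d. c T * of_bool (T \<subseteq> A))"
    "g = (\<lambda>A. \<Sum>T | card T \<le> d. c' T * of_bool (T \<subseteq> A))"
    using assms by (auto simp: deg_le_def)
  then have "f A + g A = (\<Sum>T | card T \<le> d. (c T + c' T) * of_bool (T \<subseteq> A))" for A
    unfolding distrib_right sum.distrib by metis
  then show ?thesis by (rule deg_leI)
qed

lemma deg_le_scale:
  assumes "deg_le d f"
  shows "deg_le d (\<lambda>A. a * f A)"
proof -
  obtain c where "f = (\<lambda>A. \<Sum>T | card T \<le> d. c T * of_bool (T \<subseteq> A))"
    using assms by (auto simp: deg_le_def)
  then have "a * f A = (\<Sum>T | card T \<le> d. (a * c T) * of_bool (T \<subseteq> A))" for A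
    unfolding mult.assoc sum_distrib_left[symmetric] by metis
  then show ?thesis by (rule deg_leI)
qed

lemma deg_le_subset:
  assumes "card T \<le> d"
  shows "deg_le d (\<lambda>A. of_bool (T \<subseteq> A))"
proof -
  have "of_bool (T \<subseteq> A) = (\<Sum>S | card S \<le> d. of_bool (S = T) * of_bool (S \<subseteq> A) :: real)" for A
  proof -
    have "(\<Sum>S | card S \<le> d. of_bool (S = T) * of_bool (S \<subseteq> A) :: real)
       = (\<Sum>S | card S \<le> d. if S = T then of_bool (T \<subseteq> A) else 0)"
      by (intro sum.cong) auto
    then show ?thesis using assms by simp
  qed
  then show ?thesis by (rule deg_leI)
qed

lemma deg_le_const: "deg_le d (\<lambda>A. a)"
  using deg_le_scale[OF deg_le_subset[of "{}" d], of a] by simp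

lemma deg_le_diff: "deg_le d f \<Longrightarrow> deg_le d g \<Longrightarrow> deg_le d (\<lambda>A. f A - g A)"
  using deg_le_add[OF _ deg_le_scale[of d g "- 1"], of f] by simp

lemma deg_le_sum:
  assumes "\<And>i. i \<in> I \<Longrightarrow> deg_le d (f i)"
  shows "deg_le d (\<lambda>A. \<Sum>i\<in>I. f i A)"
  using assms
  by (induction I rule: infinite_finite_induct) (auto intro: deg_le_add deg_le_const)

lemma deg_le_mult:
  assumes "deg_le d f" "deg_le d' g"
  shows "deg_le (d + d') (\<lambda>A. f A * g A)"
proof -
  obtain c c' where f: "f = (\<lambda>A. \<Sum>T | card T \<le> d. c T * of_bool (T \<subseteq> A))"
    and g: "g = (\<lambda>A. \<Sum>T | card T \<le> d'. c' T * of_bool (T \<subseteq> A))"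
    using assms by (auto simp: deg_le_def)
  have "(\<lambda>A. f A * g A) =
    (\<lambda>A. \<Sum>T | card T \<le> d. \<Sum>S | card S \<le> d'. c T * c' S * of_bool (T \<union> S \<subseteq> A))"
    unfolding f g sum_product by (intro ext sum.cong) auto
  moreover have "deg_le (d + d') (\<lambda>A. c T * c' S * of_bool (T \<union> S \<subseteq> A))" if "card T \<le> d" "card S \<le> d'" for T S
    by (intro deg_le_scale deg_le_subset) (use card_Un_le[of T S] that in linarith)
  moreover have "deg_le (d + d') (\<lambda>A. \<Sum>T | card T \<le> d. \<Sum>S | card S \<le> d'. c T * c' S * of_bool (T \<union> S \<subseteq> A))"
    by (intro deg_le_sum) (use calculation(2) in simp)
  ultimately show ?thesis by simp
qed

lemma deg_le_prod:
  assumes "\<And>i. i \<in> I \<Longrightarrow> deg_le 1 (f i)" "finite I"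
  shows "deg_le (card I) (\<lambda>A. \<Prod>i\<in>I. f i A)"
  using assms(2,1)
proof (induction I rule: finite_induct)
  case (insert i I)
  then have "deg_le (1 + card I) (\<lambda>A. f i A * (\<Prod>i\<in>I. f i A))"
    by (intro deg_le_mult) auto
  then show ?case using insert by simp
qed (simp add: deg_le_const)

lemma deg_le_power:
  assumes "deg_le 1 f"
  shows "deg_le i (\<lambda>A. f A ^ i)"
  using deg_le_prod[of "{..<i}" "\<lambda>_. f"] assms by simp

text \<open>The count is the sum of the coordinates in \<open>z\<close>. With the variants below, a
  polynomial of degree i in a separation has degree at most i as a function on the cube.\<close>

lemma deg_le_card_Int: "deg_le 1 (\<lambda>A. real (card (A \<inter> z)))"
proof -
  have "(\<lambda>A. real (card (A \<inter> z))) = (\<lambda>A. \<Sum>j\<in>z. of_bool ({j} \<subseteq> A))"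
    by (intro ext) (simp add: Int_commute Collect_mem_eq[symmetric] Collect_conj_eq[symmetric] del: Collect_mem_eq)
  then show ?thesis by (simp only:) (intro deg_le_sum deg_le_subset; simp)
qed

lemma deg_le_card: "deg_le 1 (\<lambda>A. real (card A))"
  using deg_le_card_Int[of UNIV] by simp

lemma deg_le_card_Diff: "deg_le 1 (\<lambda>A. real (card (A - z)))"
  using deg_le_card_Int[of "-z"] by (simp add: Diff_eq)

lemma deg_le_card_Diff': "deg_le 1 (\<lambda>A. real (card (z - A)))"
proof -
  have "card (z - A) = card z - card (A \<inter> z)" "card (A \<inter> z) \<le> card z" for A
    by (metis Diff_Int2 Int_commute card_Diff_subset_Int finite Int_absorb, simp add: card_mono)
  then have "(\<lambda>A. real (card (z - A))) = (\<lambda>A. real (card z) - real (card (A \<inter> z)))"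
    by (simp add: of_nat_diff)
  then show ?thesis using deg_le_diff[OF deg_le_const deg_le_card_Int] by simp
qed


section \<open>Characters of the cube\<close>

definition chi :: "'a::finite set \<Rightarrow> 'a set \<Rightarrow> real" where
  "chi S A = (\<Prod>j\<in>S. if j \<in> A then - 1 else 1)"

text \<open>Both sides are -1 to the power |S \<inter> A|; \<open>chi\<close> is the character table
  of the group of subsets under symmetric difference.\<close>

lemma chi_commute: "chi S A = chi A S"
  unfolding chi_def by (simp add: prod.If_cases Int_commute)

lemma chi_empty: "chi S {} = 1"
  by (simp add: chi_def)

lemma deg_le_chi: "deg_le (card S) (chi S)"
proof -
  have "chi S = (\<lambda>A. \<Prod>j\<in>S. 1 - 2 * of_bool ({j} \<subseteq> A))"
    unfolding chi_def by (auto intro!: prod.cong)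
  then show ?thesis
    by (simp only:) (intro deg_le_prod deg_le_diff deg_le_const deg_le_scale deg_le_subset; simp)
qed

lemma sum_Pow_prod:
  fixes g :: "'a \<Rightarrow> 'b::comm_semiring_1"
  assumes "finite U"
  shows "(\<Sum>S\<in>Pow U. \<Prod>j\<in>S. g j) = (\<Prod>j\<in>U. 1 + g j)"
  using assms
proof (induction U rule: finite_induct)
  case (insert a U)
  have inj: "inj_on (insert a) (Pow U)"
    using insert.hyps(2) by (auto simp: inj_on_def)
  have "(\<Sum>S\<in>insert a ` Pow U. \<Prod>j\<in>S. g j) = (\<Sum>S\<in>Pow U. g a * (\<Prod>j\<in>S. g j))"
    unfolding sum.reindex[OF inj] o_def using insert.hyps
    by (intro sum.cong refl prod.insert) (auto intro: finite_subset)
  moreover have "Pow U \<inter> insert a ` Pow U = {}" using insert.hyps(2) by auto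
  ultimately show ?case using insert
    by (simp add: Pow_insert sum.union_disjoint sum_distrib_left[symmetric] algebra_simps)
qed auto

lemma sum_chi_chi:
  fixes A B :: "'a::finite set"
  shows "(\<Sum>S\<in>UNIV. chi S A * chi S B) = (if A = B then 2 ^ CARD('a) else 0)"
proof -
  let ?g = "\<lambda>j. (if j \<in> A then - 1 else 1 :: real) * (if j \<in> B then - 1 else 1)"
  have "(\<Sum>S\<in>UNIV. chi S A * chi S B) = (\<Sum>S\<in>Pow UNIV. \<Prod>j\<in>S. ?g j)"
    unfolding chi_def prod.distrib by simp
  also have "\<dots> = (\<Prod>j\<in>UNIV. 1 + ?g j)" by (rule sum_Pow_prod) simp
  also have "\<dots> = (if A = B then 2 ^ CARD('a) else 0)"
  proof (cases "A = B")
    case True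
    then have "(\<Prod>j\<in>UNIV. 1 + ?g j) = (\<Prod>j\<in>(UNIV::'a set). 2)" by (intro prod.cong) auto
    then show ?thesis using True by simp
  next
    case False
    \<comment> \<open>At a point lying in exactly one of \<open>A\<close> and \<open>B\<close> the
      two signs differ, and the factor vanishes.\<close>
    then obtain j where "j \<in> A \<longleftrightarrow> j \<notin> B" by blast
    then have "1 + ?g j = 0" by auto
    then have "(\<Prod>j\<in>UNIV. 1 + ?g j) = 0" by (meson UNIV_I finite prod_zero)
    then show ?thesis using False by simp
  qed
  finally show ?thesis .
qed

text \<open>The indicator is the product over j in \<open>T\<close> of (1 - sign of j) / 2, where
  the sign is -1 exactly for j in \<open>A\<close>; multiplying out gives the alternating sum of
  characters.\<close>

lemma subset_eq_sum_chi:
  fixes T :: "'a::finite set"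
  shows "of_bool (T \<subseteq> A) = (\<Sum>S\<in>Pow T. (- 1) ^ card S * chi S A) / 2 ^ card T"
proof -
  have "(\<Sum>S\<in>Pow T. (- 1) ^ card S * chi S A)
      = (\<Sum>S\<in>Pow T. \<Prod>j\<in>S. if j \<in> A then 1 else - 1 :: real)"
  proof (intro sum.cong refl)
    fix S
    have "(- 1) ^ card S * chi S A = (\<Prod>j\<in>S. (- 1) * (if j \<in> A then - 1 else 1 :: real))"
      unfolding chi_def prod.distrib by simp
    also have "\<dots> = (\<Prod>j\<in>S. if j \<in> A then 1 else - 1)" by (intro prod.cong) auto
    finally show "(- 1) ^ card S * chi S A = (\<Prod>j\<in>S. if j \<in> A then 1 else - 1)" .
  qed
  also have "\<dots> = (\<Prod>j\<in>T. 1 + (if j \<in> A then 1 else - 1))" by (rule sum_Pow_prod) simp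
  also have "\<dots> = (\<Prod>j\<in>T. 2 * of_bool (j \<in> A))" by (intro prod.cong) auto
  also have "\<dots> = 2 ^ card T * of_bool (T \<subseteq> A)"
    by (auto simp: prod.distrib intro!: prod.neutral)
  finally show ?thesis by simp
qed

lemma sum_Pow_card:
  fixes h :: "nat \<Rightarrow> real"
  assumes "finite T"
  shows "(\<Sum>S\<in>Pow T. h (card S)) = (\<Sum>i\<le>card T. real (card T choose i) * h i)"
proof -
  have "(\<Sum>S\<in>Pow T. h (card S)) = (\<Sum>i\<le>card T. \<Sum>S | S \<in> Pow T \<and> card S = i. h (card S))"
    using assms by (intro sum.group[symmetric]) (auto intro: card_mono)
  also have "\<dots> = (\<Sum>i\<le>card T. real (card T choose i) * h i)"
    using assms by (intro sum.cong refl) (simp add: n_subsets)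
  finally show ?thesis .
qed

lemma card_supersets:
  fixes T :: "'a::finite set"
  assumes "card T \<le> k"
  shows "card {A. T \<subseteq> A \<and> card A = k} = (CARD('a) - card T) choose (k - card T)"
proof -
  have "bij_betw (\<lambda>B. B - T) {A. T \<subseteq> A \<and> card A = k} {B. B \<subseteq> - T \<and> card B = k - card T}"
    using assms
    by (intro bij_betwI[where g = "\<lambda>B. B \<union> T"])
       (auto simp: card_Diff_subset card_Un_disjoint intro!: card_Un_disjoint[THEN trans])
  then have "card {A. T \<subseteq> A \<and> card A = k} = card {B. B \<subseteq> - T \<and> card B = k - card T}"
    by (rule bij_betw_same_card)
  also have "\<dots> = card (- T) choose (k - card T)" by (simp add: n_subsets)
  finally show ?thesis by (simp add: card_Diff_subset Compl_eq_Diff_UNIV)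
qed

lemma sum_of_bool_Collect:
  "(\<Sum>x | P x. of_bool (Q x) :: real) = real (card {x :: 'a::finite. Q x \<and> P x})"
proof -
  have "(\<Sum>x | P x. of_bool (Q x) :: real) = (\<Sum>x | Q x \<and> P x. 1)"
    by (rule sum.mono_neutral_cong_right) auto
  then show ?thesis by simp
qed

text \<open>Averaging over a shell is symmetrisation under all permutations of the points.\<close>

definition shell_avg :: "('a::finite set \<Rightarrow> real) \<Rightarrow> nat \<Rightarrow> real" where
  "shell_avg f k = (\<Sum>A | card A = k. f A) / real (CARD('a) choose k)"

lemma choose_pos_UNIV: "(CARD('a::finite) choose card (A :: 'a set)) > 0"
  by (intro zero_less_binomial card_mono) auto

text \<open>Expanding a monomial in characters shows that its integral depends only on its degree; averaging
  over all monomials of that degree then yields the symmetrised integral.\<close>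

lemma quadrature_of_moments:
  fixes w :: "'a::finite set \<Rightarrow> real"
  assumes moments: "\<And>S. card S \<le> t \<Longrightarrow> (\<Sum>A\<in>UNIV. w A * chi S A) = c (card S)"
    and "deg_le t f"
  shows "(\<Sum>A\<in>UNIV. w A * f A) = (\<Sum>A\<in>UNIV. w A * shell_avg f (card A))"
proof -
  \<comment> \<open>By \<open>subset_eq_sum_chi\<close>, the integral of every monomial of degree j
    is d j.\<close>
  define d where "d = (\<lambda>t. (\<Sum>i\<le>t. real (t choose i) * ((- 1) ^ i * c i)) / 2 ^ t)"
  have 1: "(\<Sum>A\<in>UNIV. w A * of_bool (T \<subseteq> A)) = d (card T)" if "card T \<le> t" for T
  proof -
    have "(\<Sum>A\<in>UNIV. w A * of_bool (T \<subseteq> A))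
        = (\<Sum>S\<in>Pow T. (- 1) ^ card S * (\<Sum>A\<in>UNIV. w A * chi S A)) / 2 ^ card T"
      unfolding subset_eq_sum_chi sum_distrib_left sum_divide_distrib
      by (subst sum.swap) (simp add: algebra_simps)
    also have "\<dots> = (\<Sum>S\<in>Pow T. (- 1) ^ card S * c (card S)) / 2 ^ card T"
    proof -
      have "card S \<le> t" if "S \<in> Pow T" for S
        using that \<open>card T \<le> t\<close> card_mono[of T S] by simp
      then show ?thesis
        by (intro arg_cong2[of _ _ _ _ "(/)"] sum.cong refl) (simp add: moments)
    qed
    also have "\<dots> = d (card T)"
      unfolding d_def using sum_Pow_card[of T "\<lambda>i. (- 1) ^ i * c i"] by simp
    finally show ?thesis .
  qed
  have 2: "(\<Sum>A\<in>UNIV. w A * of_bool (T \<subseteq> A))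
         = (\<Sum>A\<in>UNIV. w A * shell_avg (\<lambda>A. of_bool (T \<subseteq> A)) (card A))" if T: "card T \<le> t" for T
  proof -
    have pos: "real (CARD('a) choose card T) > 0" using choose_pos_UNIV by simp
    \<comment> \<open>Summing over all sets of the size of \<open>T\<close> and exchanging sums
      counts the subsets of that size in each \<open>A\<close>, which is a multiple of the shell
      average.\<close>
    have "real (CARD('a) choose card T) * d (card T) = (\<Sum>S :: 'a set | card S = card T. d (card S))"
      using n_subsets[of "UNIV :: 'a set" "card T"] by simp
    also have "\<dots> = (\<Sum>S | card S = card T. \<Sum>A\<in>UNIV. w A * of_bool (S \<subseteq> A))"
      using 1 T by (intro sum.cong) auto
    also have "\<dots> = (\<Sum>A\<in>UNIV. w A * real (card A choose card T))"
    proof -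
      have "(\<Sum>S | card S = card T. of_bool (S \<subseteq> A)) = real (card A choose card T)" for A :: "'a set"
        unfolding sum_of_bool_Collect using n_subsets[of A "card T"] by simp
      then show ?thesis by (subst sum.swap) (simp add: sum_distrib_left[symmetric])
    qed
    also have "\<dots> = (\<Sum>A\<in>UNIV. w A * (real (CARD('a) choose card T) *
                       shell_avg (\<lambda>A. of_bool (T \<subseteq> A)) (card A)))"
    proof (intro sum.cong refl arg_cong2[of _ _ _ _ "(*)"])
      fix A :: "'a set"
      have cnt: "(\<Sum>B | card B = card A. of_bool (T \<subseteq> B)) = real (card {B. T \<subseteq> B \<and> card B = card A})"
        by (rule sum_of_bool_Collect)
      show "real (card A choose card T)
          = real (CARD('a) choose card T) * shell_avg (\<lambda>A. of_bool (T \<subseteq> A)) (card A)"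
      \<comment> \<open>\<open>card_supersets\<close> and the binomial revision apply only if a
        superset of that size can exist; otherwise both sides vanish.\<close>
      proof (cases "card T \<le> card A")
        case True
        have "(CARD('a) choose card A) * (card A choose card T)
            = (CARD('a) choose card T) * ((CARD('a) - card T) choose (card A - card T))"
          using True by (intro choose_mult) (auto intro: card_mono)
        then have "real (CARD('a) choose card A) * real (card A choose card T)
            = real (CARD('a) choose card T) * real ((CARD('a) - card T) choose (card A - card T))"
          by (metis of_nat_mult)
        then show ?thesis using choose_pos_UNIV[of A]
          by (simp add: shell_avg_def cnt card_supersets[OF True] field_simps)
      next
        case False
        have "\<not> (T \<subseteq> B \<and> card B = card A)" for B
          using False card_mono[of B T] by auto
        then have "{B. T \<subseteq> B \<and> card B = card A} = {}" by blast
        then show ?thesis using False unfolding shell_avg_def cnt by (simp only:) (simp add: binomial_eq_0)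
      qed
    qed
    finally have "real (CARD('a) choose card T) * d (card T) = real (CARD('a) choose card T) *
        (\<Sum>A\<in>UNIV. w A * shell_avg (\<lambda>A. of_bool (T \<subseteq> A)) (card A))"
      by (simp add: sum_distrib_left algebra_simps)
    then show ?thesis using pos 1[OF T] by simp
  qed
  obtain c' where f: "f = (\<lambda>A. \<Sum>T | card T \<le> t. c' T * of_bool (T \<subseteq> A))"
    using assms(2) by (auto simp: deg_le_def)
  have avg: "shell_avg f k = (\<Sum>T | card T \<le> t. c' T * shell_avg (\<lambda>A. of_bool (T \<subseteq> A)) k)" for k
    unfolding f shell_avg_def by (subst sum.swap) (simp add: sum_distrib_left sum_divide_distrib mult.commute)
  have "(\<Sum>A\<in>UNIV. w A * f A) = (\<Sum>T | card T \<le> t. c' T * (\<Sum>A\<in>UNIV. w A * of_bool (T \<subseteq> A)))"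
    unfolding f sum_distrib_left by (subst sum.swap) (simp add: algebra_simps)
  also have "\<dots> = (\<Sum>T | card T \<le> t. c' T *
                     (\<Sum>A\<in>UNIV. w A * shell_avg (\<lambda>A. of_bool (T \<subseteq> A)) (card A)))"
    using 2 by (intro sum.cong) auto
  also have "\<dots> = (\<Sum>A\<in>UNIV. w A * shell_avg f (card A))"
    unfolding avg sum_distrib_left by (subst sum.swap) (simp add: algebra_simps)
  finally show ?thesis .
qed

section \<open>Harmonic functions\<close>

definition homogeneous :: "nat \<Rightarrow> (real ^ ('a::finite set)) set" where
  "homogeneous r = {v. \<forall>S. card S \<noteq> r \<longrightarrow> v $ S = 0}"

text \<open>Raising operator of the subset lattice; \<open>down\<close> is its adjoint
  (\<open>inner_up\<close>), and their commutator is scalar on each level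
  (\<open>down_up\<close>).\<close>

definition up :: "real ^ ('a::finite set) \<Rightarrow> real ^ ('a set)" where
  "up v = (\<chi> A. \<Sum>b\<in>A. v $ (A - {b}))"

definition down :: "real ^ ('a::finite set) \<Rightarrow> real ^ ('a set)" where
  "down v = (\<chi> A. \<Sum>a\<in>- A. v $ insert a A)"

text \<open>Kernel of the lowering operator on one level, as coefficient vectors. One such space
  serves all shells at once through \<open>lift\<close>.\<close>

definition harmonic :: "nat \<Rightarrow> (real ^ ('a::finite set)) set" where
  "harmonic r = {v \<in> homogeneous r. down v = 0}"

text \<open>The multilinear polynomial with coefficients \<open>v\<close>, evaluated at the 0/1
  vector of \<open>A\<close>.\<close>

definition lift :: "real ^ ('a::finite set) \<Rightarrow> 'a set \<Rightarrow> real" where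
  "lift v A = (\<Sum>S\<in>Pow A. v $ S)"

lemma linear_up: "linear up"
  by (rule linearI) (simp_all add: up_def vec_eq_iff sum.distrib sum_distrib_left)

lemma linear_down: "linear down"
  by (rule linearI) (simp_all add: down_def vec_eq_iff sum.distrib sum_distrib_left)

lemma linear_lift: "linear (\<lambda>v. lift v A)"
  by (rule linearI) (simp_all add: lift_def sum.distrib sum_distrib_left)

lemma subspace_homogeneous: "subspace (homogeneous r)"
  by (simp add: subspace_def homogeneous_def)

lemma subspace_harmonic: "subspace (harmonic r)"
  using subspace_homogeneous[of r]
  by (auto simp: subspace_def harmonic_def linear_add[OF linear_down] linear_cmul[OF linear_down]
      linear_0[OF linear_down])

text \<open>Both sides enumerate the pairs of a set and a set obtained from it by adding one point.\<close>

lemma sum_remove_swap: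
  fixes F :: "'a::finite set \<Rightarrow> 'a set \<Rightarrow> 'b::comm_monoid_add"
  shows "(\<Sum>A\<in>UNIV. \<Sum>b\<in>A. F A (A - {b})) = (\<Sum>B\<in>UNIV. \<Sum>a\<in>- B. F (insert a B) B)"
proof -
  have "(\<Sum>A\<in>UNIV. \<Sum>b\<in>A. F A (A - {b})) = (\<Sum>(A, b)\<in>(SIGMA A:UNIV. A). F A (A - {b}))"
    by (rule sum.Sigma) auto
  also have "\<dots> = (\<Sum>(B, a)\<in>(SIGMA B:UNIV. - B). F (insert a B) B)"
    by (rule sum.reindex_bij_witness[where i = "\<lambda>(B, a). (insert a B, a)"
          and j = "\<lambda>(A, b). (A - {b}, b)"]) (auto simp: insert_absorb)
  also have "\<dots> = (\<Sum>B\<in>UNIV. \<Sum>a\<in>- B. F (insert a B) B)"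
    by (rule sum.Sigma[symmetric]) auto
  finally show ?thesis .
qed

lemma inner_up: "up v \<bullet> w = v \<bullet> down w"
proof -
  have "up v \<bullet> w = (\<Sum>A\<in>UNIV. \<Sum>b\<in>A. v $ (A - {b}) * w $ A)"
    by (simp add: inner_vec_def up_def sum_distrib_right)
  also have "\<dots> = (\<Sum>B\<in>UNIV. \<Sum>a\<in>- B. v $ B * w $ insert a B)"
    by (rule sum_remove_swap[of "\<lambda>A B. v $ B * w $ A"])
  also have "\<dots> = v \<bullet> down w"
    by (simp add: inner_vec_def down_def sum_distrib_left)
  finally show ?thesis .
qed

lemma up_homogeneous: "v \<in> homogeneous r \<Longrightarrow> up v \<in> homogeneous (Suc r)"
  unfolding homogeneous_def up_def
proof (clarsimp, rule sum.neutral, rule ballI)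
  fix S :: "'a set" and b assume "\<forall>S. card S \<noteq> r \<longrightarrow> v $ S = 0" "card S \<noteq> Suc r" "b \<in> S"
  then show "v $ (S - {b}) = 0"
    by (metis card_Suc_Diff1 finite)
qed

lemma down_homogeneous: "v \<in> homogeneous (Suc r) \<Longrightarrow> down v \<in> homogeneous r"
proof -
  assume v: "v \<in> homogeneous (Suc r)"
  have "v $ insert a S = 0" if "card S \<noteq> r" "a \<in> - S" for S a
  proof -
    have "card (insert a S) \<noteq> Suc r" using that by simp
    then show ?thesis using v unfolding homogeneous_def by blast
  qed
  then have "down v $ S = 0" if "card S \<noteq> r" for S
    using that unfolding down_def by (simp only: vec_lambda_beta) (simp add: sum.neutral)
  then show ?thesis by (simp add: homogeneous_def)
qed

text \<open>Adding then removing, and removing then adding, reach the same sets by exchanging two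
  different points. What remains are the returns to \<open>A\<close>: n - |A| in one order, |A| in
  the other.\<close>

lemma down_up:
  fixes v :: "real ^ ('a::finite set)"
  shows "down (up v) $ A - up (down v) $ A = (real CARD('a) - 2 * real (card A)) * v $ A"
proof -
  have 1: "(\<Sum>b\<in>insert a A. v $ (insert a A - {b})) = v $ A + (\<Sum>b\<in>A. v $ insert a (A - {b}))"
    if "a \<in> - A" for a
  proof -
    have "(\<Sum>b\<in>A. v $ (insert a A - {b})) = (\<Sum>b\<in>A. v $ insert a (A - {b}))"
      using that by (intro sum.cong refl arg_cong[of _ _ "($) v"]) auto
    then show ?thesis using that by simp
  qed
  have 2: "(\<Sum>a\<in>- (A - {b}). v $ insert a (A - {b})) = v $ A + (\<Sum>a\<in>- A. v $ insert a (A - {b}))"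
    if "b \<in> A" for b
  proof -
    have "- (A - {b}) = insert b (- A)" using that by auto
    then show ?thesis using that by (simp add: insert_absorb)
  qed
  have "down (up v) $ A = real (card (- A)) * v $ A + (\<Sum>a\<in>- A. \<Sum>b\<in>A. v $ insert a (A - {b}))"
    using 1 by (simp add: down_def up_def sum.distrib)
  moreover have "up (down v) $ A = real (card A) * v $ A + (\<Sum>b\<in>A. \<Sum>a\<in>- A. v $ insert a (A - {b}))"
    using 2 by (simp add: down_def up_def sum.distrib)
  moreover have "real (card (- A)) = real CARD('a) - real (card A)"
    by (simp add: Compl_eq_Diff_UNIV card_Diff_subset card_mono of_nat_diff)
  ultimately show ?thesis
    using sum.swap[of "\<lambda>a b. v $ insert a (A - {b})" A "- A"] by (simp add: algebra_simps)
qed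

text \<open>Pairing the commutator relation with \<open>v\<close> gives |up v|^2 = |down v|^2 + (n -
  2r)|v|^2, and n - 2r is positive below the middle level.\<close>

lemma up_eq_0_imp:
  fixes v :: "real ^ ('a::finite set)"
  assumes "v \<in> homogeneous r" "2 * r < CARD('a)" "up v = 0"
  shows "v = 0"
proof -
  have "down (up v) = up (down v) + (real CARD('a) - 2 * real r) *\<^sub>R v"
  proof (rule vec_eq_iff[THEN iffD2], rule allI)
    fix A :: "'a set"
    show "down (up v) $ A = (up (down v) + (real CARD('a) - 2 * real r) *\<^sub>R v) $ A"
      using down_up[of v A] assms(1)
      by (cases "card A = r") (auto simp: homogeneous_def algebra_simps)
  qed
  then have "v \<bullet> down (up v) = v \<bullet> up (down v) + (real CARD('a) - 2 * real r) * (v \<bullet> v)"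
    by (simp add: inner_add_right)
  moreover have "v \<bullet> down (up v) = 0" by (simp add: assms(3) linear_0[OF linear_down])
  moreover have "v \<bullet> up (down v) = down v \<bullet> down v"
    by (metis inner_up inner_commute)
  ultimately have "down v \<bullet> down v + (real CARD('a) - 2 * real r) * (v \<bullet> v) = 0" by simp
  moreover have "down v \<bullet> down v \<ge> 0" "v \<bullet> v \<ge> 0" by auto
  moreover have "real CARD('a) - 2 * real r > 0" using assms(2) by linarith
  ultimately have "v \<bullet> v = 0"
    by (smt (verit) mult_pos_pos)
  then show ?thesis by simp
qed

lemma dim_homogeneous: "dim (homogeneous r :: (real ^ ('a::finite set)) set) = CARD('a) choose r"
proof -
  have "homogeneous r = {v :: real ^ ('a set). \<forall>S. S \<notin> {S. card S = r} \<longrightarrow> v $ S = 0}"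
    by (auto simp: homogeneous_def)
  then have "vec.dim (homogeneous r :: (real ^ ('a set)) set) = card {S :: 'a set. card S = r}"
    using dim_substandard_cart[where 'a = real, of "{S :: 'a set. card S = r}"] by simp
  then show ?thesis
    using n_subsets[of "UNIV :: 'a set" r] by (simp add: dim_vec_eq)
qed

text \<open>The decisive test vector is \<open>up (down v)\<close>: its inner product with
  \<open>v\<close> is the squared norm of \<open>down v\<close>.\<close>

lemma harmonic_eq_orthogonal:
  "harmonic (Suc r) = {v \<in> homogeneous (Suc r). \<forall>u\<in>up ` homogeneous r. orthogonal u v}"
proof -
  have "down v = 0" if v: "v \<in> homogeneous (Suc r)" and o: "\<forall>u\<in>up ` homogeneous r. orthogonal u v" for v
  proof -
    have "orthogonal (up (down v)) v" using o down_homogeneous[OF v] by blast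
    then show ?thesis by (simp add: orthogonal_def inner_up)
  qed
  then show ?thesis by (auto simp: harmonic_def orthogonal_def inner_up)
qed

lemma subspace_up_homogeneous: "subspace (up ` homogeneous r)"
  using linear_up subspace_homogeneous by (rule linear_subspace_image)

text \<open>\<open>harmonic r\<close> is the orthogonal complement of the raised level r - 1, and
  raising is injective there.\<close>

lemma dim_harmonic:
  assumes "2 * r \<le> CARD('a::finite)"
  shows "real (dim (harmonic r :: (real ^ ('a set)) set)) = binomial_diff CARD('a) r"
proof (cases r)
  case 0
  have "down v = 0" if "v \<in> homogeneous 0" for v :: "real ^ ('a set)"
    using that by (simp add: down_def vec_eq_iff homogeneous_def)
  then have "harmonic r = (homogeneous 0 :: (real ^ ('a set)) set)" using 0 by (auto simp: harmonic_def)
  then show ?thesis using 0 by (simp add: dim_homogeneous binomial_diff_def)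
next
  case (Suc s)
  have "inj_on up (homogeneous s :: (real ^ ('a set)) set)"
  proof (rule inj_onI)
    fix v w :: "real ^ ('a set)"
    assume "v \<in> homogeneous s" "w \<in> homogeneous s" "up v = up w"
    then have "v - w \<in> homogeneous s" "up (v - w) = 0"
      using linear_diff[OF linear_up, of v w] by (auto simp: homogeneous_def)
    moreover have "2 * s < CARD('a)" using assms Suc by linarith
    ultimately have "v - w = 0" using up_eq_0_imp by blast
    then show "v = w" by simp
  qed
  then have "dim (up ` homogeneous s :: (real ^ ('a set)) set) = CARD('a) choose s"
    using dim_image_eq[OF linear_up, of "homogeneous s :: (real ^ ('a set)) set"]
    unfolding span_eq_iff[THEN iffD2, OF subspace_homogeneous] dim_homogeneous by simp
  moreover have "dim (harmonic r :: (real ^ ('a set)) set) + dim (up ` homogeneous s :: (real ^ ('a set)) set)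
      = dim (homogeneous r :: (real ^ ('a set)) set)"
    unfolding Suc harmonic_eq_orthogonal
    using up_homogeneous
    by (intro dim_subspace_orthogonal_to_vectors subspace_homogeneous subspace_up_homogeneous) blast
  ultimately have "dim (harmonic r :: (real ^ ('a set)) set) + (CARD('a) choose s) = CARD('a) choose r"
    by (simp only: dim_homogeneous)
  then have "real (dim (harmonic r :: (real ^ ('a set)) set)) + real (CARD('a) choose s)
      = real (CARD('a) choose r)"
    by (metis of_nat_add)
  then show ?thesis unfolding binomial_diff_def Suc by simp
qed

lemma lift_eq_0: "v \<in> homogeneous r \<Longrightarrow> card A < r \<Longrightarrow> lift v A = 0"
  unfolding lift_def
proof (intro sum.neutral ballI)
  fix S assume "v \<in> homogeneous r" "card A < r" "S \<in> Pow A"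
  then have "card S \<noteq> r" using card_mono[of A S] by auto
  then show "v $ S = 0" using \<open>v \<in> homogeneous r\<close> by (simp add: homogeneous_def)
qed

lemma lift_eq_self:
  assumes "v \<in> homogeneous r" "card A = r"
  shows "lift v A = v $ A"
proof -
  have "lift v A = (\<Sum>S\<in>Pow A. if S = A then v $ A else 0)"
    unfolding lift_def
  proof (intro sum.cong refl)
    fix S assume "S \<in> Pow A"
    then have "card S \<noteq> r" if "S \<noteq> A" using that assms(2) card_subset_eq[of A S] by auto
    then show "v $ S = (if S = A then v $ A else 0)" using assms(1) by (auto simp: homogeneous_def)
  qed
  then show ?thesis by simp
qed

lemma deg_le_lift:
  assumes "v \<in> homogeneous r"
  shows "deg_le r (lift v)"
proof (rule deg_leI)
  fix A :: "'a set"
  have "lift v A = (\<Sum>S\<in>UNIV. v $ S * of_bool (S \<subseteq> A))"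
    unfolding lift_def by (intro sum.mono_neutral_cong_left) auto
  also have "\<dots> = (\<Sum>S | card S \<le> r. v $ S * of_bool (S \<subseteq> A))"
    using assms by (intro sum.mono_neutral_right) (auto simp: homogeneous_def)
  finally show "lift v A = (\<Sum>S | card S \<le> r. v $ S * of_bool (S \<subseteq> A))" .
qed

lemma sum_card_lift:
  assumes "v \<in> homogeneous r"
  shows "(\<Sum>S\<in>Pow A. real (card S) * v $ S) = real r * lift v A"
  unfolding lift_def sum_distrib_left using assms
  by (intro sum.cong refl) (auto simp: homogeneous_def)

text \<open>A subset S of \<open>A\<close> survives |A - S| of the removals, and only subsets of
  size r carry a coefficient.\<close>

lemma lift_remove:
  assumes "v \<in> homogeneous r"
  shows "(\<Sum>b\<in>A. lift v (A - {b})) = (real (card A) - real r) * lift v A"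
proof -
  have "(\<Sum>b\<in>A. lift v (A - {b})) = (\<Sum>b\<in>A. \<Sum>S\<in>Pow A. if b \<notin> S then v $ S else 0)"
    unfolding lift_def
    by (intro sum.cong refl sum.mono_neutral_cong_left) auto
  also have "\<dots> = (\<Sum>S\<in>Pow A. real (card (A - S)) * v $ S)"
    by (subst sum.swap) (simp add: sum.If_cases Diff_eq Collect_neg_eq[symmetric] Compl_eq)
  also have "\<dots> = (\<Sum>S\<in>Pow A. real (card A) * v $ S - real (card S) * v $ S)"
    by (intro sum.cong refl) (auto simp: card_Diff_subset of_nat_diff card_mono algebra_simps)
  also have "\<dots> = real (card A) * lift v A - real r * lift v A"
    by (simp add: sum_subtractf sum_card_lift[OF assms] lift_def sum_distrib_left)
  finally show ?thesis by (simp add: algebra_simps)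
qed

text \<open>Each insertion gives \<open>lift v A\<close> once more and a sum over the new subsets,
  those containing a. Harmonicity replaces the sum over a outside \<open>A\<close> by minus the sum
  over a in A - S, in which each r-subset of \<open>A\<close> occurs r times.\<close>

lemma lift_insert:
  fixes v :: "real ^ ('a::finite set)"
  assumes "v \<in> harmonic r"
  shows "(\<Sum>a\<in>- A. lift v (insert a A)) = (real CARD('a) - real (card A) - real r) * lift v A"
proof -
  have v: "v \<in> homogeneous r" and down: "\<And>S. (\<Sum>a\<in>- S. v $ insert a S) = 0"
    using assms by (auto simp: harmonic_def down_def vec_eq_iff)
  have ins: "lift v (insert a A) = lift v A + (\<Sum>S\<in>Pow A. v $ insert a S)" if "a \<in> - A" for a
  proof -
    have inj: "inj_on (insert a) (Pow A)" using that by (auto simp: inj_on_def)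
    have "Pow A \<inter> insert a ` Pow A = {}" using that by auto
    then show ?thesis unfolding lift_def Pow_insert
      by (simp add: sum.union_disjoint sum.reindex[OF inj])
  qed
  have "(\<Sum>S\<in>Pow A. \<Sum>a\<in>- A. v $ insert a S) = (\<Sum>S\<in>Pow A. - (\<Sum>a\<in>A - S. v $ insert a S))"
  proof (intro sum.cong refl)
    fix S assume "S \<in> Pow A"
    then have "- S = - A \<union> (A - S)" "- A \<inter> (A - S) = {}" by auto
    then have "(\<Sum>a\<in>- S. v $ insert a S) = (\<Sum>a\<in>- A. v $ insert a S) + (\<Sum>a\<in>A - S. v $ insert a S)"
      by (metis finite sum.union_disjoint)
    then show "(\<Sum>a\<in>- A. v $ insert a S) = - (\<Sum>a\<in>A - S. v $ insert a S)"
      using down[of S] by simp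
  qed
  also have "\<dots> = - (\<Sum>S\<in>Pow A. \<Sum>a\<in>A - S. v $ insert a S)" by (rule sum_negf)
  also have "(\<Sum>S\<in>Pow A. \<Sum>a\<in>A - S. v $ insert a S)
      = (\<Sum>S\<in>UNIV. \<Sum>a\<in>- S. if insert a S \<subseteq> A then v $ insert a S else 0)"
  proof (rule sum.mono_neutral_cong_left)
    fix S assume "S \<in> Pow A"
    then show "(\<Sum>a\<in>A - S. v $ insert a S) = (\<Sum>a\<in>- S. if insert a S \<subseteq> A then v $ insert a S else 0)"
      by (intro sum.mono_neutral_cong_left) auto
  qed auto
  also have "\<dots> = (\<Sum>S\<in>UNIV. \<Sum>b\<in>S. if S \<subseteq> A then v $ S else 0)"
    by (rule sum_remove_swap[of "\<lambda>S T. if S \<subseteq> A then v $ S else 0", symmetric])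
  also have "\<dots> = (\<Sum>S\<in>Pow A. real (card S) * v $ S)"
    by (intro sum.mono_neutral_cong_right) auto
  also have "\<dots> = real r * lift v A" by (rule sum_card_lift[OF v])
  finally have *: "(\<Sum>S\<in>Pow A. \<Sum>a\<in>- A. v $ insert a S) = - real r * lift v A" by simp
  have "(\<Sum>a\<in>- A. lift v (insert a A)) = real (card (- A)) * lift v A + (\<Sum>S\<in>Pow A. \<Sum>a\<in>- A. v $ insert a S)"
    using ins by (subst sum.swap) (simp add: sum.distrib)
  moreover have "real (card (- A)) = real CARD('a) - real (card A)"
    by (simp add: Compl_eq_Diff_UNIV card_Diff_subset card_mono of_nat_diff)
  ultimately show ?thesis using * by (simp add: algebra_simps)
qed

text \<open>The eigenvalue equation of the Johnson graph on the sets of size \<open>card A\<close>.\<close>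

lemma lift_exchange:
  fixes v :: "real ^ ('a::finite set)"
  assumes "v \<in> harmonic r"
  shows "(\<Sum>b\<in>A. \<Sum>a\<in>- A. lift v (insert a (A - {b})))
    = ((real CARD('a) - real (card A) + 1 - real r) * (real (card A) - real r) - real (card A)) * lift v A"
proof -
  have v: "v \<in> homogeneous r" using assms by (simp add: harmonic_def)
  \<comment> \<open>The complement of A - {b} also contains b, whose insertion restores
    \<open>A\<close>; hence the subtracted term.\<close>
  have "(\<Sum>a\<in>- A. lift v (insert a (A - {b})))
      = (real CARD('a) - real (card A) + 1 - real r) * lift v (A - {b}) - lift v A" if "b \<in> A" for b
  proof -
    have "- (A - {b}) = insert b (- A)" using that by auto
    then have "(\<Sum>a\<in>- (A - {b}). lift v (insert a (A - {b})))
        = lift v A + (\<Sum>a\<in>- A. lift v (insert a (A - {b})))"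
      using that by (simp add: insert_absorb)
    moreover have "real (card (A - {b})) = real (card A) - 1"
      using that card_Suc_Diff1[of A b] by simp
    ultimately show ?thesis using lift_insert[OF assms, of "A - {b}"]
      by (simp only:) argo
  qed
  then have "(\<Sum>b\<in>A. \<Sum>a\<in>- A. lift v (insert a (A - {b})))
      = (\<Sum>b\<in>A. (real CARD('a) - real (card A) + 1 - real r) * lift v (A - {b}) - lift v A)"
    by simp
  also have "\<dots> = (real CARD('a) - real (card A) + 1 - real r) * (\<Sum>b\<in>A. lift v (A - {b}))
                     - real (card A) * lift v A"
    by (simp add: sum_subtractf sum_distrib_left)
  finally show ?thesis unfolding lift_remove[OF v] by (simp add: algebra_simps)
qed

lemma sum_level_remove_swap:
  fixes F :: "'a::finite set \<Rightarrow> 'a set \<Rightarrow> real"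
  shows "(\<Sum>A | card A = Suc k. \<Sum>b\<in>A. F A (A - {b})) = (\<Sum>B | card B = k. \<Sum>a\<in>- B. F (insert a B) B)"
proof -
  have "(\<Sum>A | card A = Suc k. \<Sum>b\<in>A. F A (A - {b}))
      = (\<Sum>A\<in>UNIV. \<Sum>b\<in>A. if card A = Suc k then F A (A - {b}) else 0)"
    by (intro sum.mono_neutral_cong_left) auto
  also have "\<dots> = (\<Sum>B\<in>UNIV. \<Sum>a\<in>- B. if card (insert a B) = Suc k then F (insert a B) B else 0)"
    by (rule sum_remove_swap[of "\<lambda>A B. if card A = Suc k then F A B else 0"])
  also have "\<dots> = (\<Sum>B | card B = k. \<Sum>a\<in>- B. F (insert a B) B)"
    by (intro sum.mono_neutral_cong_right) (auto simp: card_insert_disjoint)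
  finally show ?thesis .
qed

text \<open>Sum \<open>lift u\<close> at the larger set times \<open>lift v\<close> at the smaller
  one over all pairs of a (k+1)-set and a k-subset: \<open>lift_remove\<close> evaluates this on the
  side of \<open>v\<close>, \<open>lift_insert\<close> on the side of \<open>u\<close>.\<close>

lemma sum_lift_lift_step:
  fixes v u :: "real ^ ('a::finite set)"
  assumes "v \<in> harmonic r" "u \<in> harmonic s"
  shows "(real (Suc k) - real r) * (\<Sum>A | card A = Suc k. lift v A * lift u A)
       = (real CARD('a) - real k - real s) * (\<Sum>A | card A = k. lift v A * lift u A)"
proof -
  have v: "v \<in> homogeneous r" using assms by (simp add: harmonic_def)
  have "(real (Suc k) - real r) * (\<Sum>A | card A = Suc k. lift v A * lift u A)
      = (\<Sum>A | card A = Suc k. \<Sum>b\<in>A. lift u A * lift v (A - {b}))"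
    unfolding sum_distrib_left using lift_remove[OF v]
    by (intro sum.cong refl) (simp add: sum_distrib_left[symmetric])
  also have "\<dots> = (\<Sum>B | card B = k. \<Sum>a\<in>- B. lift u (insert a B) * lift v B)"
    by (rule sum_level_remove_swap)
  also have "\<dots> = (real CARD('a) - real k - real s) * (\<Sum>A | card A = k. lift v A * lift u A)"
    unfolding sum_distrib_left using lift_insert[OF assms(2)]
    by (intro sum.cong refl) (simp add: sum_distrib_right[symmetric])
  finally show ?thesis .
qed

text \<open>At the lowest shell \<open>lift\<close> returns the coefficients. Each step up
  multiplies by (n - k - r) / (k + 1 - r), the ratio of consecutive binomials of n - 2r.\<close>

lemma sum_lift_lift_self:
  fixes v u :: "real ^ ('a::finite set)"
  assumes "v \<in> harmonic r" "u \<in> harmonic r" "r \<le> k" "k \<le> CARD('a) - r"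
  shows "(\<Sum>A | card A = k. lift v A * lift u A) = real ((CARD('a) - 2 * r) choose (k - r)) * (v \<bullet> u)"
  using assms(3,4)
proof (induction k rule: dec_induct)
  case base
  have h: "v \<in> homogeneous r" "u \<in> homogeneous r" using assms by (auto simp: harmonic_def)
  have "(\<Sum>A | card A = r. lift v A * lift u A) = (\<Sum>A | card A = r. v $ A * u $ A)"
    using h by (intro sum.cong refl) (simp add: lift_eq_self)
  also have "\<dots> = (\<Sum>A\<in>UNIV. v $ A * u $ A)"
    using h by (intro sum.mono_neutral_left) (auto simp: homogeneous_def)
  finally show ?case by (simp add: inner_vec_def)
next
  case (step k)
  let ?N = "\<lambda>k. \<Sum>A | card A = k. lift v A * lift u A"
  define j where "j = k - r"
  define N where "N = CARD('a) - 2 * r"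
  have jN: "j < N" using step by (auto simp: j_def N_def)
  have "real (Suc j) = real (Suc k) - real r" "real N - real j = real CARD('a) - real k - real r"
    using step by (auto simp: j_def N_def)
  then have "real (Suc j) * ?N (Suc k) = (real N - real j) * ?N k"
    using sum_lift_lift_step[OF assms(1,2), of k] by (simp only:)
  also have "\<dots> = (real N - real j) * real (N choose j) * (v \<bullet> u)"
    using step by (simp add: j_def N_def)
  also have "(real N - real j) * real (N choose j) = real (Suc j) * real (N choose Suc j)"
    using jN by (metis (no_types, lifting) binomial_absorb_comp binomial_absorption less_imp_le of_nat_diff of_nat_mult)
  finally have "?N (Suc k) = real (N choose Suc j) * (v \<bullet> u)" by simp
  then show ?case using step by (simp add: j_def N_def Suc_diff_le)
qed

text \<open>Up to size r the lift of \<open>u\<close> vanishes. Beyond it the factor k + 1 - r in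
  \<open>sum_lift_lift_step\<close> is nonzero, because the smaller degree sits on the removal
  side.\<close>

lemma sum_lift_lift_less:
  fixes v u :: "real ^ ('a::finite set)"
  assumes "v \<in> harmonic r" "u \<in> harmonic s" "r < s"
  shows "(\<Sum>A | card A = k. lift v A * lift u A) = 0"
proof (induction k)
  case 0
  have "u \<in> homogeneous s" using assms by (auto simp: harmonic_def)
  then show ?case using assms by (intro sum.neutral) (auto simp: lift_eq_0)
next
  case (Suc k)
  show ?case
  proof (cases "Suc k \<le> r")
    case True
    have "u \<in> homogeneous s" using assms by (auto simp: harmonic_def)
    then show ?thesis using assms True by (intro sum.neutral) (auto simp: lift_eq_0)
  next
    case False
    then show ?thesis using sum_lift_lift_step[OF assms(1,2), of k] Suc by simp
  qed
qed

lemma sum_lift_lift_neq: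
  fixes v u :: "real ^ ('a::finite set)"
  assumes "v \<in> harmonic r" "u \<in> harmonic s" "r \<noteq> s"
  shows "(\<Sum>A | card A = k. lift v A * lift u A) = 0"
  using sum_lift_lift_less[OF assms(1,2), of k] sum_lift_lift_less[OF assms(2,1), of k] assms(3)
  by (cases "r < s") (auto simp: mult.commute)

text \<open>Each R inside \<open>A\<close> extends within \<open>A\<close> by |A - R| points. So on
  a single shell raising only multiplies by a constant.\<close>

lemma lift_up:
  assumes "w \<in> homogeneous r"
  shows "lift (up w) A = (real (card A) - real r) * lift w A"
proof -
  have "lift (up w) A = (\<Sum>S\<in>UNIV. \<Sum>b\<in>S. if S \<subseteq> A then w $ (S - {b}) else 0)"
    unfolding lift_def up_def by (intro sum.mono_neutral_cong_left) auto
  also have "\<dots> = (\<Sum>R\<in>UNIV. \<Sum>a\<in>- R. if insert a R \<subseteq> A then w $ R else 0)"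
    by (rule sum_remove_swap[of "\<lambda>S R. if S \<subseteq> A then w $ R else 0"])
  also have "\<dots> = (\<Sum>R\<in>Pow A. \<Sum>a\<in>A - R. w $ R)"
  proof (rule sum.mono_neutral_cong_right)
    fix R assume "R \<in> Pow A"
    then show "(\<Sum>a\<in>- R. if insert a R \<subseteq> A then w $ R else 0) = (\<Sum>a\<in>A - R. w $ R)"
      by (intro sum.mono_neutral_cong_right) auto
  qed auto
  also have "\<dots> = (\<Sum>S\<in>Pow A. real (card A) * w $ S - real (card S) * w $ S)"
    by (intro sum.cong refl) (auto simp: card_Diff_subset of_nat_diff card_mono algebra_simps)
  also have "\<dots> = real (card A) * lift w A - real r * lift w A"
    by (simp add: sum_subtractf sum_card_lift[OF assms] lift_def sum_distrib_left)
  finally show ?thesis by (simp add: algebra_simps)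
qed

text \<open>The top coefficient is the same on all shells: this is why the harmonic space of degree \<open>e\<close> enters
  the polynomials of degree at most \<open>e\<close> on two shells only diagonally.\<close>

lemma lift_decomposition:
  fixes v :: "real ^ ('a::finite set)"
  assumes "v \<in> homogeneous t"
  shows "\<exists>c p. (\<forall>r\<le>t. c r \<in> harmonic r) \<and> (\<forall>A. lift v A = (\<Sum>r\<le>t. p r (card A) * lift (c r) A))
              \<and> (\<forall>k. p t k = (1 :: real))"
  using assms
proof (induction t arbitrary: v)
  case 0
  have "down v = 0"
    using 0 by (simp add: down_def vec_eq_iff homogeneous_def)
  then have "v \<in> harmonic 0" using 0 by (simp add: harmonic_def)
  then show ?case by (intro exI[of _ "\<lambda>_. v"] exI[of _ "\<lambda>_ _. 1"]) auto
next
  case (Suc t)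
  \<comment> \<open>Split \<open>v\<close> into a raised part and a part orthogonal to all raised
    vectors; the latter is harmonic of degree t + 1.\<close>
  obtain y z where yz: "y \<in> span (up ` homogeneous t)"
    "\<And>w. w \<in> span (up ` homogeneous t) \<Longrightarrow> orthogonal z w" "v = y + z"
    by (rule orthogonal_subspace_decomp_exists[of "up ` homogeneous t" v], rule that)
  then obtain w where w: "w \<in> homogeneous t" "y = up w"
    using span_eq_iff[THEN iffD2, OF subspace_up_homogeneous] by (metis imageE)
  have "z = v - up w" using yz w by simp
  then have "z \<in> homogeneous (Suc t)"
    using Suc.prems up_homogeneous[OF w(1)] subspace_homogeneous subspace_diff by metis
  then have z: "z \<in> harmonic (Suc t)"
    unfolding harmonic_eq_orthogonal using yz(2) by (auto simp: orthogonal_commute[of _ z] intro: span_base)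
  obtain c p where cp: "\<forall>r\<le>t. c r \<in> harmonic r"
    "\<forall>A. lift w A = (\<Sum>r\<le>t. p r (card A) * lift (c r) A)"
    using Suc.IH[OF w(1)] by blast
  define c' where "c' = c(Suc t := z)"
  \<comment> \<open>The harmonic part keeps coefficient 1; the raised part picks up the factor |A| -
    t from \<open>lift_up\<close>.\<close>
  define p' where "p' = (\<lambda>r k. if r = Suc t then 1 else (real k - real t) * p r k)"
  have "lift v A = (\<Sum>r\<le>Suc t. p' r (card A) * lift (c' r) A)" for A
  proof -
    have "lift v A = lift z A + (real (card A) - real t) * lift w A"
      using yz(3) w linear_add[OF linear_lift, of y z A] lift_up[OF w(1), of A] by simp
    also have "\<dots> = (\<Sum>r\<le>Suc t. p' r (card A) * lift (c' r) A)"
      using cp(2) by (simp add: p'_def c'_def sum_distrib_left mult.assoc)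
    finally show ?thesis .
  qed
  moreover have "\<forall>r\<le>Suc t. c' r \<in> harmonic r" using cp(1) z by (auto simp: c'_def le_Suc_eq)
  moreover have "\<forall>k. p' (Suc t) k = 1" by (simp add: p'_def)
  ultimately show ?case by (intro exI[of _ c'] exI[of _ p']) blast
qed

lemma lift_axis: "lift (axis T 1) A = of_bool (T \<subseteq> A)"
proof -
  have "lift (axis T 1) A = (\<Sum>S\<in>Pow A. if S = T then 1 else 0)"
    unfolding lift_def axis_def by (intro sum.cong) auto
  then show ?thesis by simp
qed

section \<open>Zonal functions and Hahn polynomials\<close>

definition permute :: "('a \<Rightarrow> 'a) \<Rightarrow> real ^ ('a::finite set) \<Rightarrow> real ^ ('a set)" where
  "permute f v = (\<chi> A. v $ (f ` A))"

lemma permute_harmonic: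
  assumes "bij f" "v \<in> harmonic r"
  shows "permute f v \<in> harmonic r"
proof -
  have inj: "inj f" using assms(1) by (rule bij_is_inj)
  have "card (f ` A) = card A" for A using inj by (simp add: card_image inj_on_subset)
  then have "permute f v \<in> homogeneous r"
    using assms(2) by (simp add: harmonic_def homogeneous_def permute_def)
  moreover have "down (permute f v) = 0"
  proof (rule vec_eq_iff[THEN iffD2], rule allI)
    fix A
    have "down (permute f v) $ A = (\<Sum>a\<in>- A. v $ insert (f a) (f ` A))"
      by (simp add: down_def permute_def)
    also have "\<dots> = (\<Sum>b\<in>f ` (- A). v $ insert b (f ` A))"
      using inj by (subst sum.reindex) (auto intro: inj_on_subset)
    also have "\<dots> = down v $ (f ` A)"
      using bij_image_Compl_eq[OF assms(1), of A] by (simp add: down_def)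
    also have "\<dots> = 0" using assms(2) by (simp add: harmonic_def)
    finally show "down (permute f v) $ A = 0 $ A" by simp
  qed
  ultimately show ?thesis by (simp add: harmonic_def)
qed

lemma permute_inverse: "bij f \<Longrightarrow> permute f (permute (inv f) v) = v"
  by (simp add: permute_def vec_eq_iff image_image bij_is_inj)

lemma inner_permute: 
  assumes "bij f"
  shows "permute f v \<bullet> permute f w = v \<bullet> w"
proof -
  have "bij ((`) f)" using assms
    by (simp add: bij_def inj_image_eq_iff inj_def) (metis surj_image_vimage_eq surjI)
  then have "(\<Sum>A\<in>UNIV. v $ (f ` A) * w $ (f ` A)) = (\<Sum>A\<in>UNIV. v $ A * w $ A)"
    using sum.reindex_bij_betw[of "(`) f" UNIV UNIV "\<lambda>A. v $ A * w $ A"] by simp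
  then show ?thesis by (simp add: inner_vec_def permute_def)
qed

lemma lift_permute:
  assumes "bij f"
  shows "lift (permute f v) A = lift v (f ` A)"
proof -
  have inj: "inj_on ((`) f) (Pow A)"
    using bij_is_inj[OF assms] by (simp add: inj_on_def inj_image_eq_iff)
  have "lift v (f ` A) = (\<Sum>S\<in>(`) f ` Pow A. v $ S)"
    unfolding lift_def by (simp add: image_Pow_surj)
  then show ?thesis
    unfolding sum.reindex[OF inj] by (simp add: lift_def permute_def)
qed

text \<open>A pair of sets is determined up to permutation by the sizes of the four regions it cuts
  out, and the hypotheses fix all four.\<close>

lemma exists_permutation:
  fixes A B A' B' :: "'a::finite set"
  assumes "card A = card A'" "card B = card B'" "card (A - B) = card (A' - B')"
  obtains f where "bij f" "f ` A = A'" "f ` B = B'"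
proof -
  have split: "card X = card (X \<inter> Z) + card (X - Z)" for X Z :: "'a set"
    by (metis card_Un_disjoint finite Int_Diff_disjoint Int_Diff_Un)
  have i: "card (A \<inter> B) = card (A' \<inter> B')"
    using split[of A B] split[of A' B'] assms by linarith
  have d: "card (B - A) = card (B' - A')"
    using split[of B A] split[of B' A'] assms i by (simp add: Int_commute)
  have "card (A \<union> B) = card A + card (B - A)" for A B :: "'a set"
    by (metis card_Un_disjoint Diff_disjoint Un_Diff_cancel finite)
  then have "card (A \<union> B) = card (A' \<union> B')" using assms d by presburger
  then have c: "card (- (A \<union> B)) = card (- (A' \<union> B'))"
    by (simp add: Compl_eq_Diff_UNIV card_Diff_subset)
  obtain g1 g2 g3 g4 where
    g1: "bij_betw g1 (A \<inter> B) (A' \<inter> B')" and g2: "bij_betw g2 (A - B) (A' - B')" and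
    g3: "bij_betw g3 (B - A) (B' - A')" and g4: "bij_betw g4 (- (A \<union> B)) (- (A' \<union> B'))"
    using i d c assms(3) finite_same_card_bij[OF finite finite] by metis
  define f where "f = (\<lambda>x. if x \<in> A then if x \<in> B then g1 x else g2 x else if x \<in> B then g3 x else g4 x)"
  have f: "bij_betw f (A \<inter> B) (A' \<inter> B')" "bij_betw f (A - B) (A' - B')"
    "bij_betw f (B - A) (B' - A')" "bij_betw f (- (A \<union> B)) (- (A' \<union> B'))"
    using g1 g2 g3 g4
    by (auto simp: f_def intro: bij_betw_cong[THEN iffD1, rotated])
  have "bij_betw f ((A \<inter> B) \<union> (A - B)) ((A' \<inter> B') \<union> (A' - B'))"
    by (rule bij_betw_combine[OF f(1,2)]) auto
  then have fA: "bij_betw f A A'" by (simp add: Int_Diff_Un)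
  have "bij_betw f ((A \<inter> B) \<union> (B - A)) ((A' \<inter> B') \<union> (B' - A'))"
    by (rule bij_betw_combine[OF f(1,3)]) auto
  then have fB: "bij_betw f B B'" by (simp add: Int_commute[of A] Int_commute[of A'] Int_Diff_Un)
  have "bij_betw f ((B - A) \<union> - (A \<union> B)) ((B' - A') \<union> - (A' \<union> B'))"
    by (rule bij_betw_combine[OF f(3,4)]) auto
  then have "bij_betw f (A \<union> ((B - A) \<union> - (A \<union> B))) (A' \<union> ((B' - A') \<union> - (A' \<union> B')))"
    by (rule bij_betw_combine[OF fA]) auto
  moreover have "A \<union> ((B - A) \<union> - (A \<union> B)) = UNIV" for A B :: "'a set" by auto
  ultimately have "bij f" by simp
  then show thesis using that fA fB by (simp add: bij_betw_def)
qed

section \<open>Zonal kernels of the harmonic spaces\<close>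

definition harmonic_basis :: "nat \<Rightarrow> (real ^ ('a::finite set)) set" where
  "harmonic_basis r = (SOME B. B \<subseteq> harmonic r \<and> pairwise orthogonal B \<and> (\<forall>x\<in>B. norm x = 1) \<and>
     finite B \<and> card B = dim (harmonic r :: (real ^ ('a set)) set) \<and> span B = harmonic r)"

lemma harmonic_basis:
  shows "(harmonic_basis r :: (real ^ ('a::finite set)) set) \<subseteq> harmonic r"
    "pairwise orthogonal (harmonic_basis r :: (real ^ ('a set)) set)"
    "\<And>x :: real ^ ('a set). x \<in> harmonic_basis r \<Longrightarrow> norm x = 1"
    "finite (harmonic_basis r :: (real ^ ('a set)) set)"
    "card (harmonic_basis r :: (real ^ ('a set)) set) = dim (harmonic r :: (real ^ ('a set)) set)"
    "span (harmonic_basis r) = (harmonic r :: (real ^ ('a set)) set)"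
proof -
  obtain B where B: "B \<subseteq> (harmonic r :: (real ^ ('a set)) set)" "pairwise orthogonal B"
    "\<And>x. x \<in> B \<Longrightarrow> norm x = 1" "independent B"
    "card B = dim (harmonic r :: (real ^ ('a set)) set)" "span B = harmonic r"
    using orthonormal_basis_subspace[OF subspace_harmonic] by metis
  have "\<exists>B :: (real ^ ('a set)) set. B \<subseteq> harmonic r \<and> pairwise orthogonal B \<and> (\<forall>x\<in>B. norm x = 1) \<and>
     finite B \<and> card B = dim (harmonic r :: (real ^ ('a::finite set)) set) \<and> span B = harmonic r"
    using B independent_imp_finite[OF B(4)] by (intro exI[of _ B]) simp
  note * = someI_ex[OF this, folded harmonic_basis_def]
  show "(harmonic_basis r :: (real ^ ('a::finite set)) set) \<subseteq> harmonic r"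
    "pairwise orthogonal (harmonic_basis r :: (real ^ ('a set)) set)"
    "\<And>x :: real ^ ('a set). x \<in> harmonic_basis r \<Longrightarrow> norm x = 1"
    "finite (harmonic_basis r :: (real ^ ('a set)) set)"
    "card (harmonic_basis r :: (real ^ ('a set)) set) = dim (harmonic r :: (real ^ ('a set)) set)"
    "span (harmonic_basis r) = (harmonic r :: (real ^ ('a set)) set)"
    using * by simp_all
qed

text \<open>Reproducing kernel for evaluating lifts, with respect to the inner product of
  coefficient vectors; it therefore covers pairs of sets of different sizes.\<close>

definition zonal :: "nat \<Rightarrow> 'a::finite set \<Rightarrow> 'a set \<Rightarrow> real" where
  "zonal r A B = (\<Sum>c\<in>harmonic_basis r. lift c A * lift c B)"

text \<open>Riesz representative of the functional sending \<open>v\<close> to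
  \<open>lift v B\<close> (see \<open>inner_evaluator\<close>).\<close>

definition evaluator :: "nat \<Rightarrow> 'a::finite set \<Rightarrow> real ^ ('a set)" where
  "evaluator r B = (\<Sum>c\<in>harmonic_basis r. lift c B *\<^sub>R c)"

lemma evaluator_harmonic: "evaluator r B \<in> harmonic r"
  unfolding evaluator_def using harmonic_basis(1)
  by (intro subspace_sum subspace_harmonic subspace_scale) auto

lemma lift_evaluator: "lift (evaluator r B) A = zonal r A B"
  unfolding evaluator_def zonal_def
  by (subst linear_sum[OF linear_lift]) (simp add: linear_cmul[OF linear_lift] mult.commute)

lemma zonal_commute: "zonal r A B = zonal r B A"
  by (simp add: zonal_def mult.commute)

lemma inner_evaluator:
  assumes "v \<in> harmonic r"
  shows "evaluator r B \<bullet> v = lift v B"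
proof (rule linear_eq_on[where f = "\<lambda>v. evaluator r B \<bullet> v" and B = "harmonic_basis r"])
  show "linear (\<lambda>v. evaluator r B \<bullet> v)"
    by (rule linearI) (simp_all add: inner_add_right)
  show "v \<in> span (harmonic_basis r)" using assms harmonic_basis(6) by metis
  fix d :: "real ^ ('a set)" assume d: "d \<in> harmonic_basis r"
  have "c \<bullet> d = (if c = d then 1 else 0)" if "c \<in> harmonic_basis r" for c
    using that d harmonic_basis(2)[of r] harmonic_basis(3)[OF d]
    by (auto simp: pairwise_def orthogonal_def norm_eq_1)
  then have "evaluator r B \<bullet> d = (\<Sum>c\<in>harmonic_basis r. if c = d then lift d B else 0)"
    unfolding evaluator_def inner_sum_left by (intro sum.cong) auto
  then show "evaluator r B \<bullet> d = lift d B" using d by (simp add: harmonic_basis(4))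
qed (rule linear_lift)

text \<open>Riesz representatives are unique: the pulled-back one for the image of \<open>B\<close>
  and the one for \<open>B\<close> act alike on harmonic vectors, so their difference is orthogonal
  to itself.\<close>

lemma zonal_permute:
  fixes f :: "'a::finite \<Rightarrow> 'a"
  assumes "bij f"
  shows "zonal r (f ` A) (f ` B) = zonal r A B"
proof -
  define d where "d = permute f (evaluator r (f ` B)) - evaluator r B"
  have p: "permute f (evaluator r (f ` B)) \<in> harmonic r"
    using assms evaluator_harmonic by (rule permute_harmonic)
  have d: "d \<in> harmonic r"
    unfolding d_def by (intro subspace_diff subspace_harmonic p evaluator_harmonic)
  have "permute f (evaluator r (f ` B)) \<bullet> d = lift d B"
  proof -
    have i: "bij (inv f)" using assms by (rule bij_imp_bij_inv)
    have "permute f (evaluator r (f ` B)) \<bullet> d = evaluator r (f ` B) \<bullet> permute (inv f) d"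
      using inner_permute[OF assms, of "evaluator r (f ` B)" "permute (inv f) d"] permute_inverse[OF assms]
      by simp
    also have "\<dots> = lift (permute (inv f) d) (f ` B)"
      by (intro inner_evaluator permute_harmonic i d)
    also have "\<dots> = lift d B"
      using lift_permute[OF i] bij_is_inj[OF assms] by (simp add: image_image)
    finally show ?thesis .
  qed
  then have "d \<bullet> d = 0"
    using inner_evaluator[OF d, of B] by (simp add: d_def inner_diff_left)
  then have "permute f (evaluator r (f ` B)) = evaluator r B" by (simp add: d_def)
  then show ?thesis by (metis lift_evaluator lift_permute[OF assms])
qed

lemma zonal_cong:
  fixes A B A' B' :: "'a::finite set"
  assumes "card A = card A'" "card B = card B'" "card (A - B) = card (A' - B')"
  shows "zonal r A B = zonal r A' B'"
  using exists_permutation[OF assms] zonal_permute by metis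

lemma sum_lift_zonal:
  fixes v :: "real ^ ('a::finite set)"
  assumes "v \<in> harmonic r" "r \<le> k" "k \<le> CARD('a) - r"
  shows "(\<Sum>A | card A = k. lift v A * zonal r A B)
    = real ((CARD('a) - 2 * r) choose (k - r)) * lift v B"
  using sum_lift_lift_self[OF assms(1) evaluator_harmonic[of r B] assms(2,3)]
  by (simp add: lift_evaluator inner_commute[of v] inner_evaluator[OF assms(1)])

lemma sum_lift_zonal_neq:
  fixes v :: "real ^ ('a::finite set)"
  assumes "v \<in> harmonic r" "r \<noteq> s"
  shows "(\<Sum>A | card A = k. lift v A * zonal s A B) = 0"
  using sum_lift_lift_neq[OF assms(1) evaluator_harmonic[of s B] assms(2), of k]
  by (simp add: lift_evaluator)

text \<open>Trace of the kernel over a shell: by transitivity all diagonal values agree, while each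
  unit basis vector contributes its squared norm on the shell.\<close>

lemma zonal_diag:
  fixes A :: "'a::finite set"
  assumes "r \<le> card A" "card A \<le> CARD('a) - r" "2 * r \<le> CARD('a)"
  shows "real (CARD('a) choose card A) * zonal r A A
    = real ((CARD('a) - 2 * r) choose (card A - r)) * binomial_diff CARD('a) r"
proof -
  have "real (CARD('a) choose card A) * zonal r A A = (\<Sum>B :: 'a set | card B = card A. zonal r A A)"
    using n_subsets[of "UNIV :: 'a set" "card A"] by simp
  also have "\<dots> = (\<Sum>B :: 'a set | card B = card A. zonal r B B)"
    by (intro sum.cong refl zonal_cong) auto
  also have "\<dots> = (\<Sum>c\<in>harmonic_basis r. \<Sum>B :: 'a set | card B = card A. lift c B * lift c B)"
    unfolding zonal_def by (rule sum.swap)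
  also have "\<dots> = (\<Sum>c \<in> (harmonic_basis r :: (real ^ ('a set)) set). real ((CARD('a) - 2 * r) choose (card A - r)))"
  proof (intro sum.cong refl)
    fix c :: "real ^ ('a set)" assume c: "c \<in> harmonic_basis r"
    then have "c \<in> harmonic r" "c \<bullet> c = 1"
      using harmonic_basis(1,3) by (auto simp: norm_eq_1)
    then show "(\<Sum>B | card B = card A. lift c B * lift c B) = real ((CARD('a) - 2 * r) choose (card A - r))"
      using sum_lift_lift_self[of c r c "card A"] assms by simp
  qed
  also have "\<dots> = real ((CARD('a) - 2 * r) choose (card A - r)) * binomial_diff CARD('a) r"
    using dim_harmonic[OF assms(3)] by (simp add: harmonic_basis(5))
  finally show ?thesis .
qed

lemma binomial_diff_pos:
  assumes "2 * r \<le> n"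
  shows "binomial_diff n r > 0"
  using assms binomial_strict_mono[of "r - 1" r n] by (auto simp: binomial_diff_def)

lemma zonal_diag_pos:
  fixes A :: "'a::finite set"
  assumes "r \<le> card A" "card A \<le> CARD('a) - r" "2 * r \<le> CARD('a)"
  shows "zonal r A A > 0"
proof -
  have "real ((CARD('a) - 2 * r) choose (card A - r)) * binomial_diff CARD('a) r > 0"
    using assms by (intro mult_pos_pos binomial_diff_pos) auto
  then have "real (CARD('a) choose card A) * zonal r A A > 0" using zonal_diag[OF assms] by simp
  then show ?thesis by (simp add: zero_less_mult_iff)
qed


text \<open>The Hahn polynomial Q_r(\<xi>; b - n - 1, - b - 1, a), normalised to 1 at \<xi> = 0; a
  and b will be the sizes of the two sets.\<close>

abbreviation hahn :: "nat \<Rightarrow> nat \<Rightarrow> nat \<Rightarrow> nat \<Rightarrow> complex \<Rightarrow> complex" where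
  "hahn n a b r \<xi> \<equiv> hyp_3F2 (- \<xi>) (- of_nat r) (of_nat r - of_nat n - 1)
     (of_nat b - of_nat n) (- of_nat a) 1"

definition hahn_coeff :: "nat \<Rightarrow> nat \<Rightarrow> nat \<Rightarrow> nat \<Rightarrow> nat \<Rightarrow> complex" where
  "hahn_coeff n a b r i = pochhammer (- of_nat r) i * pochhammer (of_nat r - of_nat n - 1) i /
     (pochhammer (of_nat b - of_nat n) i * pochhammer (- of_nat a) i * fact i)"

lemma hahn_eq_sum: "hahn n a b r \<xi> = (\<Sum>i\<le>r. hahn_coeff n a b r i * pochhammer (- \<xi>) i)"
proof -
  have "hahn n a b r \<xi> = (\<Sum>i. hahn_coeff n a b r i * pochhammer (- \<xi>) i)"
    unfolding hyp_3F2_def hahn_coeff_def by (intro arg_cong[of _ _ suminf]) auto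
  also have "\<dots> = (\<Sum>i\<le>r. hahn_coeff n a b r i * pochhammer (- \<xi>) i)"
    by (rule suminf_finite) (auto simp: hahn_coeff_def pochhammer_of_nat_eq_0_iff)
  finally show ?thesis .
qed

lemma hahn_0: "hahn n a b r 0 = 1"
proof -
  have "hahn n a b r 0 = (\<Sum>i\<le>r. if i = 0 then 1 else 0)"
    unfolding hahn_eq_sum by (intro sum.cong) (auto simp: hahn_coeff_def pochhammer_0_left)
  then show ?thesis by simp
qed

lemma pochhammer_shift_down:
  fixes \<xi> :: complex
  shows "\<xi> * pochhammer (- (\<xi> - 1)) i = (\<xi> - of_nat i) * pochhammer (- \<xi>) i"
proof -
  have "(- \<xi>) * pochhammer (- \<xi> + 1) i = pochhammer (- \<xi>) i * (- \<xi> + of_nat i)"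
    by (metis pochhammer_rec pochhammer_Suc)
  then show ?thesis by (simp add: algebra_simps)
qed

lemma pochhammer_shift_up:
  fixes \<xi> :: complex
  shows "pochhammer (- (\<xi> + 1)) (Suc i) = - (\<xi> + 1) * pochhammer (- \<xi>) i"
  by (simp add: pochhammer_rec)

definition johnson_eigenvalue :: "nat \<Rightarrow> nat \<Rightarrow> nat \<Rightarrow> complex" where
  "johnson_eigenvalue n a r =
     (of_nat n - of_nat a + 1 - of_nat r) * (of_nat a - of_nat r) - of_nat a"

text \<open>The coefficients count one-point exchanges on an a-set C with |C - B| = \<xi> and |B| =
  b: \<xi>(b - a + \<xi>) of them lower the separation, (a - \<xi>)(n - b - \<xi>) raise it, the
  rest keep it.\<close>

definition hahn_operator ::
    "nat \<Rightarrow> nat \<Rightarrow> nat \<Rightarrow> (complex \<Rightarrow> complex) \<Rightarrow> complex \<Rightarrow> complex" where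
  "hahn_operator n a b g \<xi> = \<xi> * (of_nat b - of_nat a + \<xi>) * g (\<xi> - 1)
     + (of_nat a - \<xi>) * (of_nat n - of_nat b - \<xi>) * g (\<xi> + 1)
     + (\<xi> * (of_nat n - of_nat b - \<xi>) + (of_nat a - \<xi>) * (of_nat b - of_nat a + \<xi>)) * g \<xi>"

lemma hahn_operator_pochhammer_0:
  "hahn_operator n a b (\<lambda>\<xi>. pochhammer (- \<xi>) 0) \<xi> = johnson_eigenvalue n a 0"
  by (simp add: hahn_operator_def johnson_eigenvalue_def algebra_simps)

text \<open>The operator is bidiagonal in the basis \<open>pochhammer (- \<xi>) i\<close>, so an
  eigenfunction amounts to a two-term recurrence for its coefficients.\<close>

lemma hahn_operator_pochhammer:
  "hahn_operator n a b (\<lambda>\<xi>. pochhammer (- \<xi>) (Suc i)) \<xi>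
     = johnson_eigenvalue n a (Suc i) * pochhammer (- \<xi>) (Suc i)
       - of_nat (Suc i) * (of_nat a - of_nat i) * (of_nat n - of_nat b - of_nat i) * pochhammer (- \<xi>) i"
proof -
  let ?P = "pochhammer (- \<xi>) i"
  have "\<xi> * pochhammer (- (\<xi> - 1)) (Suc i) = (\<xi> - of_nat (Suc i)) * (?P * (- \<xi> + of_nat i))"
    unfolding pochhammer_shift_down pochhammer_Suc[of "- \<xi>"] ..
  then have down: "\<xi> * (of_nat b - of_nat a + \<xi>) * pochhammer (- (\<xi> - 1)) (Suc i)
      = (of_nat b - of_nat a + \<xi>) * (\<xi> - of_nat (Suc i)) * (?P * (- \<xi> + of_nat i))"
    by algebra
  have "hahn_operator n a b (\<lambda>\<xi>. pochhammer (- \<xi>) (Suc i)) \<xi>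
     = (of_nat b - of_nat a + \<xi>) * (\<xi> - of_nat (Suc i)) * (?P * (- \<xi> + of_nat i))
     + (of_nat a - \<xi>) * (of_nat n - of_nat b - \<xi>) * (- (\<xi> + 1) * ?P)
     + (\<xi> * (of_nat n - of_nat b - \<xi>) + (of_nat a - \<xi>) * (of_nat b - of_nat a + \<xi>)) * (?P * (- \<xi> + of_nat i))"
    unfolding hahn_operator_def down pochhammer_shift_up pochhammer_Suc[of "- \<xi>"] ..
  then show ?thesis
    unfolding johnson_eigenvalue_def pochhammer_Suc[of "- \<xi>"] of_nat_Suc by algebra
qed

text \<open>For i < r the bounds keep the factors a - i and n - b - i of the denominator nonzero, so
  no value 0 from a division by zero intervenes.\<close>

lemma hahn_coeff_Suc:
  assumes "i < r" "r \<le> a" "r + b \<le> n"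
  shows "hahn_coeff n a b r (Suc i) * (of_nat (Suc i) * (of_nat a - of_nat i) * (of_nat n - of_nat b - of_nat i))
    = hahn_coeff n a b r i * (johnson_eigenvalue n a i - johnson_eigenvalue n a r)"
proof -
  have nz: "of_nat b - of_nat n + of_nat i \<noteq> (0 :: complex)" "- of_nat a + of_nat i \<noteq> (0 :: complex)"
  proof -
    have "of_nat (b + i) \<noteq> (of_nat n :: complex)" "of_nat i \<noteq> (of_nat a :: complex)"
      unfolding of_nat_eq_iff using assms by auto
    then show "of_nat b - of_nat n + of_nat i \<noteq> (0 :: complex)" "- of_nat a + of_nat i \<noteq> (0 :: complex)"
      by (auto simp: algebra_simps)
  qed
  define D :: complex where
    "D = (of_nat b - of_nat n + of_nat i) * (- of_nat a + of_nat i) * of_nat (Suc i)"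
  have D: "D \<noteq> 0" unfolding D_def using nz of_nat_neq_0[of i, where 'a = complex] by simp
  have c: "hahn_coeff n a b r (Suc i) = hahn_coeff n a b r i *
    ((- of_nat r + of_nat i) * (of_nat r - of_nat n - 1 + of_nat i)) / D"
    unfolding hahn_coeff_def pochhammer_Suc fact_Suc D_def by (simp add: field_simps)
  have M: "of_nat (Suc i) * (of_nat a - of_nat i) * (of_nat n - of_nat b - of_nat i) = D"
    unfolding D_def by algebra
  have ev: "(- of_nat r + of_nat i) * (of_nat r - of_nat n - 1 + of_nat i)
     = johnson_eigenvalue n a i - johnson_eigenvalue n a r"
    unfolding johnson_eigenvalue_def by algebra
  show ?thesis unfolding c M ev using D by simp
qed

lemma hahn_eigen:
  assumes "r \<le> a" "r + b \<le> n"
  shows "hahn_operator n a b (hahn n a b r) \<xi> = johnson_eigenvalue n a r * hahn n a b r \<xi>"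
proof -
  let ?c = "hahn_coeff n a b r" and ?P = "\<lambda>i. pochhammer (- \<xi>) i"
  let ?ev = "johnson_eigenvalue n a"
  let ?mu = "\<lambda>i. of_nat (Suc i) * (of_nat a - of_nat i) * (of_nat n - of_nat b - of_nat i) :: complex"
  have lin: "hahn_operator n a b (\<lambda>\<xi>. \<Sum>i\<le>k. ?c i * pochhammer (- \<xi>) i) \<xi>
      = (\<Sum>i\<le>k. ?c i * hahn_operator n a b (\<lambda>\<xi>. pochhammer (- \<xi>) i) \<xi>)" for k
    unfolding hahn_operator_def sum_distrib_left sum.distrib[symmetric]
    by (intro sum.cong refl) algebra
  \<comment> \<open>The sum telescopes: a partial sum violates the eigenvalue equation only by its
    last term, whose factor vanishes at k = r.\<close>
  have "(\<Sum>i\<le>k. ?c i * hahn_operator n a b (\<lambda>\<xi>. pochhammer (- \<xi>) i) \<xi>)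
      = ?ev r * (\<Sum>i\<le>k. ?c i * ?P i) + ?c k * (?ev k - ?ev r) * ?P k" if "k \<le> r" for k
    using that
  proof (induction k)
    case 0
    show ?case by (simp add: hahn_operator_pochhammer_0[simplified] algebra_simps)
  next
    case (Suc k)
    then have "?c (Suc k) * ?mu k = ?c k * (?ev k - ?ev r)"
      using assms by (intro hahn_coeff_Suc) auto
    then have "?c (Suc k) * hahn_operator n a b (\<lambda>\<xi>. pochhammer (- \<xi>) (Suc k)) \<xi>
        = ?c (Suc k) * ?ev (Suc k) * ?P (Suc k) - (?c k * (?ev k - ?ev r)) * ?P k"
      unfolding hahn_operator_pochhammer by algebra
    moreover note Suc.IH[OF Suc_leD[OF Suc.prems]]
    ultimately show ?case unfolding sum.atMost_Suc by algebra
  qed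
  from this[of r] show ?thesis unfolding hahn_eq_sum lin by simp
qed

text \<open>For fixed \<open>B\<close>, the values of the zonal function satisfy the three-term recurrence expressed by
  \<open>hahn_eigen\<close>, which determines them from the value at \<open>A \<subseteq> B\<close>.\<close>

lemma zonal_eq_hahn:
  fixes A B :: "'a::finite set"
  assumes "r \<le> card A" "r + card B \<le> CARD('a)" "A\<^sub>0 \<subseteq> B" "card A\<^sub>0 = card A"
  shows "of_real (zonal r A B)
    = of_real (zonal r A\<^sub>0 B) * hahn CARD('a) (card A) (card B) r (of_nat (card (A - B)))"
  using assms
proof (induction "card (A - B)" arbitrary: A rule: less_induct)
  case less
  let ?n = "CARD('a)" and ?a = "card A" and ?b = "card B"
  let ?h = "hahn ?n ?a ?b r" and ?z = "complex_of_real (zonal r A\<^sub>0 B)"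
  have ab: "?a \<le> ?b" using less.prems card_mono[of B A\<^sub>0] by simp
  show ?case
  proof (cases "card (A - B)")
    case 0
    then have "zonal r A B = zonal r A\<^sub>0 B"
      using less.prems by (intro zonal_cong) (auto simp: Diff_eq_empty_iff[THEN iffD2])
    moreover have "?h (of_nat (card (A - B))) = 1" unfolding 0 of_nat_0 by (rule hahn_0)
    ultimately show ?thesis by simp
  next
    case (Suc k)
    then obtain p where p: "p \<in> A - B" by (metis card.empty ex_in_conv nat.distinct(1))
    \<comment> \<open>|A| is at most |B| because \<open>B\<close> has a subset of that size, so B -
      A is at least as large as A - B.\<close>
    have "card (B - A) \<ge> Suc k"
    proof -
      have "card (A \<inter> B) + card (A - B) = ?a" "card (A \<inter> B) + card (B - A) = ?b"
        by (metis Int_Diff_Un Int_Diff_disjoint card_Un_disjoint finite,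
            metis Int_commute Int_Diff_Un Int_Diff_disjoint card_Un_disjoint finite)
      then show ?thesis using ab Suc by linarith
    qed
    then obtain q where q: "q \<in> B - A" by (metis card.empty ex_in_conv not_less_eq_eq zero_le)
    \<comment> \<open>One exchange nearer to \<open>B\<close>. The eigenvalue equation at
      \<open>C\<close> involves the separations k - 1, k and k + 1, of which only the last, that of
      \<open>A\<close>, is still unknown.\<close>
    define C where "C = insert q (A - {p})"
    have cC: "card C = ?a"
    proof -
      have "p \<in> A" "q \<notin> A - {p}" using p q by auto
      then show ?thesis unfolding C_def using card_Suc_Diff1[of A p] by simp
    qed
    have "C - B = (A - B) - {p}" using p q by (auto simp: C_def)
    then have cCB: "card (C - B) = k" using Suc p by simp
    have i: "card (C \<inter> B) + k = ?a"
      by (metis Int_Diff_Un Int_Diff_disjoint card_Un_disjoint finite cC cCB)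
    have ii: "card (B - C) + ?a = ?b + k"
    proof -
      have "card (C \<inter> B) + card (B - C) = ?b"
        by (metis Int_commute Int_Diff_Un Int_Diff_disjoint card_Un_disjoint finite)
      then show ?thesis using i by linarith
    qed
    have iii: "card (- (C \<union> B)) + ?b + k = ?n"
    proof -
      have "card (C \<union> B) = ?b + k"
        by (metis Un_commute Un_Diff_cancel Diff_disjoint card_Un_disjoint finite cCB)
      moreover have "card (C \<union> B) \<le> ?n" by (simp add: card_mono)
      ultimately show ?thesis by (simp add: Compl_eq_Diff_UNIV card_Diff_subset)
    qed
    have move: "card (insert t (C - {s})) = ?a"
      "card (insert t (C - {s}) - B) + of_bool (s \<notin> B) = k + of_bool (t \<notin> B)"
      if "s \<in> C" "t \<in> - C" for s t
    proof -
      show "card (insert t (C - {s})) = ?a"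
        using that card_Suc_Diff1[of C s] cC by simp
      have "card (C - {s} - B) + of_bool (s \<notin> B) = k"
      proof (cases "s \<in> B")
        case True
        then have "C - {s} - B = C - B" by auto
        then show ?thesis using True cCB by simp
      next
        case False
        then have "C - {s} - B = (C - B) - {s}" "s \<in> C - B" using that by auto
        then show ?thesis using False cCB card_Suc_Diff1[of "C - B" s] by simp
      qed
      moreover have "card (insert t (C - {s}) - B) = card (C - {s} - B) + of_bool (t \<notin> B)"
        using that by (simp add: insert_Diff_if)
      ultimately show "card (insert t (C - {s}) - B) + of_bool (s \<notin> B) = k + of_bool (t \<notin> B)"
        by simp
    qed
    \<comment> \<open>Kernel values at the neighbours of \<open>C\<close>, sorted by which exchanged
      points lie in \<open>B\<close>. Separation k - 1 arises only for s outside \<open>B\<close>,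
      hence never if k = 0.\<close>
    define F where "F = (\<lambda>s t. complex_of_real (zonal r (insert t (C - {s})) B))"
    have F: "F s t = (if s \<in> B then if t \<in> B then ?z * ?h (of_nat k) else of_real (zonal r A B)
                      else if t \<in> B then ?z * ?h (of_nat k - 1) else ?z * ?h (of_nat k))"
      if st: "s \<in> C" "t \<in> - C" for s t
    proof -
      let ?X = "insert t (C - {s})"
      note m = move[OF st]
      have IH: "F s t = ?z * ?h (of_nat (card (?X - B)))" if "card (?X - B) \<le> k"
        unfolding F_def using less.hyps[of ?X] that m(1) less.prems Suc by simp
      show ?thesis
      proof (cases "s \<in> B"; cases "t \<in> B")
        assume "s \<in> B" "t \<in> B" then show ?thesis using IH m(2) by simp
      next
        assume "s \<notin> B" "t \<notin> B" then show ?thesis using IH m(2) by simp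
      next
        assume "s \<in> B" "t \<notin> B"
        then have "zonal r ?X B = zonal r A B" using m Suc by (intro zonal_cong) auto
        then show ?thesis using \<open>s \<in> B\<close> \<open>t \<notin> B\<close> by (simp add: F_def)
      next
        assume "s \<notin> B" "t \<in> B"
        then have k: "k = card (?X - B) + 1" using m(2) by simp
        then have "card (?X - B) \<le> k" by linarith
        moreover have "(of_nat k - 1 :: complex) = of_nat (card (?X - B))"
          using k by (metis add_diff_cancel_right' of_nat_1 of_nat_add)
        ultimately show ?thesis using \<open>s \<notin> B\<close> \<open>t \<in> B\<close> IH by simp
      qed
    qed
    have split: "(\<Sum>x\<in>X. if x \<in> B then u else w) = of_nat (card (X \<inter> B)) * u + of_nat (card (X - B)) * w"
      for X :: "'a set" and u w :: complex
      by (simp add: sum.If_cases Diff_eq Collect_mem_eq Compl_eq)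
    have e: "- C \<inter> B = B - C" "- C - B = - (C \<union> B)" by auto
    have "(\<Sum>s\<in>C. \<Sum>t\<in>- C. F s t) = (\<Sum>s\<in>C. if s \<in> B
        then of_nat (card (B - C)) * (?z * ?h (of_nat k)) + of_nat (card (- (C \<union> B))) * of_real (zonal r A B)
        else of_nat (card (B - C)) * (?z * ?h (of_nat k - 1)) + of_nat (card (- (C \<union> B))) * (?z * ?h (of_nat k)))"
    proof (intro sum.cong refl)
      fix s assume s: "s \<in> C"
      have "(\<Sum>t\<in>- C. F s t) = (\<Sum>t\<in>- C. if t \<in> B then if s \<in> B then ?z * ?h (of_nat k) else ?z * ?h (of_nat k - 1)
           else if s \<in> B then of_real (zonal r A B) else ?z * ?h (of_nat k))"
        using s by (intro sum.cong refl) (simp add: F)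
      then show "(\<Sum>t\<in>- C. F s t) = (if s \<in> B
        then of_nat (card (B - C)) * (?z * ?h (of_nat k)) + of_nat (card (- (C \<union> B))) * of_real (zonal r A B)
        else of_nat (card (B - C)) * (?z * ?h (of_nat k - 1)) + of_nat (card (- (C \<union> B))) * (?z * ?h (of_nat k)))"
        unfolding split e by simp
    qed
    also have "\<dots> = of_nat (card (C \<inter> B)) *
          (of_nat (card (B - C)) * (?z * ?h (of_nat k)) + of_nat (card (- (C \<union> B))) * of_real (zonal r A B))
        + of_nat k * (of_nat (card (B - C)) * (?z * ?h (of_nat k - 1)) + of_nat (card (- (C \<union> B))) * (?z * ?h (of_nat k)))"
      unfolding split cCB ..
    finally have S: "(\<Sum>s\<in>C. \<Sum>t\<in>- C. F s t) = \<dots>" .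
    have "(\<Sum>s\<in>C. \<Sum>t\<in>- C. F s t) = johnson_eigenvalue ?n ?a r * of_real (zonal r C B)"
      using arg_cong[OF lift_exchange[OF evaluator_harmonic[of r B], of C], of complex_of_real]
      unfolding lift_evaluator F_def johnson_eigenvalue_def cC by simp
    moreover have "complex_of_real (zonal r C B) = ?z * ?h (of_nat k)"
      using less.hyps[of C] Suc cCB cC less.prems by simp
    moreover have "hahn_operator ?n ?a ?b ?h (of_nat k) = johnson_eigenvalue ?n ?a r * ?h (of_nat k)"
      using less.prems by (intro hahn_eigen) auto
    moreover have "of_nat (card (C \<inter> B)) = (of_nat ?a - of_nat k :: complex)"
      "of_nat (card (B - C)) = (of_nat ?b - of_nat ?a + of_nat k :: complex)"
      "of_nat (card (- (C \<union> B))) = (of_nat ?n - of_nat ?b - of_nat k :: complex)"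
      using arg_cong[OF i, of "of_nat :: nat \<Rightarrow> complex"] arg_cong[OF ii, of "of_nat :: nat \<Rightarrow> complex"]
        arg_cong[OF iii, of "of_nat :: nat \<Rightarrow> complex"] by (simp_all add: algebra_simps)
    ultimately have "(of_nat ?a - of_nat k) * (of_nat ?n - of_nat ?b - of_nat k) *
        (of_real (zonal r A B) - ?z * ?h (of_nat k + 1)) = 0"
      unfolding S hahn_operator_def by algebra
    \<comment> \<open>That \<open>A\<close> has separation k + 1 makes both coefficients of the
      unknown nonzero: k + 1 is at most |A| and at most n - |B|.\<close>
    moreover have "of_nat ?a - of_nat k \<noteq> (0 :: complex)"
    proof -
      have "card (A - B) \<le> ?a" by (intro card_mono) auto
      then have "of_nat ?a \<noteq> (of_nat k :: complex)" unfolding of_nat_eq_iff using Suc by linarith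
      then show ?thesis by simp
    qed
    moreover have "of_nat ?n - of_nat ?b - of_nat k \<noteq> (0 :: complex)"
    proof -
      have "card (A - B) \<le> card (- B)" by (intro card_mono) auto
      moreover have "card (- B) = ?n - ?b" by (simp add: Compl_eq_Diff_UNIV card_Diff_subset)
      ultimately have "?b + k < ?n" using Suc by linarith
      then have "of_nat (?b + k) \<noteq> (of_nat ?n :: complex)" unfolding of_nat_eq_iff by linarith
      then show ?thesis by (simp add: algebra_simps)
    qed
    ultimately have "of_real (zonal r A B) = ?z * ?h (of_nat k + 1)" by simp
    then show ?thesis using Suc by (simp add: add.commute)
  qed
qed

text \<open>If one such value vanished, \<open>zonal_eq_hahn\<close> would make the kernel vanish
  between the two whole shells. By \<open>sum_lift_zonal\<close> every harmonic lift of degree r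
  would vanish at \<open>A\<close>, against \<open>zonal_diag_pos\<close>.\<close>

lemma zonal_inclusion_neq_0:
  fixes A B :: "'a::finite set"
  assumes "r \<le> card A" "A \<subseteq> B" "r + card B \<le> CARD('a)" "2 * r \<le> CARD('a)"
  shows "zonal r A B \<noteq> 0"
proof
  assume z: "zonal r A B = 0"
  have le: "card A \<le> card B" using assms by (intro card_mono) auto
  have 0: "zonal r X C = 0" if X: "card X = card A" and C: "card C = card B" for X C :: "'a set"
  proof -
    obtain X0 where X0: "X0 \<subseteq> C" "card X0 = card X"
      using obtain_subset_with_card_n[of "card X" C] X C le by metis
    then have "zonal r X0 C = zonal r A B"
      using assms(2) X C by (intro zonal_cong) (simp_all add: Diff_eq_empty_iff[THEN iffD2])
    then have "complex_of_real (zonal r X C) = 0"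
      using zonal_eq_hahn[of r X C X0] X C X0 z assms by simp
    then show ?thesis by simp
  qed
  have "lift c A = 0" if "c \<in> harmonic r" for c
  proof -
    have "real ((CARD('a) - 2 * r) choose (card B - r)) * lift c A
        = (\<Sum>C | card C = card B. lift c C * zonal r C A)"
      using that assms le by (intro sum_lift_zonal[symmetric]) auto
    also have "\<dots> = 0" using 0[of A] by (intro sum.neutral) (simp add: zonal_commute[of r _ A])
    finally have "real ((CARD('a) - 2 * r) choose (card B - r)) * lift c A = 0" .
    moreover have "(CARD('a) - 2 * r) choose (card B - r) > 0"
      using assms le by (intro zero_less_binomial) linarith
    ultimately show ?thesis by simp
  qed
  then have "zonal r A A = 0" unfolding zonal_def using harmonic_basis(1) by (intro sum.neutral) auto
  moreover have "zonal r A A > 0" using assms le by (intro zonal_diag_pos) auto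
  ultimately show False by simp
qed

section \<open>Tight weights on two shells\<close>

lemma deg_le_lift_harmonic: "c \<in> harmonic r \<Longrightarrow> deg_le r (lift c)"
  by (simp add: deg_le_lift harmonic_def)

text \<open>On one shell, \<open>lift_decomposition\<close> writes \<open>f\<close> through harmonic
  lifts of degree at most d, and lifts of different degrees are orthogonal there.\<close>

lemma sum_deg_le_lift_eq_0:
  fixes c :: "real ^ ('a::finite set)"
  assumes "deg_le d f" "d < s" "c \<in> harmonic s"
  shows "(\<Sum>A | card A = k. f A * lift c A) = 0"
proof -
  obtain a where f: "f = (\<lambda>A. \<Sum>T | card T \<le> d. a T * of_bool (T \<subseteq> A))"
    using assms(1) by (auto simp: deg_le_def)
  have "(\<Sum>A | card A = k. of_bool (T \<subseteq> A) * lift c A) = 0" if T: "card T \<le> d" for T :: "'a set"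
  proof -
    have "axis T (1::real) \<in> homogeneous (card T)"
      by (auto simp: homogeneous_def axis_def)
    from lift_decomposition[OF this] obtain c' p where
      c': "\<forall>r\<le>card T. c' r \<in> harmonic r"
      and eq: "\<And>A. of_bool (T \<subseteq> A) = (\<Sum>r\<le>card T. p r (card A) * lift (c' r) A)"
      unfolding lift_axis by blast
    have "(\<Sum>A | card A = k. of_bool (T \<subseteq> A) * lift c A)
        = (\<Sum>A | card A = k. \<Sum>r\<le>card T. p r k * (lift (c' r) A * lift c A))"
      unfolding eq sum_distrib_right by (intro sum.cong refl) auto
    also have "\<dots> = (\<Sum>r\<le>card T. p r k * (\<Sum>A | card A = k. lift (c' r) A * lift c A))"
      by (subst sum.swap) (simp add: sum_distrib_left)
    also have "\<dots> = 0"
    proof (intro sum.neutral ballI)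
      fix r assume "r \<in> {..card T}"
      then have "(\<Sum>A | card A = k. lift (c' r) A * lift c A) = 0"
        using c' T assms(2,3) by (intro sum_lift_lift_neq[of _ r _ s]) auto
      then show "p r k * (\<Sum>A | card A = k. lift (c' r) A * lift c A) = 0" by simp
    qed
    finally show ?thesis .
  qed
  note T = this
  have "(\<Sum>A | card A = k. f A * lift c A)
      = (\<Sum>A | card A = k. \<Sum>T | card T \<le> d. a T * (of_bool (T \<subseteq> A) * lift c A))"
    unfolding f sum_distrib_right by (intro sum.cong refl) auto
  also have "\<dots> = (\<Sum>T | card T \<le> d. a T * (\<Sum>A | card A = k. of_bool (T \<subseteq> A) * lift c A))"
    by (subst sum.swap) (simp only: sum_distrib_left)
  also have "\<dots> = 0" using T by (intro sum.neutral) simp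
  finally show ?thesis .
qed

lemma sum_shell_cong:
  fixes A A' C C' :: "'a::finite set"
  assumes "card A = card A'" "card C = card C'" "card (A - C) = card (A' - C')"
  shows "(\<Sum>B | card B = b. F (card (A - B)) (card (B - C)))
       = (\<Sum>B | card B = b. F (card (A' - B)) (card (B - C')))"
proof -
  obtain f where f: "bij f" "f ` A = A'" "f ` C = C'"
    by (rule exists_permutation[OF assms])
  have inj: "inj f" using f(1) by (rule bij_is_inj)
  have c: "card (f ` X) = card X" for X using inj by (simp add: card_image inj_on_subset)
  have "bij_betw ((`) f) {B. card B = b} {B. card B = b}"
  proof (rule bij_betwI[where g = "(`) (inv f)"])
    have "card (inv f ` X) = card X" for X
      using f(1) by (intro card_image inj_on_subset[OF bij_is_inj[OF bij_imp_bij_inv]]) auto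
    then show "(`) (inv f) \<in> {B. card B = b} \<rightarrow> {B. card B = b}" by simp
    show "(`) f \<in> {B. card B = b} \<rightarrow> {B. card B = b}" using c by simp
    show "inv f ` f ` X = X" for X using inj by (simp add: image_image)
    show "f ` inv f ` X = X" for X using f(1) by (simp add: image_image bij_is_surj surj_f_inv_f)
  qed
  then have "(\<Sum>B | card B = b. F (card (A' - B)) (card (B - C')))
      = (\<Sum>B | card B = b. F (card (A' - f ` B)) (card (f ` B - C')))"
    by (rule sum.reindex_bij_betw[symmetric])
  also have "\<dots> = (\<Sum>B | card B = b. F (card (A - B)) (card (B - C)))"
  proof (intro sum.cong refl)
    fix B
    have "A' - f ` B = f ` (A - B)" "f ` B - C' = f ` (B - C)"
      using f inj by (simp_all add: image_set_diff)
    then show "F (card (A' - f ` B)) (card (f ` B - C')) = F (card (A - B)) (card (B - C))"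
      by (simp add: c)
  qed
  finally show ?thesis by simp
qed

section \<open>Univariate polynomials: exact degrees and interpolation\<close>

lemma degree_graded_sum:
  fixes p :: "nat \<Rightarrow> 'b::comm_ring poly"
  assumes "\<And>i. i < d \<Longrightarrow> degree (p i) \<le> i" "degree q = d"
  shows "degree ((\<Sum>i<d. p i) + q) = d"
proof (cases d)
  case (Suc k)
  have "degree (p i) \<le> k" if "i \<in> {..<d}" for i
    using assms(1)[of i] that Suc by simp
  then have "degree (\<Sum>i<d. p i) \<le> k" by (intro degree_sum_le) auto
  then show ?thesis using assms(2) Suc by (subst degree_add_eq_right) auto
qed (use assms in simp)

definition falling_poly :: "nat \<Rightarrow> complex poly" where
  "falling_poly i = (\<Prod>j<i. [:of_nat j, - 1:])"

lemma poly_falling: "poly (falling_poly i) \<xi> = pochhammer (- \<xi>) i"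
  by (simp add: falling_poly_def poly_prod pochhammer_prod atLeast0LessThan algebra_simps)

lemma degree_falling: "degree (falling_poly i) = i"
  unfolding falling_poly_def by (subst degree_prod_eq_sum_degree) auto

text \<open>The denominators matter as well, since division by zero would yield 0. In the numerator,
  the last factor stays nonzero because r is at most n + 1 - r.\<close>

lemma hahn_coeff_neq_0:
  assumes "r \<le> a" "r + b \<le> n" "2 * r \<le> n"
  shows "hahn_coeff n a b r r \<noteq> 0"
proof -
  have "of_nat r - of_nat n - 1 = - (of_nat (n + 1 - r) :: complex)"
    "of_nat b - of_nat n = - (of_nat (n - b) :: complex)"
    using assms by (simp_all add: of_nat_diff)
  moreover have "r \<le> n + 1 - r" "r \<le> n - b" using assms by linarith+
  ultimately show ?thesis
    using assms by (simp add: hahn_coeff_def pochhammer_of_nat_eq_0_iff not_less del: of_nat_diff)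
qed

lemma hahn_poly:
  assumes "r \<le> a" "r + b \<le> n" "2 * r \<le> n"
  obtains p where "degree p = r" "\<And>\<xi>. poly p \<xi> = hahn n a b r \<xi>"
proof -
  let ?c = "hahn_coeff n a b r"
  define p where "p = (\<Sum>i<r. smult (?c i) (falling_poly i)) + smult (?c r) (falling_poly r)"
  have "degree p = r"
    unfolding p_def using hahn_coeff_neq_0[OF assms]
    by (intro degree_graded_sum) (auto simp: degree_falling intro: le_trans[OF degree_smult_le])
  moreover have "poly p \<xi> = hahn n a b r \<xi>" for \<xi>
    unfolding p_def hahn_eq_sum
    by (simp add: poly_sum poly_falling lessThan_Suc_atMost[symmetric])
  ultimately show thesis by (rule that)
qed

lemma interpolation_coefficients:
  fixes g :: "nat \<Rightarrow> complex"
  assumes "finite N"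
  shows "\<exists>c. \<forall>x\<in>N. (\<Sum>i<card N. c i * of_nat x ^ i) = g x"
proof -
  \<comment> \<open>The empty set is carried separately, as no degree lies below 0.\<close>
  have "\<exists>p. (N \<noteq> {} \<longrightarrow> degree p < card N) \<and> (N = {} \<longrightarrow> p = 0) \<and> (\<forall>x\<in>N. poly p (of_nat x) = g x)"
    using assms
  proof (induction N rule: finite_induct)
    case (insert a N)
    then obtain p where p: "N \<noteq> {} \<longrightarrow> degree p < card N" "N = {} \<longrightarrow> p = 0"
      "\<forall>x\<in>N. poly p (of_nat x) = g x" by blast
    define q where "q = (\<Prod>x\<in>N. [:- of_nat x, 1 :: complex:])"
    have q0: "poly q (of_nat x) = 0 \<longleftrightarrow> x \<in> N" for x
      using insert.hyps(1) by (auto simp: q_def poly_prod)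
    have dq: "degree q = card N" unfolding q_def by (subst degree_prod_eq_sum_degree) auto
    define p' where "p' = p + smult ((g a - poly p (of_nat a)) / poly q (of_nat a)) q"
    have "degree p' \<le> card N"
      unfolding p'_def using p(1,2) dq
      by (intro degree_add_le le_trans[OF degree_smult_le]) (cases "N = {}"; auto)+
    then have "degree p' < card (insert a N)" using insert.hyps by simp
    moreover have "poly p' (of_nat x) = g x" if "x \<in> insert a N" for x
      using that p(3) q0 insert.hyps(2) by (auto simp: p'_def)
    ultimately show ?case by blast
  qed auto
  then obtain p where p: "N \<noteq> {} \<longrightarrow> degree p < card N" "\<forall>x\<in>N. poly p (of_nat x) = g x"
    by blast
  have "(\<Sum>i<card N. coeff p i * of_nat x ^ i) = g x" if x: "x \<in> N" for x
  proof -
    have "degree p < card N" using p(1) x by auto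
    then have "(\<Sum>i<card N. coeff p i * of_nat x ^ i) = (\<Sum>i\<le>degree p. coeff p i * of_nat x ^ i)"
      by (intro sum.mono_neutral_right) (auto simp: coeff_eq_0)
    then show ?thesis using p(2) x by (simp add: poly_altdef)
  qed
  then show ?thesis by (intro exI[of _ "coeff p"]) blast
qed

lemma card_Diff_swap:
  fixes A B :: "'a::finite set"
  shows "card (A - B) + card B = card (B - A) + card A"
  by (metis Un_Diff_cancel Un_Diff_cancel2 Un_commute add.commute card_Un_disjoint Diff_disjoint finite)

text \<open>What the combinatorial part uses of a tight relative design, the base vertex being the
  empty set. \<open>quadrature\<close> encodes the design property, \<open>interpolation\<close> the
  tightness: each support point is isolated within the support by a polynomial of degree at most
  \<open>e\<close>.\<close>

locale tight_weight =
  fixes w :: "'a::finite set \<Rightarrow> real" and e l m :: nat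
  assumes nonneg: "w A \<ge> 0"
    and params: "1 \<le> e" "e \<le> l" "l < m" "m + l \<le> CARD('a)"
    and support: "w A \<noteq> 0 \<Longrightarrow> card A \<in> {l, m}"
    and occupied: "k \<in> {l, m} \<Longrightarrow> \<exists>A. card A = k \<and> w A > 0"
    and quadrature: "deg_le (2 * e) f \<Longrightarrow>
      (\<Sum>A\<in>UNIV. w A * f A) = (\<Sum>A\<in>UNIV. w A * shell_avg f (card A))"
    and interpolation: "w A > 0 \<Longrightarrow> \<exists>f. deg_le e f \<and> (\<forall>B. w B > 0 \<longrightarrow> f B = of_bool (B = A))"
begin

definition layer :: "nat \<Rightarrow> 'a set set" where
  "layer k = {A. card A = k \<and> w A > 0}"

definition W :: "nat \<Rightarrow> real" where
  "W k = (\<Sum>A | card A = k. w A)"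

definition \<kappa> :: real where
  "\<kappa> = kappa CARD('a) e l m (W l) (W m)"

lemma shell_range: "k \<in> {l, m} \<Longrightarrow> e \<le> k \<and> k \<le> CARD('a) - e \<and> e + k \<le> CARD('a) \<and> 2 * e \<le> CARD('a)"
  using params by auto

lemma choose_pos:
  assumes "k \<in> {l, m}" "r \<le> e"
  shows "real (CARD('a) choose k) > 0" "real ((CARD('a) - 2 * r) choose (k - r)) > 0"
proof -
  have "k \<le> CARD('a)" "k - r \<le> CARD('a) - 2 * r" using shell_range[OF assms(1)] assms(2) by auto
  then show "real (CARD('a) choose k) > 0" "real ((CARD('a) - 2 * r) choose (k - r)) > 0"
    by (simp_all only: of_nat_0_less_iff zero_less_binomial)
qed

lemma W_pos: "k \<in> {l, m} \<Longrightarrow> W k > 0"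
proof -
  assume "k \<in> {l, m}"
  then obtain A where "card A = k" "w A > 0" using occupied by blast
  then show ?thesis unfolding W_def using nonneg by (intro sum_pos2[of _ A]) auto
qed

lemma kappa_part_pos: "k \<in> {l, m} \<Longrightarrow> kappa_part CARD('a) e k (W k) > 0"
  unfolding kappa_part_def using choose_pos[of k e] W_pos[of k] by simp

lemma \<kappa>_pos: "\<kappa> > 0"
  unfolding \<kappa>_def kappa_def using kappa_part_pos[of l] kappa_part_pos[of m] by simp

lemma sum_weight_card: "(\<Sum>A\<in>UNIV. w A * h (card A)) = (\<Sum>k\<in>{l, m}. W k * h k)"
proof -
  have "(\<Sum>A\<in>UNIV. w A * h (card A)) = (\<Sum>A | card A \<in> {l, m}. w A * h (card A))"
    using support by (intro sum.mono_neutral_right) auto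
  also have "\<dots> = (\<Sum>k\<in>{l, m}. \<Sum>A | A \<in> {A. card A \<in> {l, m}} \<and> card A = k. w A * h (card A))"
    by (rule sum.group[symmetric]) auto
  also have "\<dots> = (\<Sum>k\<in>{l, m}. W k * h k)"
    unfolding W_def sum_distrib_right by (intro sum.cong refl) auto
  finally show ?thesis .
qed

lemma quadrature_shells:
  "deg_le (2 * e) f \<Longrightarrow> (\<Sum>A\<in>UNIV. w A * f A) = (\<Sum>k\<in>{l, m}. W k * shell_avg f k)"
  unfolding quadrature sum_weight_card ..

text \<open>Affine function of the size with value 1 on shell b and 0 on the other one, whose index
  is l + m - b.\<close>

definition selector :: "nat \<Rightarrow> 'a set \<Rightarrow> real" where
  "selector b A = (1 / (real b - real (l + m - b))) * (real (card A) - real (l + m - b))"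

lemma deg_le_selector: "deg_le 1 (selector b)"
  unfolding selector_def by (intro deg_le_scale deg_le_diff deg_le_card deg_le_const)

lemma selector_eq:
  "b \<in> {l, m} \<Longrightarrow> card A \<in> {l, m} \<Longrightarrow> selector b A = of_bool (card A = b)"
  using params by (auto simp: selector_def)

text \<open>The factor \<open>selector b\<close> cuts out one shell and uses up one of the 2e
  degrees.\<close>

lemma quadrature_layer:
  assumes b: "b \<in> {l, m}" and f: "deg_le (2 * e - 1) f"
  shows "(\<Sum>A\<in>layer b. w A * f A) = W b * shell_avg f b"
proof -
  have deg: "deg_le (2 * e) (\<lambda>A. f A * selector b A)"
    using deg_le_mult[OF f deg_le_selector] params by simp
  have avg: "shell_avg (\<lambda>A. f A * selector b A) k = of_bool (k = b) * shell_avg f b"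
    if "k \<in> {l, m}" for k
    unfolding shell_avg_def using selector_eq[OF b] that
    by (cases "k = b") (auto intro!: sum.cong arg_cong2[of _ _ _ _ "(/)"])
  have "(\<Sum>A\<in>layer b. w A * f A) = (\<Sum>A\<in>UNIV. w A * (f A * selector b A))"
  proof (rule sum.mono_neutral_cong_left)
    show "\<forall>A\<in>UNIV - layer b. w A * (f A * selector b A) = 0"
    proof
      fix A assume A: "A \<in> UNIV - layer b"
      show "w A * (f A * selector b A) = 0"
      proof (cases "w A = 0")
        case False
        then have "card A \<noteq> b" using A nonneg[of A] by (auto simp: layer_def)
        then show ?thesis using selector_eq[OF b support[OF False]] by simp
      qed simp
    qed
    show "w A * f A = w A * (f A * selector b A)" if "A \<in> layer b" for A
      using that selector_eq[OF b, of A] b by (simp add: layer_def)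
  qed auto
  also have "\<dots> = (\<Sum>k\<in>{l, m}. W k * shell_avg (\<lambda>A. f A * selector b A) k)"
    by (rule quadrature_shells[OF deg])
  also have "\<dots> = (\<Sum>k\<in>{l, m}. if k = b then W b * shell_avg f b else 0)"
    using avg by (intro sum.cong refl) auto
  also have "\<dots> = W b * shell_avg f b" using b by (simp add: sum.delta del: insert_iff sum.insert)
  finally show ?thesis .
qed

text \<open>Each zonal term is divided by its squared norm in the symmetrised weight. For r < e
  every shell has its own copy, hence the indicator of equal sizes and, on shell k, the norm W k *
  binom(n - 2r, k - r) / binom(n, k). In degree e a single copy lives on both shells, and the two
  norms add up to 2^(n - 2e) * \<kappa>.\<close>

definition kernel :: "'a set \<Rightarrow> 'a set \<Rightarrow> real" where
  "kernel A B =
     of_bool (card A = card B) * (\<Sum>r<e. real (CARD('a) choose card B) /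
       (W (card B) * real ((CARD('a) - 2 * r) choose (card B - r))) * zonal r A B)
     + zonal e A B / (2 ^ (CARD('a) - 2 * e) * \<kappa>)"

lemma deg_le_zonal: "deg_le r (\<lambda>A. zonal r A B)"
proof -
  have "(\<lambda>A. zonal r A B) = lift (evaluator r B)" by (simp add: fun_eq_iff lift_evaluator)
  then show ?thesis by (simp add: deg_le_lift_harmonic evaluator_harmonic)
qed

lemma kernel_deg_le:
  assumes "card B \<in> {l, m}"
  obtains g where "deg_le e g" "\<And>A. card A \<in> {l, m} \<Longrightarrow> kernel A B = g A"
proof -
  define g where "g = (\<lambda>A. selector (card B) A * (\<Sum>r<e. real (CARD('a) choose card B) /
       (W (card B) * real ((CARD('a) - 2 * r) choose (card B - r))) * zonal r A B)
     + (1 / (2 ^ (CARD('a) - 2 * e) * \<kappa>)) * zonal e A B)"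
  \<comment> \<open>Cutting to one shell raises the degree by one, which is affordable since r <
    e.\<close>
  have "deg_le (1 + (e - 1)) (\<lambda>A. selector (card B) A * (\<Sum>r<e. real (CARD('a) choose card B) /
       (W (card B) * real ((CARD('a) - 2 * r) choose (card B - r))) * zonal r A B))"
    by (intro deg_le_mult deg_le_selector deg_le_sum deg_le_scale deg_le_mono[OF deg_le_zonal]) auto
  then have "deg_le e g"
    unfolding g_def using params
    by (intro deg_le_add deg_le_scale deg_le_zonal) simp
  moreover have "kernel A B = g A" if "card A \<in> {l, m}" for A
    unfolding g_def kernel_def selector_eq[OF assms that] by simp
  ultimately show thesis by (rule that)
qed

text \<open>Inner product of \<open>f\<close> with the kernel column of \<open>B\<close> in the
  symmetrised weight.\<close>

definition smear :: "'a set \<Rightarrow> ('a set \<Rightarrow> real) \<Rightarrow> real" where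
  "smear B f = (\<Sum>k\<in>{l, m}. W k * shell_avg (\<lambda>A. f A * kernel A B) k)"

lemma smear_sum: "smear B (\<lambda>A. \<Sum>i\<in>I. f i A) = (\<Sum>i\<in>I. smear B (f i))"
proof -
  have "shell_avg (\<lambda>A. (\<Sum>i\<in>I. f i A) * kernel A B) k = (\<Sum>i\<in>I. shell_avg (\<lambda>A. f i A * kernel A B) k)" for k
    unfolding shell_avg_def sum_distrib_right
    by (subst sum.swap) (simp only: sum_divide_distrib)
  then show ?thesis
    unfolding smear_def sum_distrib_left by (simp only: sum_distrib_left) (rule sum.swap)
qed

lemma smear_scale: "smear B (\<lambda>A. a * f A) = a * smear B f"
proof -
  have "shell_avg (\<lambda>A. (a * f A) * kernel A B) k = a * shell_avg (\<lambda>A. f A * kernel A B) k" for k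
    unfolding shell_avg_def by (simp add: sum_distrib_left mult.assoc)
  then show ?thesis
    unfolding smear_def sum_distrib_left by (simp only:) (simp only: mult.left_commute)
qed

lemma shell_sum_lift_kernel:
  assumes "c \<in> harmonic r" "k \<in> {l, m}"
  shows "(\<Sum>A | card A = k. lift c A * kernel A B) =
    of_bool (k = card B) * (\<Sum>s<e. real (CARD('a) choose k) /
       (W k * real ((CARD('a) - 2 * s) choose (k - s))) * (\<Sum>A | card A = k. lift c A * zonal s A B))
     + (\<Sum>A | card A = k. lift c A * zonal e A B) / (2 ^ (CARD('a) - 2 * e) * \<kappa>)"
proof -
  have "(\<Sum>A | card A = k. lift c A * kernel A B) = (\<Sum>A | card A = k.
      (\<Sum>s<e. of_bool (k = card B) * (real (CARD('a) choose k) /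
       (W k * real ((CARD('a) - 2 * s) choose (k - s))) * (lift c A * zonal s A B)))
      + lift c A * zonal e A B / (2 ^ (CARD('a) - 2 * e) * \<kappa>))"
    unfolding kernel_def
    by (intro sum.cong refl) (auto simp: distrib_left sum_distrib_left mult_ac)
  also have "\<dots> = (\<Sum>s<e. of_bool (k = card B) * (real (CARD('a) choose k) /
       (W k * real ((CARD('a) - 2 * s) choose (k - s))) * (\<Sum>A | card A = k. lift c A * zonal s A B)))
      + (\<Sum>A | card A = k. lift c A * zonal e A B) / (2 ^ (CARD('a) - 2 * e) * \<kappa>)"
    unfolding sum.distrib sum_divide_distrib sum_distrib_left by (subst sum.swap) simp
  finally show ?thesis unfolding sum_distrib_left .
qed

text \<open>\<open>p\<close> is arbitrary because degrees below e have a separate copy on each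
  shell: the kernel reproduces on the shell of \<open>B\<close> and is orthogonal to the lift on the
  other one.\<close>

lemma smear_lift_low:
  assumes "c \<in> harmonic r" "r < e" "card B \<in> {l, m}"
  shows "smear B (\<lambda>A. p (card A) * lift c A) = p (card B) * lift c B"
proof -
  have "W k * shell_avg (\<lambda>A. p (card A) * lift c A * kernel A B) k
      = (if k = card B then p (card B) * lift c B else 0)" if k: "k \<in> {l, m}" for k
  proof -
    have e0: "(\<Sum>A | card A = k. lift c A * zonal e A B) = 0"
      using assms by (intro sum_lift_zonal_neq[of _ r]) auto
    have z: "(\<Sum>A | card A = k. lift c A * zonal s A B)
        = (if s = r then real ((CARD('a) - 2 * r) choose (k - r)) * lift c B else 0)" for s
      using sum_lift_zonal_neq[OF assms(1), where s = s and k = k and B = B] sum_lift_zonal[OF assms(1), of k B]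
        shell_range[OF k] assms(2) by auto
    have "(\<Sum>s<e. real (CARD('a) choose k) /
         (W k * real ((CARD('a) - 2 * s) choose (k - s))) * (\<Sum>A | card A = k. lift c A * zonal s A B))
        = (\<Sum>s<e. if s = r then real (CARD('a) choose k) / W k * lift c B else 0)"
      unfolding z using choose_pos[OF k, of r] assms(2) by (intro sum.cong refl) auto
    then have "(\<Sum>A | card A = k. lift c A * kernel A B)
        = of_bool (k = card B) * (real (CARD('a) choose k) / W k * lift c B)"
      unfolding shell_sum_lift_kernel[OF assms(1) k] e0 using assms(2) by simp
    moreover have "(\<Sum>A | card A = k. p (card A) * lift c A * kernel A B)
        = p k * (\<Sum>A | card A = k. lift c A * kernel A B)"
      unfolding sum_distrib_left by (intro sum.cong refl) auto
    ultimately show ?thesis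
      unfolding shell_avg_def using choose_pos(1)[OF k, of 0] W_pos[OF k] by simp
  qed
  then have "smear B (\<lambda>A. p (card A) * lift c A) = (\<Sum>k\<in>{l, m}. if k = card B then p (card B) * lift c B else 0)"
    unfolding smear_def by (intro sum.cong refl)
  also have "\<dots> = p (card B) * lift c B"
    using assms(3) by (simp add: sum.delta del: insert_iff sum.insert)
  finally show ?thesis .
qed

text \<open>Here both shells contribute, in the proportions \<open>kappa_part\<close> / \<kappa>,
  which add up to 1.\<close>

lemma smear_lift_top:
  assumes "c \<in> harmonic e" "card B \<in> {l, m}"
  shows "smear B (lift c) = lift c B"
proof -
  have "W k * shell_avg (\<lambda>A. lift c A * kernel A B) k
      = kappa_part CARD('a) e k (W k) / \<kappa> * lift c B" if k: "k \<in> {l, m}" for k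
  proof -
    have z: "(\<Sum>A | card A = k. lift c A * zonal s A B) = 0" if "s < e" for s
      using that by (intro sum_lift_zonal_neq[OF assms(1)]) auto
    have ze: "(\<Sum>A | card A = k. lift c A * zonal e A B)
        = real ((CARD('a) - 2 * e) choose (k - e)) * lift c B"
      using shell_range[OF k] by (intro sum_lift_zonal assms) auto
    have "(\<Sum>A | card A = k. lift c A * kernel A B)
        = real ((CARD('a) - 2 * e) choose (k - e)) * lift c B / (2 ^ (CARD('a) - 2 * e) * \<kappa>)"
      unfolding shell_sum_lift_kernel[OF assms(1) k] ze using z by simp
    then show ?thesis unfolding shell_avg_def kappa_part_def by (simp add: mult_ac)
  qed
  then have "smear B (lift c) = (\<Sum>k\<in>{l, m}. kappa_part CARD('a) e k (W k) / \<kappa> * lift c B)"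
    unfolding smear_def by (intro sum.cong refl)
  also have "\<dots> = (kappa_part CARD('a) e l (W l) + kappa_part CARD('a) e m (W m)) / \<kappa> * lift c B"
    using params by (simp add: add_divide_distrib distrib_right)
  also have "\<dots> = lift c B" using \<kappa>_pos by (simp add: \<kappa>_def kappa_def)
  finally show ?thesis .
qed

text \<open>\<open>kernel\<close> is the reproducing kernel of the polynomials of degree at most \<open>e\<close> on the two shells.\<close>

lemma smear_reproduces:
  assumes "deg_le e f" "card B \<in> {l, m}"
  shows "smear B f = f B"
proof -
  obtain a where f: "f = (\<lambda>A. \<Sum>T | card T \<le> e. a T * of_bool (T \<subseteq> A))"
    using assms(1) by (auto simp: deg_le_def)
  have "smear B (\<lambda>A. of_bool (T \<subseteq> A)) = of_bool (T \<subseteq> B)" if T: "card T \<le> e" for T :: "'a set"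
  proof -
    have "axis T (1::real) \<in> homogeneous (card T)"
      by (auto simp: homogeneous_def axis_def)
    from lift_decomposition[OF this] obtain c p where
      c: "\<forall>r\<le>card T. c r \<in> harmonic r"
      and eq: "\<And>A. of_bool (T \<subseteq> A) = (\<Sum>r\<le>card T. p r (card A) * lift (c r) A)"
      and top: "\<And>k. p (card T) k = (1 :: real)"
      unfolding lift_axis by blast
    have "smear B (\<lambda>A. p r (card A) * lift (c r) A) = p r (card B) * lift (c r) B"
      if r: "r \<le> card T" for r
    proof (cases "r < e")
      case True
      then show ?thesis using c r assms(2) by (intro smear_lift_low) auto
    next
      case False
      \<comment> \<open>The top coefficient in \<open>lift_decomposition\<close> is 1 on all shells,
        so this term is a pure lift.\<close>
      then have "r = e" "card T = e" using r T by auto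
      then show ?thesis using smear_lift_top[of "c e" B] c top assms(2) by simp
    qed
    then show ?thesis unfolding eq smear_sum by (intro sum.cong) auto
  qed
  then show ?thesis unfolding f smear_sum smear_scale by (intro sum.cong) auto
qed

text \<open>Integrate the interpolant of \<open>A\<close> times the kernel column of
  \<open>B\<close>: on the support only \<open>A\<close> contributes, while the quadrature turns the
  integral into \<open>smear\<close>, which returns the interpolant at \<open>B\<close>.\<close>

lemma kernel_on_support:
  assumes "w A > 0" "w B > 0"
  shows "w A * kernel A B = of_bool (A = B)"
proof -
  have cA: "card A \<in> {l, m}" and cB: "card B \<in> {l, m}"
    using assms support by (metis less_irrefl)+
  obtain g where g: "deg_le e g" "\<And>C. card C \<in> {l, m} \<Longrightarrow> kernel C B = g C"
    by (rule kernel_deg_le[OF cB]) blast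
  obtain f where f: "deg_le e f" "\<forall>C. w C > 0 \<longrightarrow> f C = of_bool (C = A)"
    using interpolation[OF assms(1)] by blast
  have "(\<Sum>C\<in>UNIV. w C * (f C * g C)) = (\<Sum>C\<in>UNIV. if C = A then w A * g A else 0)"
  proof (intro sum.cong refl)
    fix C
    show "w C * (f C * g C) = (if C = A then w A * g A else 0)"
      using f(2) nonneg[of C] assms(1) by (cases "w C = 0") auto
  qed
  then have "w A * g A = (\<Sum>C\<in>UNIV. w C * (f C * g C))" by simp
  also have "\<dots> = (\<Sum>k\<in>{l, m}. W k * shell_avg (\<lambda>C. f C * g C) k)"
    using deg_le_mult[OF f(1) g(1)] by (intro quadrature_shells) (simp add: mult_2)
  also have "\<dots> = smear B f"
    unfolding smear_def shell_avg_def using g(2) by (intro sum.cong refl) auto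
  also have "\<dots> = of_bool (A = B)"
    using smear_reproduces[OF f(1) cB] f(2) assms(2) by auto
  finally show ?thesis using g(2)[OF cA] by simp
qed

text \<open>In the terms with r < e, \<open>W k\<close> and the binomials cancel against the norm
  and the diagonal value of \<open>zonal\<close>; only the term of degree e keeps a weight.\<close>

lemma kernel_same_shell:
  assumes "k \<in> {l, m}" "card A = k" "card B = k"
  shows "complex_of_real (W k * kernel A B) = psi_diag CARD('a) e k (W k) \<kappa> (of_nat (card (A - B)))"
proof -
  let ?\<xi> = "of_nat (card (A - B)) :: complex"
  have z: "of_real (zonal r A B) = of_real (real ((CARD('a) - 2 * r) choose (k - r)) * binomial_diff CARD('a) r
      / real (CARD('a) choose k)) * hahn CARD('a) k k r ?\<xi>" if r: "r \<le> e" for r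
  proof -
    have "real (CARD('a) choose k) * zonal r B B = real ((CARD('a) - 2 * r) choose (k - r)) * binomial_diff CARD('a) r"
    proof -
      have "r \<le> k" "k \<le> CARD('a) - r" "2 * r \<le> CARD('a)" using shell_range[OF assms(1)] r by linarith+
      then show ?thesis using zonal_diag[of r B] assms(3) by simp
    qed
    then have "zonal r B B = real ((CARD('a) - 2 * r) choose (k - r)) * binomial_diff CARD('a) r / real (CARD('a) choose k)"
      using choose_pos(1)[OF assms(1), of 0] by (simp add: field_simps)
    moreover have "of_real (zonal r A B) = of_real (zonal r B B) * hahn CARD('a) k k r ?\<xi>"
      using zonal_eq_hahn[of r A B B] shell_range[OF assms(1)] r assms by simp
    ultimately show ?thesis by simp
  qed
  have W: "W k \<noteq> 0" using W_pos[OF assms(1)] by simp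
  have low: "complex_of_real (W k * (real (CARD('a) choose k) /
      (W k * real ((CARD('a) - 2 * r) choose (k - r))) * zonal r A B))
      = of_real (binomial_diff CARD('a) r) * hahn CARD('a) k k r ?\<xi>" if r: "r < e" for r
  proof -
    have "complex_of_real (W k * (real (CARD('a) choose k) /
      (W k * real ((CARD('a) - 2 * r) choose (k - r))) * zonal r A B))
      = of_real (real (CARD('a) choose k) / real ((CARD('a) - 2 * r) choose (k - r))) * of_real (zonal r A B)"
      using W by simp
    also have "\<dots> = of_real (binomial_diff CARD('a) r) * hahn CARD('a) k k r ?\<xi>"
      unfolding z[OF less_imp_le[OF r]] mult.assoc[symmetric] of_real_mult[symmetric]
      using choose_pos[OF assms(1), of r] r by simp
    finally show ?thesis .
  qed
  have "complex_of_real (W k * kernel A B) = (\<Sum>r<e. complex_of_real (W k * (real (CARD('a) choose k) /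
      (W k * real ((CARD('a) - 2 * r) choose (k - r))) * zonal r A B)))
      + of_real (W k / (2 ^ (CARD('a) - 2 * e) * \<kappa>)) * of_real (zonal e A B)"
    unfolding kernel_def using assms(2,3) by (simp add: distrib_left sum_distrib_left)
  also have "\<dots> = psi_diag CARD('a) e k (W k) \<kappa> ?\<xi>"
  proof -
    have "of_real (W k / (2 ^ (CARD('a) - 2 * e) * \<kappa>)) * complex_of_real (zonal e A B)
       = of_real (W k * real ((CARD('a) - 2 * e) choose (k - e)) * binomial_diff CARD('a) e /
                (2 ^ (CARD('a) - 2 * e) * \<kappa> * real (CARD('a) choose k))) * hahn CARD('a) k k e ?\<xi>"
      unfolding z[OF order_refl] by simp
    then show ?thesis unfolding psi_diag_def using low by simp
  qed
  finally show ?thesis .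
qed

text \<open>Only the term of degree e links different shells, and its normalising value at a subset
  of \<open>B\<close> is nonzero.\<close>

lemma kernel_off_shell:
  assumes "card A = l" "card B = m"
  shows "kernel A B = 0 \<longleftrightarrow> psi_off CARD('a) e l m (of_nat (card (A - B))) = 0"
proof -
  obtain A0 where A0: "A0 \<subseteq> B" "card A0 = l"
    using obtain_subset_with_card_n[of l B] assms params by (metis less_imp_le)
  have nz: "zonal e A0 B \<noteq> 0"
    using params A0 assms by (intro zonal_inclusion_neq_0) auto
  have "complex_of_real (zonal e A B)
      = of_real (zonal e A0 B) * psi_off CARD('a) e l m (of_nat (card (A - B)))"
    unfolding psi_off_def using zonal_eq_hahn[of e A B A0] params A0 assms by simp
  then have "zonal e A B = 0 \<longleftrightarrow> psi_off CARD('a) e l m (of_nat (card (A - B))) = 0"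
    using nz by (metis mult_eq_0_iff of_real_eq_0_iff)
  then show ?thesis unfolding kernel_def using assms params \<kappa>_pos by simp
qed

lemma psi_diag_eq_0_iff:
  assumes "k \<in> {l, m}" "A \<in> layer k" "B \<in> layer k"
  shows "psi_diag CARD('a) e k (W k) \<kappa> (of_nat (card (A - B))) = 0 \<longleftrightarrow> A \<noteq> B"
proof -
  have "w A > 0" "w B > 0" "card A = k" "card B = k" using assms(2,3) by (auto simp: layer_def)
  then show ?thesis
    using kernel_on_support[of A B] kernel_same_shell[OF assms(1), of A B] W_pos[OF assms(1)]
    by (cases "A = B") (auto simp flip: kernel_same_shell[OF assms(1)])
qed

lemma psi_off_eq_0:
  assumes "A \<in> layer l" "B \<in> layer m"
  shows "psi_off CARD('a) e l m (of_nat (card (A - B))) = 0"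
proof -
  have "w A > 0" "w B > 0" "card A = l" "card B = m" "A \<noteq> B"
    using assms params by (auto simp: layer_def)
  then show ?thesis
    using kernel_on_support[of A B] kernel_off_shell[of A B] by simp
qed

text \<open>At separation 0 the kernel depends only on the shell, and there it is the reciprocal of
  the weight.\<close>

lemma weight_constant:
  assumes "k \<in> {l, m}" "A \<in> layer k" "B \<in> layer k"
  shows "w A = w B"
proof -
  have AB: "w A > 0" "w B > 0" "card A = k" "card B = k" using assms(2,3) by (auto simp: layer_def)
  have "complex_of_real (W k * kernel A A) = complex_of_real (W k * kernel B B)"
    unfolding kernel_same_shell[OF assms(1) AB(3) AB(3)] kernel_same_shell[OF assms(1) AB(4) AB(4)]
    by simp
  then have "kernel A A = kernel B B" using W_pos[OF assms(1)] by simp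
  then show ?thesis
    using kernel_on_support[OF AB(1,1)] kernel_on_support[OF AB(2,2)]
    by (metis mult_cancel_right mult_zero_right of_bool_eq(2) zero_neq_one)
qed

section \<open>Counting separations and locating the zeros\<close>

definition separations :: "nat \<Rightarrow> nat \<Rightarrow> nat set" where
  "separations a b = {card (A - B) | A B. A \<in> layer a \<and> B \<in> layer b}"

lemma finite_separations: "finite (separations a b)"
proof -
  have "separations a b = (\<lambda>p. card (fst p - snd p)) ` (layer a \<times> layer b)"
    by (force simp: separations_def)
  then show ?thesis by simp
qed

lemma layer_nonempty: "k \<in> {l, m} \<Longrightarrow> \<exists>A. A \<in> layer k"
  using occupied by (auto simp: layer_def)

lemma card_Diff_eq_0_iff: "card A = card B \<Longrightarrow> card (A - B) = 0 \<longleftrightarrow> A = B" for A B :: "'a set"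
  by (metis card.empty Diff_cancel Diff_eq_empty_iff card_0_eq card_subset_eq finite)

text \<open>If there were fewer than \<open>e\<close> separations, the annihilator polynomial of a point \<open>A\<close> of the layer
  would isolate \<open>A\<close> on the layer and be orthogonal to the harmonic functions of degree \<open>e\<close>, so all of
  these would vanish at \<open>A\<close>.\<close>

lemma card_separations_same_ge:
  assumes k: "k \<in> {l, m}"
  shows "e \<le> card (separations k k - {0})"
proof (rule ccontr)
  assume "\<not> e \<le> card (separations k k - {0})"
  define S where "S = separations k k - {0}"
  have S: "finite S" "card S < e" using finite_separations \<open>\<not> _\<close> by (auto simp: S_def)
  obtain A where A: "A \<in> layer k" using layer_nonempty[OF k] by blast
  define p where "p = (\<lambda>B. \<Prod>s\<in>S. real (card (B - A)) - real s)"
  have p: "deg_le (card S) p"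
    unfolding p_def using S(1) by (intro deg_le_prod deg_le_diff deg_le_const deg_le_card_Diff)
  have pA: "p A \<noteq> 0" using S(1) by (simp add: p_def S_def)
  have p0: "p B = 0" if "B \<in> layer k" "B \<noteq> A" for B
  proof -
    have "card (B - A) \<in> S"
      using that A card_Diff_eq_0_iff[of B A] by (auto simp: S_def separations_def layer_def)
    then show ?thesis unfolding p_def using S(1) by (intro prod_zero) auto
  qed
  define c where "c = evaluator e A"
  have c: "c \<in> harmonic e" unfolding c_def by (rule evaluator_harmonic)
  have "deg_le (2 * e - 1) (\<lambda>B. p B * lift c B)"
    by (rule deg_le_mono[OF deg_le_mult[OF p deg_le_lift_harmonic[OF c]]]) (use S(2) in linarith)
  then have "(\<Sum>B\<in>layer k. w B * (p B * lift c B)) = W k * shell_avg (\<lambda>B. p B * lift c B) k"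
    by (rule quadrature_layer[OF k])
  also have "\<dots> = 0"
    using sum_deg_le_lift_eq_0[OF p S(2) c, of k] by (simp add: shell_avg_def)
  also have "(\<Sum>B\<in>layer k. w B * (p B * lift c B)) = (\<Sum>B\<in>layer k. if B = A then w A * (p A * lift c A) else 0)"
    using p0 by (intro sum.cong refl) auto
  also have "\<dots> = w A * (p A * lift c A)" using A by simp
  finally have "zonal e A A = 0" using pA A by (simp add: c_def lift_evaluator layer_def)
  moreover have "zonal e A A > 0"
    using A shell_range[OF k] by (intro zonal_diag_pos) (auto simp: layer_def)
  ultimately show False by simp
qed

text \<open>With fewer than e separations the annihilator of \<open>A\<close> vanishes on layer m;
  its square has degree at most 2e - 2, so the quadrature makes it vanish on the whole shell. But
  there all separations 0, ..., l from \<open>A\<close> occur, more than e of them.\<close>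

lemma card_separations_off_ge: "e \<le> card (separations l m)"
proof (rule ccontr)
  assume "\<not> e \<le> card (separations l m)"
  define S where "S = separations l m"
  have S: "finite S" "card S < e" using finite_separations \<open>\<not> _\<close> by (auto simp: S_def)
  obtain A where A: "A \<in> layer l" using layer_nonempty by blast
  then have cA: "card A = l" by (simp add: layer_def)
  define p where "p = (\<lambda>B. \<Prod>s\<in>S. real (card (A - B)) - real s)"
  have p: "deg_le (card S) p"
    unfolding p_def using S(1) by (intro deg_le_prod deg_le_diff deg_le_const deg_le_card_Diff')
  have p0: "p B = 0" if "B \<in> layer m" for B
  proof -
    have "card (A - B) \<in> S" using that A by (auto simp: S_def separations_def)
    then show ?thesis unfolding p_def using S(1) by (intro prod_zero) auto
  qed
  have "deg_le (2 * e - 1) (\<lambda>B. p B * p B)"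
    by (rule deg_le_mono[OF deg_le_mult[OF p p]]) (use S(2) in linarith)
  then have "(\<Sum>B\<in>layer m. w B * (p B * p B)) = W m * shell_avg (\<lambda>B. p B * p B) m"
    by (intro quadrature_layer) auto
  moreover have "(\<Sum>B\<in>layer m. w B * (p B * p B)) = 0" using p0 by (intro sum.neutral) auto
  ultimately have "(\<Sum>B :: 'a set | card B = m. p B * p B) = 0"
    using W_pos[of m] choose_pos(1)[of m 0] by (simp add: shell_avg_def)
  then have pm: "p B = 0" if "card B = m" for B :: "'a set"
    using that by (subst (asm) sum_nonneg_eq_0_iff) auto
  have "{..l} \<subseteq> S"
  proof
    fix j assume "j \<in> {..l}"
    then have j: "j \<le> l" by simp
    \<comment> \<open>A point of shell m at separation j: keep l - j points of \<open>A\<close> and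
      add m - l + j points from outside, which exist since m + l \<le> n.\<close>
    obtain X where X: "X \<subseteq> A" "card X = l - j"
      using obtain_subset_with_card_n[of "l - j" A] cA by (metis diff_le_self)
    have "card (- A) = CARD('a) - l" using cA by (simp add: Compl_eq_Diff_UNIV card_Diff_subset)
    then have "m - l + j \<le> card (- A)" using params j by simp
    then obtain Z where Z: "Z \<subseteq> - A" "card Z = m - l + j"
      using obtain_subset_with_card_n by metis
    have "card (X \<union> Z) = m"
      using X Z j params by (subst card_Un_disjoint) auto
    then have "p (X \<union> Z) = 0" by (rule pm)
    moreover have "A - (X \<union> Z) = A - X" using Z by auto
    then have "card (A - (X \<union> Z)) = j"
      using X cA j by (simp add: card_Diff_subset)
    ultimately have "(\<Prod>s\<in>S. real j - real s) = 0" by (simp add: p_def)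
    then show "j \<in> S" using S(1) by auto
  qed
  then have "card {..l} \<le> card S" using S(1) by (intro card_mono)
  then show False using S(2) params by simp
qed

lemma psi_diag_poly:
  assumes k: "k \<in> {l, m}"
  obtains p where "degree p = e" "\<And>\<xi>. poly p \<xi> = psi_diag CARD('a) e k (W k) \<kappa> \<xi>"
proof -
  have "\<forall>r\<in>{..e}. \<exists>p. degree p = r \<and> (\<forall>\<xi>. poly p \<xi> = hahn CARD('a) k k r \<xi>)"
  proof
    fix r assume "r \<in> {..e}"
    then have "r \<le> k" "r + k \<le> CARD('a)" "2 * r \<le> CARD('a)" using shell_range[OF k] by auto
    then show "\<exists>p. degree p = r \<and> (\<forall>\<xi>. poly p \<xi> = hahn CARD('a) k k r \<xi>)"
      by (rule hahn_poly) blast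
  qed
  then obtain h where h: "\<forall>r\<in>{..e}. degree (h r) = r \<and> (\<forall>\<xi>. poly (h r) \<xi> = hahn CARD('a) k k r \<xi>)"
    by metis
  define c where "c = W k * real ((CARD('a) - 2 * e) choose (k - e)) * binomial_diff CARD('a) e /
                (2 ^ (CARD('a) - 2 * e) * \<kappa> * real (CARD('a) choose k))"
  have "binomial_diff CARD('a) e > 0" using shell_range[OF k] by (intro binomial_diff_pos) auto
  then have c: "c > 0"
    unfolding c_def using \<kappa>_pos W_pos[OF k] choose_pos[OF k, of e] by simp
  define p where "p = (\<Sum>r<e. smult (of_real (binomial_diff CARD('a) r)) (h r)) + smult (of_real c) (h e)"
  have "degree p = e"
    unfolding p_def using h c
    by (intro degree_graded_sum le_trans[OF degree_smult_le]) (auto simp: degree_smult_eq)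
  moreover have "poly p \<xi> = psi_diag CARD('a) e k (W k) \<kappa> \<xi>" for \<xi>
    unfolding p_def psi_diag_def c_def[symmetric] using h by (simp add: poly_sum)
  ultimately show thesis by (rule that)
qed

text \<open>A polynomial of degree e \<ge> 1 has at most e roots, so e known roots exhaust them, and
  the lower bound on the number of separations becomes exact.\<close>

lemma zeros_eq_of_card:
  fixes p :: "complex poly"
  assumes "degree p = e" "finite S" "e \<le> card S" "\<And>s. s \<in> S \<Longrightarrow> poly p (of_nat s) = 0"
  shows "card S = e \<and> {\<xi>. poly p \<xi> = 0} = of_nat ` S"
proof -
  have "p \<noteq> 0" using assms(1) params by auto
  then have fin: "finite {\<xi>. poly p \<xi> = 0}" and le: "card {\<xi>. poly p \<xi> = 0} \<le> e"
    using poly_roots_finite[of p] card_poly_roots_bound[of p] assms(1) by auto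
  have sub: "of_nat ` S \<subseteq> {\<xi>. poly p \<xi> = 0}" using assms(4) by auto
  have "card (of_nat ` S :: complex set) = card S" by (intro card_image) (simp add: inj_on_def)
  then have "card (of_nat ` S :: complex set) = card {\<xi>. poly p \<xi> = 0}" "card S = e"
    using card_mono[OF fin sub] le assms(3) by linarith+
  then show ?thesis using card_subset_eq[OF fin sub] by simp
qed

lemma separations_same:
  assumes k: "k \<in> {l, m}"
  shows "card (separations k k - {0}) = e"
    and "{\<xi>. psi_diag CARD('a) e k (W k) \<kappa> \<xi> = 0} = of_nat ` (separations k k - {0})"
proof -
  obtain p where p: "degree p = e" "\<And>\<xi>. poly p \<xi> = psi_diag CARD('a) e k (W k) \<kappa> \<xi>"
    by (rule psi_diag_poly[OF k]) blast
  have "poly p (of_nat s) = 0" if s: "s \<in> separations k k - {0}" for s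
  proof -
    obtain A B where AB: "s = card (A - B)" "A \<in> layer k" "B \<in> layer k"
      using s by (auto simp: separations_def)
    then have "A \<noteq> B" using s by auto
    then show ?thesis unfolding p(2) using psi_diag_eq_0_iff[OF k AB(2,3)] AB(1) by simp
  qed
  from zeros_eq_of_card[OF p(1) _ card_separations_same_ge[OF k] this]
  show "card (separations k k - {0}) = e"
    "{\<xi>. psi_diag CARD('a) e k (W k) \<kappa> \<xi> = 0} = of_nat ` (separations k k - {0})"
    by (simp_all add: finite_separations p(2))
qed

lemma separations_off:
  shows "card (separations l m) = e"
    and "{\<xi>. psi_off CARD('a) e l m \<xi> = 0} = of_nat ` separations l m"
proof -
  obtain p where p: "degree p = e" "\<And>\<xi>. poly p \<xi> = psi_off CARD('a) e l m \<xi>"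
    unfolding psi_off_def using params by (rule_tac hahn_poly[of e l m "CARD('a)"]) auto
  have "poly p (of_nat s) = 0" if s: "s \<in> separations l m" for s
    unfolding p(2) using s psi_off_eq_0 by (auto simp: separations_def)
  from zeros_eq_of_card[OF p(1) _ card_separations_off_ge this]
  show "card (separations l m) = e"
    "{\<xi>. psi_off CARD('a) e l m \<xi> = 0} = of_nat ` separations l m"
    by (simp_all add: finite_separations p(2))
qed

lemma card_separations_swap: "card (separations m l) = e"
proof -
  have "card (A - B) = card (B - A) + (m - l)" if "A \<in> layer m" "B \<in> layer l" for A B
    using that card_Diff_swap[of A B] params by (auto simp: layer_def)
  then have "separations m l = (\<lambda>j. j + (m - l)) ` separations l m"
    unfolding separations_def by (auto simp: image_iff) metis+
  then show ?thesis using separations_off(1) by (simp add: card_image)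
qed

text \<open>Between distinct points only e separations occur, so degree at most e - 1 suffices; the
  extra term repairs the value on the diagonal.\<close>

lemma separation_interpolation:
  fixes g :: "nat \<Rightarrow> complex"
  assumes "a \<in> {l, m}" "b \<in> {l, m}"
  obtains c s where "\<And>A B. A \<in> layer a \<Longrightarrow> B \<in> layer b \<Longrightarrow>
     g (card (A - B)) = (\<Sum>i<e. c i * of_nat (card (A - B)) ^ i) + s * of_bool (A = B)"
proof -
  define N where "N = (if a = b then separations a b - {0} else separations a b)"
  have "finite N" "card N = e"
    using separations_same(1)[OF assms(1)] separations_off(1) card_separations_swap assms params
    by (auto simp: N_def finite_separations)
  then obtain c where c: "\<forall>x\<in>N. (\<Sum>i<e. c i * of_nat x ^ i) = g x"
    using interpolation_coefficients[of N g] by auto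
  define s where "s = g 0 - (\<Sum>i<e. c i * of_nat 0 ^ i)"
  have "g (card (A - B)) = (\<Sum>i<e. c i * of_nat (card (A - B)) ^ i) + s * of_bool (A = B)"
    if AB: "A \<in> layer a" "B \<in> layer b" for A B
  proof (cases "A = B")
    case True
    then show ?thesis by (simp add: s_def)
  next
    case False
    have "card (A - B) \<in> N"
    proof (cases "a = b")
      case True
      then have "card (A - B) \<noteq> 0" using AB False card_Diff_eq_0_iff[of A B] by (simp add: layer_def)
      then show ?thesis using AB by (auto simp: N_def separations_def)
    next
      case False
      then show ?thesis using AB by (auto simp: N_def separations_def)
    qed
    then show ?thesis using c False by simp
  qed
  then show thesis by (rule that)
qed

text \<open>The weight is constant on a layer and can be divided out of the quadrature; the
  exponents keep the degree at most 2e - 2.\<close>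

lemma sum_layer_powers:
  assumes b: "b \<in> {l, m}"
  obtains t where "\<And>A C i j. i < e \<Longrightarrow> j < e \<Longrightarrow>
    (\<Sum>B\<in>layer b. of_nat (card (A - B)) ^ i * of_nat (card (B - C)) ^ j)
      = t * (\<Sum>B | card B = b. of_nat (card (A - B)) ^ i * of_nat (card (B - C)) ^ j :: complex)"
proof -
  obtain B0 where B0: "B0 \<in> layer b" using layer_nonempty[OF b] by blast
  then have pos: "w B0 > 0" by (simp add: layer_def)
  define t where "t = W b / (w B0 * real (CARD('a) choose b))"
  have *: "(\<Sum>B\<in>layer b. real (card (A - B)) ^ i * real (card (B - C)) ^ j)
      = t * (\<Sum>B | card B = b. real (card (A - B)) ^ i * real (card (B - C)) ^ j)"
    if ij: "i < e" "j < e" for A C :: "'a set" and i j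
  proof -
    let ?f = "\<lambda>B. real (card (A - B)) ^ i * real (card (B - C)) ^ j"
    have "deg_le (i + j) ?f"
      by (intro deg_le_mult deg_le_power deg_le_card_Diff deg_le_card_Diff')
    then have "deg_le (2 * e - 1) ?f" using ij by (elim deg_le_mono) linarith
    then have "(\<Sum>B\<in>layer b. w B * ?f B) = W b * shell_avg ?f b" by (rule quadrature_layer[OF b])
    moreover have "(\<Sum>B\<in>layer b. w B * ?f B) = w B0 * (\<Sum>B\<in>layer b. ?f B)"
      unfolding sum_distrib_left using weight_constant[OF b _ B0] by (intro sum.cong) auto
    ultimately have "w B0 * (\<Sum>B\<in>layer b. ?f B) = W b * shell_avg ?f b" by simp
    then have "(\<Sum>B\<in>layer b. ?f B) = W b * shell_avg ?f b / w B0" using pos by (simp add: field_simps)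
    then show ?thesis by (simp add: t_def shell_avg_def mult_ac)
  qed
  show thesis
    by (rule that[of "complex_of_real t"]) (use arg_cong[OF *, of _ _ complex_of_real] in simp)
qed

text \<open>The sum over a layer of a product of two functions of the separation is, up to diagonal terms,
  the integral of a polynomial of degree at most \<open>2e - 2\<close>, hence a sum over the whole shell, where the
  symmetric group acts.\<close>

lemma layer_convolution:
  fixes g h :: "nat \<Rightarrow> complex"
  assumes a: "a \<in> {l, m}" and b: "b \<in> {l, m}" and c: "c \<in> {l, m}"
    and A: "A \<in> layer a" "A' \<in> layer a" and C: "C \<in> layer c" "C' \<in> layer c"
    and AC: "card (A - C) = card (A' - C')"
  shows "(\<Sum>B\<in>layer b. g (card (A - B)) * h (card (B - C)))
       = (\<Sum>B\<in>layer b. g (card (A' - B)) * h (card (B - C')))"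
proof -
  obtain p s where g: "\<And>A B. A \<in> layer a \<Longrightarrow> B \<in> layer b \<Longrightarrow>
     g (card (A - B)) = (\<Sum>i<e. p i * of_nat (card (A - B)) ^ i) + s * of_bool (A = B)"
    by (rule separation_interpolation[OF a b, of g]) blast
  obtain q t where h: "\<And>B C. B \<in> layer b \<Longrightarrow> C \<in> layer c \<Longrightarrow>
     h (card (B - C)) = (\<Sum>i<e. q i * of_nat (card (B - C)) ^ i) + t * of_bool (B = C)"
    by (rule separation_interpolation[OF b c, of h]) blast
  obtain u where u: "\<And>A C i j. i < e \<Longrightarrow> j < e \<Longrightarrow>
    (\<Sum>B\<in>layer b. of_nat (card (A - B)) ^ i * of_nat (card (B - C)) ^ j)
      = u * (\<Sum>B | card B = b. of_nat (card (A - B)) ^ i * of_nat (card (B - C)) ^ j :: complex)"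
    by (rule sum_layer_powers[OF b]) blast
  define P where "P = (\<lambda>j. \<Sum>i<e. p i * of_nat j ^ i)"
  define Q where "Q = (\<lambda>j. \<Sum>i<e. q i * of_nat j ^ i)"
  have PQ: "(\<Sum>B\<in>layer b. P (card (A - B)) * Q (card (B - C)))
      = (\<Sum>i<e. \<Sum>j<e. p i * q j * (u * (\<Sum>B | card B = b. of_nat (card (A - B)) ^ i * of_nat (card (B - C)) ^ j)))"
    for A C
  proof -
    have "(\<Sum>B\<in>layer b. P (card (A - B)) * Q (card (B - C)))
      = (\<Sum>B\<in>layer b. \<Sum>i<e. \<Sum>j<e. p i * q j * (of_nat (card (A - B)) ^ i * of_nat (card (B - C)) ^ j))"
      unfolding P_def Q_def sum_product by (intro sum.cong refl) (simp add: mult_ac)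
    also have "\<dots> = (\<Sum>i<e. \<Sum>B\<in>layer b. \<Sum>j<e. p i * q j * (of_nat (card (A - B)) ^ i * of_nat (card (B - C)) ^ j))"
      by (rule sum.swap)
    also have "\<dots> = (\<Sum>i<e. \<Sum>j<e. \<Sum>B\<in>layer b. p i * q j * (of_nat (card (A - B)) ^ i * of_nat (card (B - C)) ^ j))"
      by (intro sum.cong refl sum.swap)
    also have "\<dots> = (\<Sum>i<e. \<Sum>j<e. p i * q j * (u * (\<Sum>B | card B = b. of_nat (card (A - B)) ^ i * of_nat (card (B - C)) ^ j)))"
      unfolding sum_distrib_left[symmetric] using u by (intro sum.cong refl) auto
    finally show ?thesis .
  qed
  \<comment> \<open>In the product, the diagonal corrections collapse the sum to values at |A - C|.
    Whether \<open>A\<close> equals \<open>C\<close> is also visible from |A - C| when both lie in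
    one layer.\<close>
  have expand: "(\<Sum>B\<in>layer b. g (card (A - B)) * h (card (B - C)))
     = (\<Sum>B\<in>layer b. P (card (A - B)) * Q (card (B - C)))
       + of_bool (a = b) * s * Q (card (A - C)) + of_bool (b = c) * t * P (card (A - C))
       + of_bool (a = b \<and> b = c \<and> card (A - C) = 0) * s * t"
    if A: "A \<in> layer a" and C: "C \<in> layer c" for A C
  proof -
    have ba: "A \<in> layer b \<longleftrightarrow> a = b" "C \<in> layer b \<longleftrightarrow> b = c" using A C by (auto simp: layer_def)
    have "(\<Sum>B\<in>layer b. g (card (A - B)) * h (card (B - C)))
      = (\<Sum>B\<in>layer b. P (card (A - B)) * Q (card (B - C))
         + (if B = A then s * Q (card (A - C)) else 0) + (if B = C then t * P (card (A - C)) else 0)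
         + (if B = A then of_bool (A = C) * s * t else 0))"
      using g[OF A] h[OF _ C] by (intro sum.cong refl) (auto simp: P_def Q_def algebra_simps)
    also have "\<dots> = (\<Sum>B\<in>layer b. P (card (A - B)) * Q (card (B - C)))
       + of_bool (a = b) * s * Q (card (A - C)) + of_bool (b = c) * t * P (card (A - C))
       + of_bool (a = b) * (of_bool (A = C) * s * t)"
      unfolding sum.distrib using ba by simp
    also have "of_bool (a = b) * (of_bool (A = C) * s * t)
        = of_bool (a = b \<and> b = c \<and> card (A - C) = 0) * s * t"
      using A C card_Diff_eq_0_iff[of A C] by (auto simp: layer_def)
    finally show ?thesis .
  qed
  have cards: "card A = card A'" "card C = card C'" using A C by (auto simp: layer_def)
  have "(\<Sum>B\<in>layer b. P (card (A - B)) * Q (card (B - C)))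
      = (\<Sum>B\<in>layer b. P (card (A' - B)) * Q (card (B - C')))"
  proof -
    have "(\<Sum>B | card B = b. of_nat (card (A - B)) ^ i * of_nat (card (B - C)) ^ j :: complex)
        = (\<Sum>B | card B = b. of_nat (card (A' - B)) ^ i * of_nat (card (B - C')) ^ j)" for i j
      by (rule sum_shell_cong[OF cards AC, of "\<lambda>x y. of_nat x ^ i * of_nat y ^ j"])
    then show ?thesis unfolding PQ by simp
  qed
  then show ?thesis
    unfolding expand[OF A(1) C(1)] expand[OF A(2) C(2)] AC by simp
qed

end

section \<open>Designs in the cube\<close>

text \<open>Translation taking the base vertex to the empty set and shell k to the sets of size
  k.\<close>

definition support_set :: "bool ^ 'n \<Rightarrow> bool ^ 'n \<Rightarrow> 'n set" where
  "support_set x y = {i. x $ i \<noteq> y $ i}"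

definition point_of :: "bool ^ 'n \<Rightarrow> 'n set \<Rightarrow> bool ^ 'n" where
  "point_of x A = (\<chi> i. x $ i \<noteq> (i \<in> A))"

lemma support_set_point_of [simp]: "support_set x (point_of x A) = A"
  by (auto simp: support_set_def point_of_def)

lemma point_of_support_set [simp]: "point_of x (support_set x y) = y"
  by (auto simp: support_set_def point_of_def vec_eq_iff)

lemma support_set_self [simp]: "support_set x x = {}"
  by (simp add: support_set_def)

lemma bij_support_set: "bij (support_set x)"
  by (rule o_bij[of "point_of x"]) (auto simp: fun_eq_iff)

lemma support_set_eq_iff: "support_set x y = support_set x z \<longleftrightarrow> y = z"
  by (metis point_of_support_set)

lemma sum_support_set: "(\<Sum>y\<in>UNIV. f (support_set x y)) = (\<Sum>A\<in>UNIV. f A)"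
  by (rule sum.reindex_bij_betw[OF bij_support_set])

lemma shell_eq: "shell x k = {y. card (support_set x y) = k}"
  by (simp add: shell_def hamming_def support_set_def)

lemma hamming_eq:
  "hamming y z = card (support_set x y - support_set x z) + card (support_set x z - support_set x y)"
proof -
  have "{i. y $ i \<noteq> z $ i} = (support_set x y - support_set x z) \<union> (support_set x z - support_set x y)"
    by (auto simp: support_set_def)
  then show ?thesis unfolding hamming_def by (simp only:) (subst card_Un_disjoint; auto)
qed

lemma hamming_commute: "hamming y z = hamming z y"
  unfolding hamming_def by (rule arg_cong[of _ _ card]) auto

lemma hamming_eq_0_iff: "hamming y z = 0 \<longleftrightarrow> y = z"
  by (auto simp: hamming_def vec_eq_iff)

text \<open>The two differences are tied by \<open>card_Diff_swap\<close>. The additive form avoids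
  truncated subtraction when b < a.\<close>

lemma hamming_shells:
  assumes "y \<in> shell x a" "z \<in> shell x b"
  shows "hamming y z + a = 2 * card (support_set x y - support_set x z) + b"
  using card_Diff_swap[of "support_set x y" "support_set x z"] assms hamming_eq[of y z x]
  by (simp add: shell_eq)


section \<open>Characters as eigenvectors of the cube\<close>

definition character :: "bool ^ 'n \<Rightarrow> 'n set \<Rightarrow> complex ^ (bool ^ 'n)" where
  "character x S = (\<chi> y. of_real (chi S (support_set x y)))"

lemma inner_character:
  "hermitian_inner v (character x S) = (\<Sum>y\<in>UNIV. v $ y * of_real (chi S (support_set x y)))"
  by (simp add: hermitian_inner_def character_def)

text \<open>Flipping the point j reverses the character exactly if j lies in \<open>S\<close>: n -
  |S| neighbours keep the value and |S| negate it.\<close>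

lemma sum_chi_neighbours:
  fixes A :: "'n::finite set"
  shows "(\<Sum>B | card (A - B) + card (B - A) = 1. chi S B) = (real CARD('n) - 2 * real (card S)) * chi S A"
proof -
  define flip where "flip = (\<lambda>j. if j \<in> A then A - {j} else insert j A)"
  have inj: "inj flip"
    unfolding flip_def inj_def by (auto split: if_splits)
  have "{B. card (A - B) + card (B - A) = 1} = range flip"
  proof (intro equalityI subsetI)
    fix B assume "B \<in> {B. card (A - B) + card (B - A) = 1}"
    then have "card (A - B) = 1 \<and> card (B - A) = 0 \<or> card (A - B) = 0 \<and> card (B - A) = 1"
      unfolding mem_Collect_eq by linarith
    then consider "card (A - B) = 1" "B - A = {}" | "A - B = {}" "card (B - A) = 1"
      unfolding card_0_eq[OF finite] by blast
    then show "B \<in> range flip"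
    proof cases
      case 1
      then obtain j where "A - B = {j}" by (auto simp: card_1_singleton_iff)
      then have "B = flip j" using 1 by (auto simp: flip_def)
      then show ?thesis by simp
    next
      case 2
      then obtain j where "B - A = {j}" by (auto simp: card_1_singleton_iff)
      then have "B = flip j" using 2 by (auto simp: flip_def)
      then show ?thesis by simp
    qed
  next
    fix B assume "B \<in> range flip"
    then obtain j where j: "B = flip j" by auto
    show "B \<in> {B. card (A - B) + card (B - A) = 1}"
    proof (cases "j \<in> A")
      case True
      then have "A - B = {j}" "B - A = {}" using j by (auto simp: flip_def)
      then show ?thesis by simp
    next
      case False
      then have "A - B = {}" "B - A = {j}" using j by (auto simp: flip_def)
      then show ?thesis by simp
    qed
  qed
  moreover have flip: "chi S (flip j) = (if j \<in> S then - 1 else 1) * chi S A" for j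
  proof (cases "j \<in> A")
    case True
    then have "chi A S = (if j \<in> S then - 1 else 1) * chi (A - {j}) S"
      unfolding chi_def by (subst prod.remove[of _ j]) auto
    then show ?thesis using True by (auto simp: flip_def chi_commute[of S])
  next
    case False
    then show ?thesis by (simp add: flip_def chi_commute[of S]) (simp add: chi_def)
  qed
  moreover have "(\<Sum>j\<in>UNIV. if j \<in> S then - 1 else 1 :: real) = real CARD('n) - 2 * real (card S)"
  proof -
    have "(\<Sum>j\<in>UNIV. if j \<in> S then - 1 else 1 :: real) = (\<Sum>j\<in>UNIV. 1 - (if j \<in> S then 2 else 0))"
      by (intro sum.cong) auto
    then show ?thesis by (simp add: sum_subtractf sum.If_cases)
  qed
  ultimately show ?thesis
    by (simp add: sum.reindex[OF inj] sum_distrib_right[symmetric])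
qed

lemma adjacency_character:
  fixes x :: "bool ^ 'n"
  shows "dist_matrix 1 *v character x S = (of_nat CARD('n) - 2 * of_nat (card S)) *s character x S"
proof (rule vec_eq_iff[THEN iffD2], rule allI)
  fix y :: "bool ^ 'n"
  let ?A = "support_set x y"
  have "(dist_matrix 1 *v character x S) $ y
      = (\<Sum>z\<in>UNIV. if card (?A - support_set x z) + card (support_set x z - ?A) = 1
            then complex_of_real (chi S (support_set x z)) else 0)"
    unfolding matrix_vector_mult_def dist_matrix_def character_def hamming_eq[of _ _ x]
    unfolding vec_lambda_beta by (intro sum.cong refl) simp
  also have "\<dots> = (\<Sum>B\<in>UNIV. if card (?A - B) + card (B - ?A) = 1 then complex_of_real (chi S B) else 0)"
    by (rule sum_support_set)
  also have "\<dots> = of_real (\<Sum>B | card (?A - B) + card (B - ?A) = 1. chi S B)"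
    by (simp add: sum.If_cases)
  also have "\<dots> = ((of_nat CARD('n) - 2 * of_nat (card S)) *s character x S) $ y"
    unfolding sum_chi_neighbours by (simp add: character_def algebra_simps)
  finally show "(dist_matrix 1 *v character x S) $ y
      = ((of_nat CARD('n) - 2 * of_nat (card S)) *s character x S) $ y" .
qed

lemma inner_adjacency:
  "hermitian_inner (dist_matrix j *v v) u = hermitian_inner v (dist_matrix j *v u)"
proof -
  have "hermitian_inner (dist_matrix j *v v) u
      = (\<Sum>y\<in>UNIV. \<Sum>z\<in>UNIV. (if hamming y z = j then 1 else 0) * v $ z * cnj (u $ y))"
    by (simp add: hermitian_inner_def matrix_vector_mult_def dist_matrix_def sum_distrib_right)
  also have "\<dots> = (\<Sum>z\<in>UNIV. \<Sum>y\<in>UNIV. v $ z * cnj ((if hamming z y = j then 1 else 0) * u $ y))"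
    by (subst sum.swap, intro sum.cong refl) (simp add: hamming_commute)
  also have "\<dots> = hermitian_inner v (dist_matrix j *v u)"
    by (simp add: hermitian_inner_def matrix_vector_mult_def dist_matrix_def sum_distrib_left)
  finally show ?thesis .
qed

lemma hermitian_inner_scale_left: "hermitian_inner (c *s v) u = c * hermitian_inner v u"
  by (simp add: hermitian_inner_def sum_distrib_left mult.assoc)

lemma hermitian_inner_scale_right: "hermitian_inner v (c *s u) = cnj c * hermitian_inner v u"
  by (simp add: hermitian_inner_def sum_distrib_left mult_ac)

lemma hermitian_inner_diff_left: "hermitian_inner (v - w) u = hermitian_inner v u - hermitian_inner w u"
  by (simp add: hermitian_inner_def sum_subtractf algebra_simps)

lemma hermitian_inner_sum_left: "hermitian_inner (\<Sum>i\<in>I. v i) u = (\<Sum>i\<in>I. hermitian_inner (v i) u)"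
  unfolding hermitian_inner_def sum_component sum_distrib_right by (rule sum.swap)

lemma hermitian_inner_commute: "hermitian_inner u v = cnj (hermitian_inner v u)"
  by (simp add: hermitian_inner_def mult.commute)

lemma hermitian_inner_self_eq_0:
  assumes "hermitian_inner v v = 0"
  shows "v = 0"
proof -
  have "hermitian_inner v v = of_real (\<Sum>y\<in>UNIV. (cmod (v $ y))\<^sup>2)"
    by (simp add: hermitian_inner_def complex_norm_square del: of_real_power)
  then have "(\<Sum>y\<in>UNIV. (cmod (v $ y))\<^sup>2) = 0" using assms of_real_eq_0_iff by metis
  then have "\<forall>y\<in>UNIV. (cmod (v $ y))\<^sup>2 = 0" by (subst (asm) sum_nonneg_eq_0_iff) auto
  then show ?thesis by (simp add: vec_eq_iff)
qed

text \<open>The adjacency matrix is self-adjoint, and \<open>v\<close> and the character belong to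
  different eigenvalues.\<close>

lemma eigenvector_inner_character:
  fixes x :: "bool ^ 'n"
  assumes "v \<in> eigenspace (dist_matrix 1) (of_nat CARD('n) - 2 * of_nat i)" "card S \<noteq> i"
  shows "hermitian_inner v (character x S) = 0"
proof -
  have "(of_nat CARD('n) - 2 * of_nat i) * hermitian_inner v (character x S)
      = hermitian_inner (dist_matrix 1 *v v) (character x S)"
    using assms(1) unfolding eigenspace_def mem_Collect_eq by (simp only: hermitian_inner_scale_left)
  also have "\<dots> = (of_nat CARD('n) - 2 * of_nat (card S)) * hermitian_inner v (character x S)"
    unfolding inner_adjacency adjacency_character hermitian_inner_scale_right by simp
  finally have "(2 * of_nat (card S) - 2 * of_nat i) * hermitian_inner v (character x S) = 0"
    by (simp add: algebra_simps)
  moreover have "2 * of_nat (card S) - 2 * of_nat i \<noteq> (0 :: complex)" using assms(2) by simp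
  ultimately show ?thesis by simp
qed

lemma fourier_inversion:
  fixes x :: "bool ^ 'n"
  shows "v = (\<Sum>S\<in>UNIV. (hermitian_inner v (character x S) / 2 ^ CARD('n)) *s character x S)"
proof (rule vec_eq_iff[THEN iffD2], rule allI)
  fix y :: "bool ^ 'n"
  have "(\<Sum>S\<in>UNIV. (hermitian_inner v (character x S) / 2 ^ CARD('n)) *s character x S) $ y
     = (\<Sum>S\<in>UNIV. \<Sum>z\<in>UNIV. v $ z / 2 ^ CARD('n) * of_real (chi S (support_set x z) * chi S (support_set x y)))"
    unfolding inner_character by (simp add: sum_component character_def sum_divide_distrib sum_distrib_left mult_ac)
  also have "\<dots> = (\<Sum>z\<in>UNIV. v $ z / 2 ^ CARD('n) * of_real (\<Sum>S\<in>UNIV. chi S (support_set x z) * chi S (support_set x y)))"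
    by (subst sum.swap) (simp add: sum_distrib_left)
  also have "\<dots> = (\<Sum>z\<in>UNIV. if z = y then v $ y else 0)"
    unfolding sum_chi_chi by (intro sum.cong refl) (simp add: support_set_eq_iff)
  finally show "v $ y = (\<Sum>S\<in>UNIV. (hermitian_inner v (character x S) / 2 ^ CARD('n)) *s character x S) $ y"
    by simp
qed

definition fourier_projection :: "bool ^ 'n \<Rightarrow> nat \<Rightarrow> complex ^ (bool ^ 'n) ^ (bool ^ 'n)" where
  "fourier_projection x i = (\<chi> y z. (\<Sum>S | card S = i.
     of_real (chi S (support_set x y) * chi S (support_set x z))) / 2 ^ CARD('n))"

lemma fourier_projection_apply:
  fixes x :: "bool ^ 'n"
  shows "fourier_projection x i *v v
    = (\<Sum>S | card S = i. (hermitian_inner v (character x S) / 2 ^ CARD('n)) *s character x S)"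
proof (rule vec_eq_iff[THEN iffD2], rule allI)
  fix y :: "bool ^ 'n"
  have "(fourier_projection x i *v v) $ y = (\<Sum>z\<in>UNIV. \<Sum>S | card S = i.
     of_real (chi S (support_set x y) * chi S (support_set x z)) / 2 ^ CARD('n) * v $ z)"
    by (simp add: fourier_projection_def matrix_vector_mult_def sum_divide_distrib sum_distrib_right)
  also have "\<dots> = (\<Sum>S | card S = i. \<Sum>z\<in>UNIV.
     of_real (chi S (support_set x y) * chi S (support_set x z)) / 2 ^ CARD('n) * v $ z)"
    by (rule sum.swap)
  also have "\<dots> = (\<Sum>S | card S = i. (hermitian_inner v (character x S) / 2 ^ CARD('n)) *s character x S) $ y"
    unfolding inner_character
    by (simp add: sum_component character_def sum_divide_distrib sum_distrib_left mult_ac)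
  finally show "(fourier_projection x i *v v) $ y
    = (\<Sum>S | card S = i. (hermitian_inner v (character x S) / 2 ^ CARD('n)) *s character x S) $ y" .
qed

lemma subspace_eigenspace: "vec.subspace (eigenspace M \<theta>)"
  unfolding eigenspace_def
  by (rule vec.subspaceI)
    (auto simp: matrix_vector_right_distrib vec.scale_right_distrib vector_scalar_commute
      vector_smult_assoc mult.commute)

lemma fourier_projection_is_projection:
  fixes x :: "bool ^ 'n"
  assumes u: "u \<in> eigenspace (dist_matrix 1) (of_nat CARD('n) - 2 * of_nat i)"
  shows "hermitian_inner (v - fourier_projection x i *v v) u = 0"
proof -
  let ?c = "\<lambda>S. (hermitian_inner v (character x S) / 2 ^ CARD('n)) *s character x S"
  have "v = (\<Sum>S\<in>UNIV. ?c S)" by (rule fourier_inversion)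
  also have "\<dots> = (\<Sum>S | card S = i. ?c S) + (\<Sum>S | card S \<noteq> i. ?c S)"
    by (subst sum.union_disjoint[symmetric]) (auto intro!: sum.cong)
  finally have "v - fourier_projection x i *v v = (\<Sum>S | card S \<noteq> i. ?c S)"
    unfolding fourier_projection_apply diff_eq_eq by (subst add.commute)
  moreover have "hermitian_inner (?c S) u = 0" if "card S \<noteq> i" for S
    using eigenvector_inner_character[OF u that, of x]
    by (subst hermitian_inner_commute) (simp add: hermitian_inner_scale_right)
  ultimately show ?thesis by (simp add: hermitian_inner_sum_left)
qed

lemma fourier_projection_in_eigenspace:
  fixes x :: "bool ^ 'n"
  shows "fourier_projection x i *v v \<in> eigenspace (dist_matrix 1) (of_nat CARD('n) - 2 * of_nat i)"
  unfolding fourier_projection_apply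
proof (intro vec.subspace_sum subspace_eigenspace vec.subspace_scale)
  fix S :: "'n set" assume "S \<in> {S. card S = i}"
  then show "character x S \<in> eigenspace (dist_matrix 1) (of_nat CARD('n) - 2 * of_nat i)"
    using adjacency_character[of x S] by (simp add: eigenspace_def)
qed

text \<open>\<open>orthogonal_projection\<close> is a definite description, so uniqueness is part of
  the claim: the difference of two candidate images lies in the eigenspace and is orthogonal to
  itself.\<close>

lemma primitive_idempotent_eq:
  fixes x :: "bool ^ 'n"
  shows "primitive_idempotent i = fourier_projection x i"
  unfolding primitive_idempotent_def orthogonal_projection_def
proof (rule the_equality)
  let ?V = "eigenspace (dist_matrix 1) (of_nat CARD('n) - 2 * of_nat i) :: (complex ^ (bool ^ 'n)) set"
  let ?P = "fourier_projection x i"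
  show "\<forall>v. ?P *v v \<in> ?V \<and> (\<forall>u\<in>?V. hermitian_inner (v - ?P *v v) u = 0)"
    using fourier_projection_in_eigenspace fourier_projection_is_projection by blast
  fix P assume P: "\<forall>v. P *v v \<in> ?V \<and> (\<forall>u\<in>?V. hermitian_inner (v - P *v v) u = 0)"
  have "P *v v = ?P *v v" for v
  proof -
    let ?d = "P *v v - ?P *v v"
    have d: "?d \<in> ?V"
      using P fourier_projection_in_eigenspace[of x i v] subspace_eigenspace
      by (intro vec.subspace_diff) auto
    have "hermitian_inner ?d ?d
        = hermitian_inner (v - ?P *v v) ?d - hermitian_inner (v - P *v v) ?d"
      by (simp add: hermitian_inner_diff_left)
    also have "\<dots> = 0" using P d fourier_projection_is_projection[OF d] by simp
    finally show ?thesis using hermitian_inner_self_eq_0[of ?d] by simp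
  qed
  then show "P = ?P" by (simp add: matrix_eq)
qed

lemma inner_idempotent_character:
  fixes x :: "bool ^ 'n"
  assumes "card S = i"
  shows "hermitian_inner (primitive_idempotent i *v v) (character x S) = hermitian_inner v (character x S)"
proof -
  have "character x S \<in> eigenspace (dist_matrix 1) (of_nat CARD('n) - 2 * of_nat i)"
    using adjacency_character[of x S] assms by (simp add: eigenspace_def)
  from fourier_projection_is_projection[OF this, of v x] show ?thesis
    by (simp add: hermitian_inner_diff_left primitive_idempotent_eq[of i x])
qed

text \<open>E_i maps into the span of the characters of the i-sets, which have degree i.
  \<open>deg_le\<close> speaks of real functions, hence the separate real and imaginary
  parts.\<close>

lemma idempotent_deg_le:
  fixes x :: "bool ^ 'n"
  obtains g h where "deg_le i g" "deg_le i h"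
    "\<And>y. (primitive_idempotent i *v v) $ y = Complex (g (support_set x y)) (h (support_set x y))"
proof -
  define c where "c = (\<lambda>S. hermitian_inner v (character x S) / 2 ^ CARD('n))"
  define g where "g = (\<lambda>A. \<Sum>S | card S = i. Re (c S) * chi S A)"
  define h where "h = (\<lambda>A. \<Sum>S | card S = i. Im (c S) * chi S A)"
  have chi: "deg_le i (chi S)" if "S \<in> {S. card S = i}" for S :: "'n set"
    using that deg_le_chi[of S] by simp
  have "deg_le i g" "deg_le i h"
    unfolding g_def h_def by (intro deg_le_sum deg_le_scale chi; assumption)+
  moreover have "(primitive_idempotent i *v v) $ y = Complex (g (support_set x y)) (h (support_set x y))" for y
    unfolding primitive_idempotent_eq[of i x] fourier_projection_apply g_def h_def
      c_def[THEN fun_cong, symmetric]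
    by (simp add: complex_eq_iff sum_component character_def)
  ultimately show thesis by (rule that)
qed

lemma design_space_deg_le:
  fixes x :: "bool ^ 'n"
  assumes "u \<in> design_space x e L" "finite L"
  obtains g h where "deg_le e g" "deg_le e h"
    "\<And>y. u $ y = (if card (support_set x y) \<in> L then Complex (g (support_set x y)) (h (support_set x y)) else 0)"
proof -
  obtain f where u: "u = (\<Sum>k\<in>L. dual_idempotent x k) *v (\<Sum>i\<le>e. primitive_idempotent i *v f i)"
    using assms(1) by (auto simp: design_space_def)
  have "\<exists>g h. deg_le i g \<and> deg_le i h \<and>
    (\<forall>y. (primitive_idempotent i *v f i) $ y = Complex (g (support_set x y)) (h (support_set x y)))" for i
    using idempotent_deg_le[of i "f i" x] by metis
  then obtain g h where gh: "\<And>i. deg_le i (g i)" "\<And>i. deg_le i (h i)"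
    "\<And>i y. (primitive_idempotent i *v f i) $ y = Complex (g i (support_set x y)) (h i (support_set x y))"
    by metis
  have "deg_le e (\<lambda>A. \<Sum>i\<le>e. g i A)" "deg_le e (\<lambda>A. \<Sum>i\<le>e. h i A)"
    using gh(1,2) by (auto intro!: deg_le_sum intro: deg_le_mono)
  moreover have "u $ y = (if card (support_set x y) \<in> L then
      Complex (\<Sum>i\<le>e. g i (support_set x y)) (\<Sum>i\<le>e. h i (support_set x y)) else 0)" for y
  proof -
    have entry: "(\<Sum>k\<in>L. dual_idempotent x k) $ y $ z = (if y = z \<and> card (support_set x y) \<in> L then 1 else 0)" for z
    proof -
      have "(\<Sum>k\<in>L. dual_idempotent x k) $ y $ z
          = (\<Sum>k\<in>L. if k = card (support_set x y) then (if y = z then 1 else 0) else 0)"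
        unfolding sum_component dual_idempotent_def by (intro sum.cong refl) (auto simp: shell_eq)
      then show ?thesis using assms(2) by simp
    qed
    have "u $ y = (\<Sum>z\<in>UNIV. if z = y then (if card (support_set x y) \<in> L
        then (\<Sum>i\<le>e. primitive_idempotent i *v f i) $ y else 0) else 0)"
      unfolding u matrix_vector_mult_def vec_lambda_beta entry by (intro sum.cong refl) auto
    then show ?thesis
      by (simp add: sum_component gh(3) complex_eq_iff)
  qed
  ultimately show thesis by (rule that)
qed

lemma subspace_design_space: "vec.subspace (design_space x e L)"
proof (rule vec.subspaceI)
  show "0 \<in> design_space x e L"
    unfolding design_space_def by (intro CollectI exI[of _ "\<lambda>_. 0"]) (simp add: matrix_vector_mult_0_right)
next
  fix u v assume "u \<in> design_space x e L" "v \<in> design_space x e L"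
  then obtain f g where "u = (\<Sum>k\<in>L. dual_idempotent x k) *v (\<Sum>i\<le>e. primitive_idempotent i *v f i)"
    "v = (\<Sum>k\<in>L. dual_idempotent x k) *v (\<Sum>i\<le>e. primitive_idempotent i *v g i)"
    by (auto simp: design_space_def)
  then have "u + v = (\<Sum>k\<in>L. dual_idempotent x k) *v (\<Sum>i\<le>e. primitive_idempotent i *v (f i + g i))"
    by (simp add: matrix_vector_right_distrib sum.distrib)
  then show "u + v \<in> design_space x e L"
    unfolding design_space_def by (intro CollectI exI[of _ "\<lambda>i. f i + g i"] conjI TrueI)
next
  fix c u assume "u \<in> design_space x e L"
  then obtain f where "u = (\<Sum>k\<in>L. dual_idempotent x k) *v (\<Sum>i\<le>e. primitive_idempotent i *v f i)"
    by (auto simp: design_space_def)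
  then have "c *s u = (\<Sum>k\<in>L. dual_idempotent x k) *v (\<Sum>i\<le>e. primitive_idempotent i *v (c *s f i))"
    by (simp add: vector_scalar_commute vec.scale_sum_right[symmetric])
  then show "c *s u \<in> design_space x e L"
    unfolding design_space_def by (intro CollectI exI[of _ "\<lambda>i. c *s f i"] conjI TrueI)
qed

text \<open>\<open>E\<^sub>i \<omega>\<close> is proportional to \<open>E\<^sub>i x\<close>, and all characters take the value \<open>1\<close> at \<open>x\<close>.\<close>

lemma relative_design_moments:
  fixes x :: "bool ^ 'n"
  assumes "relative_design x t Y \<omega>" "card S \<le> t" "card S = card S'"
  shows "(\<Sum>A\<in>UNIV. \<omega> (point_of x A) * chi S A) = (\<Sum>A\<in>UNIV. \<omega> (point_of x A) * chi S' A)"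
\<comment> \<open>The design condition starts at i = 1; in degree 0 the empty set is the only set of
  its size.\<close>
proof (cases "card S = 0")
  case True
  then have "S = S'" using assms(3) by simp
  then show ?thesis by simp
next
  case False
  have inner: "hermitian_inner (weight_vec \<omega>) (character x T)
      = of_real (\<Sum>A\<in>UNIV. \<omega> (point_of x A) * chi T A)" for T
    using sum_support_set[of "\<lambda>A. complex_of_real (\<omega> (point_of x A) * chi T A)" x]
    by (simp add: inner_character weight_vec_def)
  have one: "hermitian_inner (char_vec x) (character x T) = 1" for T :: "'n set"
    by (simp add: inner_character char_vec_def if_distrib[of "\<lambda>a. a * _"] chi_empty cong: if_cong)
  have "primitive_idempotent (card S) *v weight_vec \<omega>
      \<in> vec.span {primitive_idempotent (card S) *v char_vec x}"
  proof -
    have "card S \<in> {1..t}" using assms(2) False by (simp add: Suc_le_eq card_gt_0_iff)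
    then show ?thesis using assms(1) unfolding relative_design_def by blast
  qed
  then obtain c where c: "primitive_idempotent (card S) *v weight_vec \<omega>
      = c *s (primitive_idempotent (card S) *v char_vec x)"
    by (auto simp: vec.span_singleton)
  have "hermitian_inner (weight_vec \<omega>) (character x T) = c" if "card T = card S" for T
  proof -
    have "hermitian_inner (weight_vec \<omega>) (character x T)
        = hermitian_inner (primitive_idempotent (card S) *v weight_vec \<omega>) (character x T)"
      using inner_idempotent_character[OF that] by simp
    also have "\<dots> = c * hermitian_inner (primitive_idempotent (card S) *v char_vec x) (character x T)"
      unfolding c hermitian_inner_scale_left ..
    also have "\<dots> = c" unfolding inner_idempotent_character[OF that] one by simp
    finally show ?thesis .
  qed
  from this[of S] this[of S'] show ?thesis using assms(3) unfolding inner by (metis of_real_eq_iff)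
qed

lemma relative_design_quadrature:
  fixes x :: "bool ^ 'n"
  assumes "relative_design x t Y \<omega>" "deg_le t f"
  shows "(\<Sum>A\<in>UNIV. \<omega> (point_of x A) * f A) = (\<Sum>A\<in>UNIV. \<omega> (point_of x A) * shell_avg f (card A))"
proof (rule quadrature_of_moments[OF _ assms(2)])
  fix S :: "'n set" assume S: "card S \<le> t"
  \<comment> \<open>A chosen set of each size expresses the moments as a function of the size
    alone.\<close>
  define T :: "'n set" where "T = (SOME T. card T = card S)"
  have "card T = card S" unfolding T_def by (rule someI) simp
  then show "(\<Sum>A\<in>UNIV. \<omega> (point_of x A) * chi S A)
      = (\<lambda>i. \<Sum>A\<in>UNIV. \<omega> (point_of x A) * chi (SOME T. card T = i) A) (card S)"
    using relative_design_moments[OF assms(1) S, of T] by (simp add: T_def)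
qed

text \<open>Restriction to \<open>Y\<close> is injective on the design space: the squared modulus of
  a function vanishing on \<open>Y\<close> has degree at most 2e and integrates to 0, so its
  averages on the occupied shells vanish. The tight cardinality makes the restriction onto, and the
  real part of a preimage of the characteristic vector of \<open>y\<close> is the
  interpolant.\<close>

lemma tight_design_interpolation:
  fixes x :: "bool ^ 'n"
  assumes tight: "tight_relative_design x e L Y \<omega>" and L: "finite L" and y: "y \<in> Y"
  shows "\<exists>g. deg_le e g \<and> (\<forall>z\<in>Y. g (support_set x z) = of_bool (z = y))"
proof -
  let ?D = "design_space x e L"
  let ?R = "rel_matrix (Id_on Y) :: complex ^ (bool ^ 'n) ^ (bool ^ 'n)"
  let ?T = "{v :: complex ^ (bool ^ 'n). \<forall>z. z \<notin> Y \<longrightarrow> v $ z = 0}"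
  have rel: "relative_design x (2 * e) Y \<omega>" and YL: "Y \<subseteq> (\<Union>k\<in>L. shell x k)"
    and ne: "\<And>k. k \<in> L \<Longrightarrow> Y \<inter> shell x k \<noteq> {}" and dim: "card Y = vec.dim ?D"
    using tight by (auto simp: tight_relative_design_def)
  have nn: "\<And>z. 0 \<le> \<omega> z" and Y: "Y = {z. 0 < \<omega> z}"
    using rel by (auto simp: relative_design_def weighted_subset_def)
  have R: "(?R *v v) $ z = (if z \<in> Y then v $ z else 0)" for v z
  proof -
    have "(?R *v v) $ z = (\<Sum>z'\<in>UNIV. if z' = z then (if z \<in> Y then v $ z else 0) else 0)"
      unfolding matrix_vector_mult_def rel_matrix_def vec_lambda_beta by (intro sum.cong refl) auto
    then show ?thesis by simp
  qed
  have inj: "inj_on ((*v) ?R) ?D"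
  proof (rule inj_onI)
    fix u v assume uv: "u \<in> ?D" "v \<in> ?D" "?R *v u = ?R *v v"
    have "u - v \<in> ?D" using uv subspace_design_space by (intro vec.subspace_diff) auto
    then obtain g h where gh: "deg_le e g" "deg_le e h" "\<And>z. (u - v) $ z
        = (if card (support_set x z) \<in> L then Complex (g (support_set x z)) (h (support_set x z)) else 0)"
      using design_space_deg_le[OF _ L] by metis
    let ?f = "\<lambda>A. g A * g A + h A * h A"
    have "deg_le (2 * e) ?f"
      using deg_le_add[OF deg_le_mult[OF gh(1,1)] deg_le_mult[OF gh(2,2)]] by (simp add: mult_2)
    then have "(\<Sum>A\<in>UNIV. \<omega> (point_of x A) * ?f A) = (\<Sum>A\<in>UNIV. \<omega> (point_of x A) * shell_avg ?f (card A))"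
      by (rule relative_design_quadrature[OF rel])
    moreover have "(\<Sum>A\<in>UNIV. \<omega> (point_of x A) * ?f A) = 0"
    proof (intro sum.neutral ballI)
      fix A :: "'n set"
      show "\<omega> (point_of x A) * ?f A = 0"
      proof (cases "point_of x A \<in> Y")
        case True
        then have "card A \<in> L" using YL by (auto simp: shell_eq)
        moreover have "(u - v) $ point_of x A = 0"
          using True R[of u "point_of x A"] R[of v "point_of x A"] uv(3) by simp
        ultimately have "g A = 0" "h A = 0" using gh(3)[of "point_of x A"] by (auto simp: complex_eq_iff)
        then show ?thesis by simp
      next
        case False
        then show ?thesis using nn[of "point_of x A"] by (simp add: Y)
      qed
    qed
    ultimately have 0: "(\<Sum>A\<in>UNIV. \<omega> (point_of x A) * shell_avg ?f (card A)) = 0" by simp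
    have "shell_avg ?f k \<ge> 0" for k
      unfolding shell_avg_def by (intro divide_nonneg_nonneg sum_nonneg add_nonneg_nonneg) auto
    then have z: "\<forall>A\<in>UNIV. \<omega> (point_of x A) * shell_avg ?f (card A) = 0"
      using nn by (intro sum_nonneg_eq_0_iff[THEN iffD1, OF _ _ 0] mult_nonneg_nonneg) auto
    have "(u - v) $ z = 0" for z
    proof (cases "card (support_set x z) \<in> L")
      case True
      \<comment> \<open>A point of \<open>Y\<close> on the same shell has positive weight, which
        forces the shell average itself to be 0.\<close>
      then obtain z' where z': "z' \<in> Y" "card (support_set x z') = card (support_set x z)"
        using ne[OF True] by (auto simp: shell_eq)
      then have "shell_avg ?f (card (support_set x z)) = 0"
        using bspec[OF z, of "support_set x z'"] by (simp add: Y)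
      then have "(\<Sum>A | card A = card (support_set x z). ?f A) = 0"
        using choose_pos_UNIV[of "support_set x z"] by (simp add: shell_avg_def)
      then have "?f (support_set x z) = 0"
        by (subst (asm) sum_nonneg_eq_0_iff) auto
      then have "g (support_set x z) = 0" "h (support_set x z) = 0"
        by (simp_all add: sum_squares_eq_zero_iff)
      then show ?thesis using gh(3)[of z] by (simp add: complex_eq_iff)
    next
      case False
      then show ?thesis using gh(3)[of z] by simp
    qed
    then show "u = v" by (simp add: vec_eq_iff)
  qed
  have dT: "vec.dim ?T = card Y" by (rule dim_substandard_cart)
  have "vec.dim ((*v) ?R ` ?D) = vec.dim ?D"
    by (rule vec.dim_image_eq) (use inj subspace_design_space[of x e L] in \<open>auto simp: vec.span_eq_iff[THEN iffD2]\<close>)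
  then have "(*v) ?R ` ?D = ?T"
    using dim dT R by (intro vec.subspace_dim_equal vec.linear_subspace_image subspace_design_space)
      (auto simp: vec.subspace_def)
  moreover have "char_vec y \<in> ?T" using y by (auto simp: char_vec_def)
  ultimately have "char_vec y \<in> (*v) ?R ` ?D" by (simp only:)
  then obtain u where "char_vec y = ?R *v u" and u1: "u \<in> ?D" by (rule imageE)
  then have u: "u \<in> ?D" "?R *v u = char_vec y" by simp_all
  obtain g h where gh: "deg_le e g" "\<And>z. u $ z
      = (if card (support_set x z) \<in> L then Complex (g (support_set x z)) (h (support_set x z)) else 0)"
    using design_space_deg_le[OF u(1) L] by metis
  have "g (support_set x z) = of_bool (z = y)" if z: "z \<in> Y" for z
  proof -
    have "u $ z = of_bool (z = y)" using u(2) R[of u z] z by (auto simp: char_vec_def)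
    moreover have "card (support_set x z) \<in> L" using z YL by (auto simp: shell_eq)
    ultimately show ?thesis using gh(2)[of z] by (auto simp: complex_eq_iff split: if_splits)
  qed
  then show ?thesis using gh(1) by blast
qed

lemma tight_design_tight_weight:
  fixes x :: "bool ^ 'n"
  assumes "1 \<le> e" "e \<le> l" "l < m" "m \<le> CARD('n) - l"
    and tight: "tight_relative_design x e {l, m} Y \<omega>"
  shows "tight_weight (\<lambda>A. \<omega> (point_of x A)) e l m"
proof
  have rel: "relative_design x (2 * e) Y \<omega>" and YL: "Y \<subseteq> (\<Union>k\<in>{l, m}. shell x k)"
    and ne: "\<And>k. k \<in> {l, m} \<Longrightarrow> Y \<inter> shell x k \<noteq> {}"
    using tight by (auto simp: tight_relative_design_def)
  have nn: "\<And>z. 0 \<le> \<omega> z" and Y: "Y = {z. 0 < \<omega> z}"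
    using rel by (auto simp: relative_design_def weighted_subset_def)
  show "0 \<le> \<omega> (point_of x A)" for A by (rule nn)
  show "1 \<le> e" "e \<le> l" "l < m" by fact+
  show "m + l \<le> CARD('n)" using assms by linarith
  show "card A \<in> {l, m}" if "\<omega> (point_of x A) \<noteq> 0" for A
  proof -
    have "point_of x A \<in> Y" using that nn[of "point_of x A"] by (simp add: Y)
    then show ?thesis using YL by (auto simp: shell_eq)
  qed
  show "\<exists>A. card A = k \<and> 0 < \<omega> (point_of x A)" if k: "k \<in> {l, m}" for k
  proof -
    obtain y where "y \<in> Y" "y \<in> shell x k" using ne[OF k] by blast
    then show ?thesis by (intro exI[of _ "support_set x y"]) (auto simp: Y shell_eq)
  qed
  show "(\<Sum>A\<in>UNIV. \<omega> (point_of x A) * f A) = (\<Sum>A\<in>UNIV. \<omega> (point_of x A) * shell_avg f (card A))"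
    if "deg_le (2 * e) f" for f
    using that by (rule relative_design_quadrature[OF rel])
  show "\<exists>f. deg_le e f \<and> (\<forall>B. 0 < \<omega> (point_of x B) \<longrightarrow> f B = of_bool (B = A))"
    if A: "0 < \<omega> (point_of x A)" for A
  proof -
    have "point_of x A \<in> Y" using A by (simp add: Y)
    then obtain g where g: "deg_le e g" "\<forall>z\<in>Y. g (support_set x z) = of_bool (z = point_of x A)"
      using tight_design_interpolation[OF tight] by auto
    have "g B = of_bool (B = A)" if "0 < \<omega> (point_of x B)" for B
    proof -
      have "point_of x B \<in> Y" using that by (simp add: Y)
      then have "g B = of_bool (point_of x B = point_of x A)" using bspec[OF g(2), of "point_of x B"] by simp
      moreover have "point_of x B = point_of x A \<longleftrightarrow> B = A" by (metis support_set_point_of)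
      ultimately show ?thesis by simp
    qed
    then show ?thesis using g(1) by blast
  qed
qed

section \<open>The coherent algebra of a tight design\<close>

lemma finite_shell_distances: "finite (shell_distances x Y a b)"
proof -
  have "shell_distances x Y a b = (\<lambda>p. hamming (fst p) (snd p)) ` ((Y \<inter> shell x a) \<times> (Y \<inter> shell x b))"
    by (force simp: shell_distances_def)
  then show ?thesis by simp
qed

lemma shell_distances_commute: "shell_distances x Y a b = shell_distances x Y b a"
  unfolding shell_distances_def by (auto simp: hamming_commute) (metis hamming_commute)+

lemma sum_dist_matrix:
  assumes "y \<in> Y \<inter> shell x a" "z \<in> Y \<inter> shell x b"
  shows "(\<Sum>j\<in>shell_distances x Y a b. c j * dist_matrix j $ y $ z) = c (hamming y z)"
proof -
  have "hamming y z \<in> shell_distances x Y a b" using assms by (auto simp: shell_distances_def)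
  moreover have "(\<Sum>j\<in>shell_distances x Y a b. c j * dist_matrix j $ y $ z)
      = (\<Sum>j\<in>shell_distances x Y a b. if j = hamming y z then c j else 0)"
    by (intro sum.cong) (auto simp: dist_matrix_def)
  ultimately show ?thesis by (simp add: finite_shell_distances)
qed

lemma design_algebra_iff:
  "M \<in> design_algebra x Y L \<longleftrightarrow> M \<in> matrices_on Y \<and>
     (\<forall>a\<in>L. \<forall>b\<in>L. \<exists>c. \<forall>y\<in>Y \<inter> shell x a. \<forall>z\<in>Y \<inter> shell x b. M $ y $ z = c (hamming y z))"
  unfolding design_algebra_def using sum_dist_matrix[of _ Y x _ _ _] by simp

text \<open>Choose a representative pair for each distance; by invariance its value is shared by all
  pairs at that distance.\<close>

lemma function_of_hammingI:
  assumes "\<And>y y' z z'. y \<in> A \<Longrightarrow> y' \<in> A \<Longrightarrow> z \<in> B \<Longrightarrow> z' \<in> B \<Longrightarrow> hamming y z = hamming y' z'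
    \<Longrightarrow> F y z = F y' z'"
  shows "\<exists>c. \<forall>y\<in>A. \<forall>z\<in>B. F y z = c (hamming y z)"
proof -
  define q where "q = (\<lambda>j. SOME p. fst p \<in> A \<and> snd p \<in> B \<and> hamming (fst p) (snd p) = j)"
  have "F y z = F (fst (q (hamming y z))) (snd (q (hamming y z)))" if yz: "y \<in> A" "z \<in> B" for y z
  proof -
    have "\<exists>p. fst p \<in> A \<and> snd p \<in> B \<and> hamming (fst p) (snd p) = hamming y z"
      using yz by (intro exI[of _ "(y, z)"]) simp
    then have "fst (q (hamming y z)) \<in> A \<and> snd (q (hamming y z)) \<in> B \<and>
        hamming (fst (q (hamming y z))) (snd (q (hamming y z))) = hamming y z"
      unfolding q_def by (rule someI_ex)
    then show ?thesis using yz by (intro assms) auto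
  qed
  then show ?thesis by (intro exI[of _ "\<lambda>j. F (fst (q j)) (snd (q j))"]) blast
qed

section \<open>The coherent partition and its type\<close>

definition relation_class ::
    "bool ^ 'n \<Rightarrow> (bool ^ 'n) set \<Rightarrow> nat \<Rightarrow> nat \<Rightarrow> nat \<Rightarrow> ((bool ^ 'n) \<times> (bool ^ 'n)) set" where
  "relation_class x Y a b j =
     {p. fst p \<in> Y \<inter> shell x a \<and> snd p \<in> Y \<inter> shell x b \<and> hamming (fst p) (snd p) = j}"

definition relation_classes ::
    "bool ^ 'n \<Rightarrow> (bool ^ 'n) set \<Rightarrow> nat set \<Rightarrow> ((bool ^ 'n) \<times> (bool ^ 'n)) set set" where
  "relation_classes x Y L =
     {relation_class x Y a b j | a b j. a \<in> L \<and> b \<in> L \<and> j \<in> shell_distances x Y a b}"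

lemma relation_class_unique:
  "p \<in> relation_class x Y a b j \<Longrightarrow>
     a = hamming x (fst p) \<and> b = hamming x (snd p) \<and> j = hamming (fst p) (snd p)"
  by (auto simp: relation_class_def shell_def)

lemma relation_class_nonempty:
  "j \<in> shell_distances x Y a b \<Longrightarrow> \<exists>p. p \<in> relation_class x Y a b j"
  by (auto simp: relation_class_def shell_distances_def)

lemma partition_relation_classes:
  assumes "Y \<subseteq> (\<Union>k\<in>L. shell x k)"
  shows "partition_on (Y \<times> Y) (relation_classes x Y L)"
proof (rule partition_onI)
  show "\<Union>(relation_classes x Y L) = Y \<times> Y"
  proof (intro equalityI subsetI)
    fix p assume "p \<in> Y \<times> Y"
    then obtain y z where p: "p = (y, z)" "y \<in> Y" "z \<in> Y" by auto
    then obtain a b where ab: "a \<in> L" "y \<in> shell x a" "b \<in> L" "z \<in> shell x b" using assms by blast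
    then have "p \<in> relation_class x Y a b (hamming y z)" "hamming y z \<in> shell_distances x Y a b"
      using p by (auto simp: relation_class_def shell_distances_def)
    then show "p \<in> \<Union>(relation_classes x Y L)" using ab by (auto simp: relation_classes_def)
  qed (auto simp: relation_classes_def relation_class_def)
  show "{} \<notin> relation_classes x Y L"
    using relation_class_nonempty by (fastforce simp: relation_classes_def)
  fix R S assume "R \<in> relation_classes x Y L" "S \<in> relation_classes x Y L" "R \<noteq> S"
  then show "disjnt R S"
    unfolding relation_classes_def disjnt_iff by (auto dest!: relation_class_unique)
qed

lemma is_coherent_partition_design_algebra:
  assumes "Y \<subseteq> (\<Union>k\<in>L. shell x k)"
  shows "is_coherent_partition Y (design_algebra x Y L) (relation_classes x Y L)"
proof -
  let ?R = "relation_classes x Y L"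
  note part = partition_relation_classes[OF assms]
  note entry = is_coherent_partition_entry[OF part]
  have off: "(\<Sum>R\<in>?R. c R * rel_matrix R $ y $ z) = 0" if "(y, z) \<notin> Y \<times> Y" for c y z
  proof (intro sum.neutral ballI)
    fix R assume "R \<in> ?R"
    then have "(y, z) \<notin> R" using part that by (auto simp: partition_on_def)
    then show "c R * rel_matrix R $ y $ z = 0" by (simp add: rel_matrix_def)
  qed
  have cls: "relation_class x Y a b (hamming y z) \<in> ?R" "(y, z) \<in> relation_class x Y a b (hamming y z)"
    if "a \<in> L" "b \<in> L" "y \<in> Y \<inter> shell x a" "z \<in> Y \<inter> shell x b" for a b y z
  proof -
    have "hamming y z \<in> shell_distances x Y a b" using that by (auto simp: shell_distances_def)
    then show "relation_class x Y a b (hamming y z) \<in> ?R"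
      unfolding relation_classes_def using that(1,2) by blast
    show "(y, z) \<in> relation_class x Y a b (hamming y z)" using that by (simp add: relation_class_def)
  qed
  have "design_algebra x Y L = {(\<chi> y z. \<Sum>R\<in>?R. c R * rel_matrix R $ y $ z) | c. True}"
  proof (intro equalityI subsetI)
    fix M assume M: "M \<in> design_algebra x Y L"
    \<comment> \<open>The coefficient of a class is read off at an arbitrary pair in it.\<close>
    define c where "c = (\<lambda>R. let p = SOME p. p \<in> R in M $ fst p $ snd p)"
    have "M $ y $ z = (\<Sum>R\<in>?R. c R * rel_matrix R $ y $ z)" for y z
    proof (cases "(y, z) \<in> Y \<times> Y")
      case True
      then obtain a b where ab: "a \<in> L" "b \<in> L" "y \<in> Y \<inter> shell x a" "z \<in> Y \<inter> shell x b"
        using assms by blast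
      let ?C = "relation_class x Y a b (hamming y z)"
      obtain d where d: "\<forall>y\<in>Y \<inter> shell x a. \<forall>z\<in>Y \<inter> shell x b. M $ y $ z = d (hamming y z)"
        using M ab(1,2) unfolding design_algebra_iff by blast
      have "(SOME p. p \<in> ?C) \<in> ?C" using cls(2)[OF ab] by (rule someI)
      then have "c ?C = M $ y $ z"
        using d ab(3,4) unfolding c_def Let_def relation_class_def by simp
      then show ?thesis using entry[OF cls[OF ab], of c] by simp
    next
      case False
      then show ?thesis using M off[OF False] by (simp add: design_algebra_iff matrices_on_def)
    qed
    then show "M \<in> {(\<chi> y z. \<Sum>R\<in>?R. c R * rel_matrix R $ y $ z) | c. True}"
      by (intro CollectI exI[of _ c]) (simp add: vec_eq_iff)
  next
    fix M assume "M \<in> {(\<chi> y z. \<Sum>R\<in>?R. c R * rel_matrix R $ y $ z) | c. True}"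
    then obtain c where M: "M = (\<chi> y z. \<Sum>R\<in>?R. c R * rel_matrix R $ y $ z)" by blast
    have "M $ y $ z = c (relation_class x Y a b (hamming y z))"
      if "a \<in> L" "b \<in> L" "y \<in> Y \<inter> shell x a" "z \<in> Y \<inter> shell x b" for a b y z
      using entry[OF cls[OF that], of c] by (simp add: M)
    then have "\<exists>d. \<forall>y\<in>Y \<inter> shell x a. \<forall>z\<in>Y \<inter> shell x b. M $ y $ z = d (hamming y z)"
      if "a \<in> L" "b \<in> L" for a b
      using that by (intro exI[of _ "\<lambda>j. c (relation_class x Y a b j)"]) blast
    moreover have "M \<in> matrices_on Y" using off by (simp add: matrices_on_def M)
    ultimately show "M \<in> design_algebra x Y L" by (simp add: design_algebra_iff)
  qed
  then show ?thesis using part by (simp add: is_coherent_partition_def)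
qed

text \<open>A class inside the diagonal has equal shells and distance 0, and at distance 0 each
  shell gives the full diagonal of its part of \<open>Y\<close>.\<close>

lemma fibers_design_algebra:
  assumes Y: "Y \<subseteq> (\<Union>k\<in>L. shell x k)" and ne: "\<And>k. k \<in> L \<Longrightarrow> Y \<inter> shell x k \<noteq> {}"
  shows "fibers Y (design_algebra x Y L) = (\<lambda>k. Y \<inter> shell x k) ` L"
proof -
  have diag: "relation_class x Y a a 0 = Id_on (Y \<inter> shell x a)" for a
    by (auto simp: relation_class_def hamming_eq_0_iff)
  have "Id_on \<Phi> \<in> relation_classes x Y L \<longleftrightarrow> \<Phi> \<in> (\<lambda>k. Y \<inter> shell x k) ` L" for \<Phi>
  proof
    assume "Id_on \<Phi> \<in> relation_classes x Y L"
    then obtain a b j where abj: "a \<in> L" "j \<in> shell_distances x Y a b" "Id_on \<Phi> = relation_class x Y a b j"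
      by (auto simp: relation_classes_def)
    then obtain p where p: "p \<in> relation_class x Y a b j" using relation_class_nonempty by blast
    then have "p \<in> Id_on \<Phi>" using abj(3) by simp
    then have "fst p = snd p" by auto
    then have "a = b" "j = 0" using relation_class_unique[OF p] by (auto simp: hamming_eq_0_iff)
    then have "Id_on \<Phi> = Id_on (Y \<inter> shell x a)" using abj(3) diag by simp
    then have "\<Phi> = Y \<inter> shell x a" by (metis Domain_Id_on)
    then show "\<Phi> \<in> (\<lambda>k. Y \<inter> shell x k) ` L" using abj(1) by blast
  next
    assume "\<Phi> \<in> (\<lambda>k. Y \<inter> shell x k) ` L"
    then obtain a where a: "a \<in> L" "\<Phi> = Y \<inter> shell x a" by blast
    then obtain y where "y \<in> Y \<inter> shell x a" using ne by blast
    then have "0 \<in> shell_distances x Y a a"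
      by (auto simp: shell_distances_def hamming_eq_0_iff intro: sym)
    then show "Id_on \<Phi> \<in> relation_classes x Y L"
      using a diag[of a] unfolding relation_classes_def by blast
  qed
  then show ?thesis
    unfolding fibers_def coherent_partition_eqI[OF is_coherent_partition_design_algebra[OF Y]] by blast
qed

text \<open>Classes are nonempty and each pair reveals its shells and its distance, so the classes
  inside the block correspond one to one to its distances.\<close>

lemma type_entry_design_algebra:
  assumes Y: "Y \<subseteq> (\<Union>k\<in>L. shell x k)" and "a \<in> L" "b \<in> L"
  shows "type_entry Y (design_algebra x Y L) (Y \<inter> shell x a) (Y \<inter> shell x b)
    = card (shell_distances x Y a b)"
proof -
  have "{R \<in> relation_classes x Y L. R \<subseteq> (Y \<inter> shell x a) \<times> (Y \<inter> shell x b)}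
      = relation_class x Y a b ` shell_distances x Y a b"
  proof (intro equalityI subsetI)
    fix R assume "R \<in> {R \<in> relation_classes x Y L. R \<subseteq> (Y \<inter> shell x a) \<times> (Y \<inter> shell x b)}"
    then obtain a' b' j where R: "R = relation_class x Y a' b' j" "j \<in> shell_distances x Y a' b'"
      and sub: "R \<subseteq> (Y \<inter> shell x a) \<times> (Y \<inter> shell x b)"
      by (auto simp: relation_classes_def)
    obtain p where p: "p \<in> R" using relation_class_nonempty[OF R(2)] R(1) by blast
    then have "a' = a" "b' = b"
      using relation_class_unique[of p x Y a' b' j] sub R(1) by (auto simp: shell_def)
    then show "R \<in> relation_class x Y a b ` shell_distances x Y a b" using R by blast
  next
    fix R assume "R \<in> relation_class x Y a b ` shell_distances x Y a b"
    then show "R \<in> {R \<in> relation_classes x Y L. R \<subseteq> (Y \<inter> shell x a) \<times> (Y \<inter> shell x b)}"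
      using assms(2,3) by (auto simp: relation_classes_def relation_class_def)
  qed
  moreover have "inj_on (relation_class x Y a b) (shell_distances x Y a b)"
  proof (rule inj_onI)
    fix i j assume "i \<in> shell_distances x Y a b" "relation_class x Y a b i = relation_class x Y a b j"
    then show "i = j" using relation_class_nonempty relation_class_unique by metis
  qed
  ultimately show ?thesis
    unfolding type_entry_def coherent_partition_eqI[OF is_coherent_partition_design_algebra[OF Y]]
    by (simp add: card_image)
qed

text \<open>Functions of the shells and the distance are closed under entrywise operations and
  transposition; the matrix product carries the content and stays as a hypothesis.\<close>

lemma coherent_algebra_design_algebra:
  assumes Y: "Y \<subseteq> (\<Union>k\<in>L. shell x k)"
    and mult: "\<And>M N. M \<in> design_algebra x Y L \<Longrightarrow> N \<in> design_algebra x Y L \<Longrightarrow> M ** N \<in> design_algebra x Y L"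
  shows "coherent_algebra Y (design_algebra x Y L)"
  unfolding coherent_algebra_def
proof (intro conjI ballI allI)
  let ?H = "design_algebra x Y L"
  note iff = design_algebra_iff[of _ x Y L]
  have ex: "\<exists>c. \<forall>y\<in>Y \<inter> shell x a. \<forall>z\<in>Y \<inter> shell x b. M $ y $ z = c (hamming y z)"
    if "M \<in> ?H" "a \<in> L" "b \<in> L" for M a b
    using that unfolding iff by blast
  show "?H \<subseteq> matrices_on Y" by (auto simp: iff)
  show "rel_matrix (Id_on Y) \<in> ?H"
    unfolding iff
  proof (intro conjI ballI exI)
    fix a b y z assume "y \<in> Y \<inter> shell x a" "z \<in> Y \<inter> shell x b"
    then show "rel_matrix (Id_on Y) $ y $ z = (\<lambda>j. if j = 0 then 1 else 0) (hamming y z)"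
      by (auto simp: rel_matrix_def hamming_eq_0_iff)
  qed (auto simp: matrices_on_def rel_matrix_def)
  show "rel_matrix (Y \<times> Y) \<in> ?H"
    unfolding iff
  proof (intro conjI ballI exI)
    fix a b y z assume "y \<in> Y \<inter> shell x a" "z \<in> Y \<inter> shell x b"
    then show "rel_matrix (Y \<times> Y) $ y $ z = (\<lambda>_. 1) (hamming y z)"
      by (auto simp: rel_matrix_def)
  qed (auto simp: matrices_on_def rel_matrix_def)
  fix M assume M: "M \<in> ?H"
  then have off: "M $ y $ z = 0" if "(y, z) \<notin> Y \<times> Y" for y z
    using that by (simp add: iff matrices_on_def)
  show "(\<chi> y z. c * M $ y $ z) \<in> ?H" for c
    unfolding iff
  proof (intro conjI ballI)
    fix a b assume "a \<in> L" "b \<in> L"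
    then obtain g where "\<forall>y\<in>Y \<inter> shell x a. \<forall>z\<in>Y \<inter> shell x b. M $ y $ z = g (hamming y z)"
      using ex[OF M] by blast
    then show "\<exists>d. \<forall>y\<in>Y \<inter> shell x a. \<forall>z\<in>Y \<inter> shell x b. (\<chi> y z. c * M $ y $ z) $ y $ z = d (hamming y z)"
      by (intro exI[of _ "\<lambda>j. c * g j"]) simp
  qed (use off in \<open>simp add: matrices_on_def\<close>)
  show "(\<chi> y z. cnj (M $ z $ y)) \<in> ?H"
    unfolding iff
  proof (intro conjI ballI)
    fix a b assume "a \<in> L" "b \<in> L"
    then obtain g where "\<forall>y\<in>Y \<inter> shell x b. \<forall>z\<in>Y \<inter> shell x a. M $ y $ z = g (hamming y z)"
      using ex[OF M] by blast
    then show "\<exists>d. \<forall>y\<in>Y \<inter> shell x a. \<forall>z\<in>Y \<inter> shell x b. (\<chi> y z. cnj (M $ z $ y)) $ y $ z = d (hamming y z)"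
      by (intro exI[of _ "\<lambda>j. cnj (g j)"]) (simp add: hamming_commute)
  qed (use off in \<open>auto simp: matrices_on_def\<close>)
  fix N assume N: "N \<in> ?H"
  show "M ** N \<in> ?H" by (rule mult[OF M N])
  have off': "N $ y $ z = 0" if "(y, z) \<notin> Y \<times> Y" for y z
    using that N by (simp add: iff matrices_on_def)
  show "M + N \<in> ?H"
    unfolding iff
  proof (intro conjI ballI)
    fix a b assume ab: "a \<in> L" "b \<in> L"
    obtain g where "\<forall>y\<in>Y \<inter> shell x a. \<forall>z\<in>Y \<inter> shell x b. M $ y $ z = g (hamming y z)"
      using ex[OF M ab] by blast
    moreover obtain h where "\<forall>y\<in>Y \<inter> shell x a. \<forall>z\<in>Y \<inter> shell x b. N $ y $ z = h (hamming y z)"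
      using ex[OF N ab] by blast
    ultimately show "\<exists>d. \<forall>y\<in>Y \<inter> shell x a. \<forall>z\<in>Y \<inter> shell x b. (M + N) $ y $ z = d (hamming y z)"
      by (intro exI[of _ "\<lambda>j. g j + h j"]) simp
  qed (use off off' in \<open>simp add: matrices_on_def\<close>)
  show "(\<chi> y z. M $ y $ z * N $ y $ z) \<in> ?H"
    unfolding iff
  proof (intro conjI ballI)
    fix a b assume ab: "a \<in> L" "b \<in> L"
    obtain g where "\<forall>y\<in>Y \<inter> shell x a. \<forall>z\<in>Y \<inter> shell x b. M $ y $ z = g (hamming y z)"
      using ex[OF M ab] by blast
    moreover obtain h where "\<forall>y\<in>Y \<inter> shell x a. \<forall>z\<in>Y \<inter> shell x b. N $ y $ z = h (hamming y z)"
      using ex[OF N ab] by blast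
    ultimately show "\<exists>d. \<forall>y\<in>Y \<inter> shell x a. \<forall>z\<in>Y \<inter> shell x b.
        (\<chi> y z. M $ y $ z * N $ y $ z) $ y $ z = d (hamming y z)"
      by (intro exI[of _ "\<lambda>j. g j * h j"]) simp
  qed (use off off' in \<open>simp add: matrices_on_def\<close>)
qed

section \<open>Transfer from subsets back to the design\<close>

context
  fixes x :: "bool ^ 'n" and \<omega> :: "bool ^ 'n \<Rightarrow> real" and Y :: "(bool ^ 'n) set" and e l m :: nat
  assumes tw: "tight_weight (\<lambda>A. \<omega> (point_of x A)) e l m"
    and Y: "Y = {y. 0 < \<omega> y}"
begin

interpretation tight_weight "\<lambda>A. \<omega> (point_of x A)" e l m by (rule tw)

lemma support_set_layer: "support_set x y \<in> layer k \<longleftrightarrow> y \<in> Y \<inter> shell x k"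
  by (auto simp: layer_def Y shell_eq)

lemma layer_image: "support_set x ` (Y \<inter> shell x k) = layer k"
proof -
  have "A \<in> support_set x ` (Y \<inter> shell x k)" if "A \<in> layer k" for A
    using that support_set_layer[of "point_of x A" k] by (intro image_eqI[of _ _ "point_of x A"]) auto
  then show ?thesis using support_set_layer by auto
qed

lemma sum_layer: "(\<Sum>y\<in>Y \<inter> shell x k. f (support_set x y)) = (\<Sum>A\<in>layer k. f A)"
proof -
  have "inj_on (support_set x) (Y \<inter> shell x k)" by (simp add: inj_on_def support_set_eq_iff)
  then show ?thesis unfolding layer_image[symmetric] by (simp add: sum.reindex)
qed

lemma shell_weight_eq: "shell_weight x \<omega> k = W k"
proof -
  have "(\<Sum>y\<in>UNIV. if card (support_set x y) = k then \<omega> (point_of x (support_set x y)) else 0)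
      = (\<Sum>A\<in>UNIV. if card A = k then \<omega> (point_of x A) else 0)"
    by (rule sum_support_set)
  then show ?thesis by (simp add: shell_weight_def W_def shell_eq sum.If_cases)
qed

lemma shell_distances_eq:
  assumes "a \<le> b"
  shows "shell_distances x Y a b = (\<lambda>j. 2 * j + (b - a)) ` separations a b"
proof -
  have h: "hamming y z = 2 * card (support_set x y - support_set x z) + (b - a)"
    if "y \<in> Y \<inter> shell x a" "z \<in> Y \<inter> shell x b" for y z
    using hamming_shells[of y x a z b] that assms by simp
  have "separations a b = {card (support_set x y - support_set x z) | y z.
      y \<in> Y \<inter> shell x a \<and> z \<in> Y \<inter> shell x b}"
    unfolding separations_def layer_image[symmetric] by blast
  then show ?thesis unfolding shell_distances_def using h by (auto simp: image_iff) (metis h IntI)+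
qed

lemma card_shell_distances:
  assumes "a \<le> b"
  shows "card (shell_distances x Y a b) = card (separations a b)"
  unfolding shell_distances_eq[OF assms] by (rule card_image) (simp add: inj_on_def)

lemma card_separations_same:
  assumes "k \<in> {l, m}"
  shows "card (separations k k) = e + 1"
proof -
  obtain A where A: "A \<in> layer k" using layer_nonempty[OF assms] by blast
  then have "card (A - A) \<in> separations k k" unfolding separations_def by blast
  then have "0 \<in> separations k k" by simp
  then show ?thesis
    using separations_same(1)[OF assms] finite_separations[of k k] card_Suc_Diff1[of "separations k k" 0]
    by simp
qed

lemma support_shells: "Y \<subseteq> (\<Union>k\<in>{l, m}. shell x k)"
proof
  fix y assume "y \<in> Y"
  then have "card (support_set x y) \<in> {l, m}" using support[of "support_set x y"] by (simp add: Y)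
  then show "y \<in> (\<Union>k\<in>{l, m}. shell x k)" by (auto simp: shell_eq)
qed

text \<open>The inner sum splits over the two shells; each part is a convolution of two functions of
  the separation, invariant by \<open>layer_convolution\<close>.\<close>

lemma design_algebra_mult:
  assumes M: "M \<in> design_algebra x Y {l, m}" and N: "N \<in> design_algebra x Y {l, m}"
  shows "M ** N \<in> design_algebra x Y {l, m}"
  unfolding design_algebra_iff
proof (intro conjI ballI)
  have off: "M $ y $ z = 0" "N $ y $ z = 0" if "(y, z) \<notin> Y \<times> Y" for y z
    using that M N by (simp_all add: design_algebra_iff matrices_on_def)
  show "M ** N \<in> matrices_on Y"
    unfolding matrices_on_def matrix_matrix_mult_def using off by (auto intro!: sum.neutral)
  fix a c assume a: "a \<in> {l, m}" and c: "c \<in> {l, m}"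
  have step: "(\<Sum>v\<in>Y \<inter> shell x b. M $ y $ v * N $ v $ z) = (\<Sum>v\<in>Y \<inter> shell x b. M $ y' $ v * N $ v $ z')"
    if b: "b \<in> {l, m}" and y: "y \<in> Y \<inter> shell x a" "y' \<in> Y \<inter> shell x a"
      and z: "z \<in> Y \<inter> shell x c" "z' \<in> Y \<inter> shell x c" and h: "hamming y z = hamming y' z'"
    for b y y' z z'
  proof -
    obtain g where g: "\<forall>y\<in>Y \<inter> shell x a. \<forall>v\<in>Y \<inter> shell x b. M $ y $ v = g (hamming y v)"
      using M a b unfolding design_algebra_iff by blast
    obtain k where k: "\<forall>v\<in>Y \<inter> shell x b. \<forall>z\<in>Y \<inter> shell x c. N $ v $ z = k (hamming v z)"
      using N b c unfolding design_algebra_iff by blast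
    \<comment> \<open>A function of the distance becomes one of the separation. Truncation is
      harmless: at realised separations j, 2j + b is at least a.\<close>
    define g' where "g' = (\<lambda>j. g (2 * j + b - a))"
    define k' where "k' = (\<lambda>j. k (2 * j + c - b))"
    let ?s = "support_set x"
    have sep: "hamming u v = 2 * card (?s u - ?s v) + q - p"
      if "u \<in> Y \<inter> shell x p" "v \<in> Y \<inter> shell x q" for u v p q
      using hamming_shells[of u x p v q] that by simp
    have eq: "(\<Sum>v\<in>Y \<inter> shell x b. M $ y $ v * N $ v $ z)
        = (\<Sum>B\<in>layer b. g' (card (?s y - B)) * k' (card (B - ?s z)))"
      if "y \<in> Y \<inter> shell x a" "z \<in> Y \<inter> shell x c" for y z
    proof -
      have "(\<Sum>v\<in>Y \<inter> shell x b. M $ y $ v * N $ v $ z)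
          = (\<Sum>v\<in>Y \<inter> shell x b. g' (card (?s y - ?s v)) * k' (card (?s v - ?s z)))"
      proof (intro sum.cong refl)
        fix v assume v: "v \<in> Y \<inter> shell x b"
        show "M $ y $ v * N $ v $ z = g' (card (?s y - ?s v)) * k' (card (?s v - ?s z))"
          using g k that v sep[OF that(1) v] sep[OF v that(2)] by (simp add: g'_def k'_def)
      qed
      also have "\<dots> = (\<Sum>B\<in>layer b. g' (card (?s y - B)) * k' (card (B - ?s z)))"
        by (rule sum_layer)
      finally show ?thesis .
    qed
    have "card (?s y - ?s z) = card (?s y' - ?s z')"
      using h hamming_shells[of y x a z c] hamming_shells[of y' x a z' c] y z by simp
    then show ?thesis
      unfolding eq[OF y(1) z(1)] eq[OF y(2) z(2)]
      using y z by (intro layer_convolution[OF a b c]) (simp_all only: support_set_layer)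
  qed
  have split: "(M ** N) $ y $ z = (\<Sum>v\<in>Y \<inter> shell x l. M $ y $ v * N $ v $ z)
      + (\<Sum>v\<in>Y \<inter> shell x m. M $ y $ v * N $ v $ z)" for y z
  proof -
    have "(Y \<inter> shell x l) \<inter> (Y \<inter> shell x m) = {}" using params by (auto simp: shell_def)
    then have "(\<Sum>v\<in>Y \<inter> shell x l. M $ y $ v * N $ v $ z) + (\<Sum>v\<in>Y \<inter> shell x m. M $ y $ v * N $ v $ z)
        = (\<Sum>v\<in>(Y \<inter> shell x l) \<union> (Y \<inter> shell x m). M $ y $ v * N $ v $ z)"
      by (intro sum.union_disjoint[symmetric]) auto
    also have "\<dots> = (\<Sum>v\<in>UNIV. M $ y $ v * N $ v $ z)"
      using support_shells off by (intro sum.mono_neutral_left) auto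
    finally show ?thesis by (simp add: matrix_matrix_mult_def)
  qed
  show "\<exists>d. \<forall>y\<in>Y \<inter> shell x a. \<forall>z\<in>Y \<inter> shell x c. (M ** N) $ y $ z = d (hamming y z)"
  proof (rule function_of_hammingI)
    fix y y' z z'
    assume yz: "y \<in> Y \<inter> shell x a" "y' \<in> Y \<inter> shell x a" "z \<in> Y \<inter> shell x c" "z' \<in> Y \<inter> shell x c"
      "hamming y z = hamming y' z'"
    show "(M ** N) $ y $ z = (M ** N) $ y' $ z'"
      unfolding split by (intro arg_cong2[of _ _ _ _ "(+)"] step yz) simp_all
  qed
qed

lemma design_algebra_structure:
  shows "coherent_algebra Y (design_algebra x Y {l, m})"
    and "fibers Y (design_algebra x Y {l, m}) = {Y \<inter> shell x l, Y \<inter> shell x m}"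
    and "Y \<inter> shell x l \<noteq> Y \<inter> shell x m"
    and "type_entry Y (design_algebra x Y {l, m}) (Y \<inter> shell x l) (Y \<inter> shell x l) = e + 1"
    and "type_entry Y (design_algebra x Y {l, m}) (Y \<inter> shell x l) (Y \<inter> shell x m) = e"
    and "type_entry Y (design_algebra x Y {l, m}) (Y \<inter> shell x m) (Y \<inter> shell x l) = e"
    and "type_entry Y (design_algebra x Y {l, m}) (Y \<inter> shell x m) (Y \<inter> shell x m) = e + 1"
proof -
  have ne: "Y \<inter> shell x k \<noteq> {}" if "k \<in> {l, m}" for k
    using layer_nonempty[OF that] layer_image[of k] by blast
  show "coherent_algebra Y (design_algebra x Y {l, m})"
    by (intro coherent_algebra_design_algebra support_shells design_algebra_mult)
  show "fibers Y (design_algebra x Y {l, m}) = {Y \<inter> shell x l, Y \<inter> shell x m}"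
    using fibers_design_algebra[OF support_shells ne] by simp
  show "Y \<inter> shell x l \<noteq> Y \<inter> shell x m"
    using ne[of l] params by (auto simp: shell_def)
  note type = type_entry_design_algebra[OF support_shells]
  have off: "card (shell_distances x Y l m) = e"
    using card_shell_distances[of l m] separations_off(1) params by simp
  show "type_entry Y (design_algebra x Y {l, m}) (Y \<inter> shell x l) (Y \<inter> shell x l) = e + 1"
    "type_entry Y (design_algebra x Y {l, m}) (Y \<inter> shell x m) (Y \<inter> shell x m) = e + 1"
    using type[of l l] type[of m m] card_shell_distances[of l l] card_shell_distances[of m m]
      card_separations_same[of l] card_separations_same[of m] by simp_all
  show "type_entry Y (design_algebra x Y {l, m}) (Y \<inter> shell x l) (Y \<inter> shell x m) = e"
    "type_entry Y (design_algebra x Y {l, m}) (Y \<inter> shell x m) (Y \<inter> shell x l) = e"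
    using type[of l m] type[of m l] off shell_distances_commute[of x Y m l] by simp_all
qed

lemma psi_diag_zeros:
  assumes "k \<in> {l, m}"
  shows "{\<xi>. psi_diag CARD('n) e k (shell_weight x \<omega> k)
      (kappa CARD('n) e l m (shell_weight x \<omega> l) (shell_weight x \<omega> m)) \<xi> = 0}
    = {\<xi>. \<xi> \<noteq> 0 \<and> 2 * \<xi> \<in> of_nat ` shell_distances x Y k k}"
    (is "?Z = ?S")
    and "{\<xi>. psi_diag CARD('n) e k (shell_weight x \<omega> k)
      (kappa CARD('n) e l m (shell_weight x \<omega> l) (shell_weight x \<omega> m)) \<xi> = 0} \<subseteq> \<int>"
proof -
  have Z: "?Z = of_nat ` (separations k k - {0})"
    unfolding shell_weight_eq \<kappa>_def[symmetric] by (rule separations_same(2)[OF assms])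
  have "?S = of_nat ` (separations k k - {0})"
    unfolding shell_distances_eq[OF order_refl] by (auto simp: image_iff)
  then show "?Z = ?S" using Z by simp
  show "?Z \<subseteq> \<int>" unfolding Z by auto
qed

lemma psi_off_zeros:
  shows "{\<xi>. psi_off CARD('n) e l m \<xi> = 0}
    = {\<xi>. 2 * \<xi> + of_nat m - of_nat l \<in> of_nat ` shell_distances x Y l m}"
    and "{\<xi>. psi_off CARD('n) e l m \<xi> = 0} \<subseteq> \<int>"
proof -
  have le: "l \<le> m" using params by simp
  have "2 * \<xi> + of_nat m - of_nat l = of_nat (2 * j + (m - l)) \<longleftrightarrow> \<xi> = of_nat j" for \<xi> :: complex and j
    using le by (simp add: of_nat_diff)
  then have "{\<xi> :: complex. 2 * \<xi> + of_nat m - of_nat l \<in> of_nat ` shell_distances x Y l m}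
      = of_nat ` separations l m"
    unfolding shell_distances_eq[OF le] image_image by (auto simp: image_iff)
  then show "{\<xi>. psi_off CARD('n) e l m \<xi> = 0}
    = {\<xi>. 2 * \<xi> + of_nat m - of_nat l \<in> of_nat ` shell_distances x Y l m}"
    using separations_off(2) by simp
  show "{\<xi>. psi_off CARD('n) e l m \<xi> = 0} \<subseteq> \<int>" unfolding separations_off(2) by auto
qed

end

theorem theorem5p3:
  fixes x :: "bool ^ 'n" and \<omega> :: "bool ^ 'n \<Rightarrow> real" and Y :: "(bool ^ 'n) set"
    and n e l m :: nat and \<omega>\<^sub>l \<omega>\<^sub>m \<kappa> :: real
  assumes "n = CARD('n)" and "1 \<le> e" and "e \<le> l" and "l < m" and "m \<le> n - l"
    and "tight_relative_design x e {l, m} Y \<omega>"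
    and "\<omega>\<^sub>l = shell_weight x \<omega> l" and "\<omega>\<^sub>m = shell_weight x \<omega> m"
    and "\<kappa> = kappa n e l m \<omega>\<^sub>l \<omega>\<^sub>m"
  shows "(coherent_algebra Y (design_algebra x Y {l, m}) \<and>
          fibers Y (design_algebra x Y {l, m}) = {Y \<inter> shell x l, Y \<inter> shell x m} \<and>
          Y \<inter> shell x l \<noteq> Y \<inter> shell x m \<and>
          type_entry Y (design_algebra x Y {l, m}) (Y \<inter> shell x l) (Y \<inter> shell x l) = e + 1 \<and>
          type_entry Y (design_algebra x Y {l, m}) (Y \<inter> shell x l) (Y \<inter> shell x m) = e \<and>
          type_entry Y (design_algebra x Y {l, m}) (Y \<inter> shell x m) (Y \<inter> shell x l) = e \<and>
          type_entry Y (design_algebra x Y {l, m}) (Y \<inter> shell x m) (Y \<inter> shell x m) = e + 1)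
       \<and> ({\<xi>. psi_diag n e l \<omega>\<^sub>l \<kappa> \<xi> = 0} = {\<xi>. \<xi> \<noteq> 0 \<and> 2 * \<xi> \<in> of_nat ` shell_distances x Y l l} \<and>
          {\<xi>. psi_diag n e m \<omega>\<^sub>m \<kappa> \<xi> = 0} = {\<xi>. \<xi> \<noteq> 0 \<and> 2 * \<xi> \<in> of_nat ` shell_distances x Y m m} \<and>
          {\<xi>. psi_off n e l m \<xi> = 0}
            = {\<xi>. 2 * \<xi> + of_nat m - of_nat l \<in> of_nat ` shell_distances x Y l m} \<and>
          {\<xi>. psi_diag n e l \<omega>\<^sub>l \<kappa> \<xi> = 0} \<subseteq> \<int> \<and>
          {\<xi>. psi_diag n e m \<omega>\<^sub>m \<kappa> \<xi> = 0} \<subseteq> \<int> \<and>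
          {\<xi>. psi_off n e l m \<xi> = 0} \<subseteq> \<int>)"
proof -
  have tw: "tight_weight (\<lambda>A. \<omega> (point_of x A)) e l m"
    using assms by (intro tight_design_tight_weight) auto
  have Y: "Y = {y. 0 < \<omega> y}"
    using assms(6) by (simp add: tight_relative_design_def relative_design_def weighted_subset_def)
  note diag = psi_diag_zeros[OF tw Y] and off = psi_off_zeros[OF tw Y]
  show ?thesis
    unfolding assms(1,7-9)
    by (intro conjI design_algebra_structure[OF tw Y] diag off) simp_all
qed

end
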